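(* Let $\mu\in(0,\underline\mu]$, $\delta,\gamma^0>0$, and let $\mathbf{x}^0$ be arbitrary. Let $\{q_k\}_{k\ge0}\subset\mathbb{Z}_+$ satisfy $\sum_{k=1}^\infty\beta^{q_{k-1}}k^4<\infty$. Then for all $B>0$ chosen sufficiently large (i.e., there is $\bar B$ such that the following holds for every $B\ge\bar B$; if all $g_i$, $i\in\mathcal{N}$, are affine, one can set $B=0$), the iterate sequence $\{\mathbf{x}^k,\boldsymbol{\theta}^k,\boldsymbol{\nu}^k\}_{k\ge0}$ generated by Algorithm DPDA-TV (defined in the context) starting from $(\boldsymbol{\theta}^0,\boldsymbol{\nu}^0)=(\mathbf{0},\mathbf{0})$ and $\mathbf{x}^0$ satisfies the following. The sequence $\{\mathbf{x}^k\}_{k\ge0}$ converges to $\mathbf{x}^*=\mathbf{1}\otimes x^*$ (i.e. $x^*$ repeated in all $N$ blocks), where $x^*$ is the optimal solution of problem (P). Moreover, there is a sequence $\Lambda(K)\geq 0$ with $\Lambda(K)=\mathcal{O}\big(\sum_{k=1}^K\beta^{q_{k-1}}k^4\big)$, hence $\sup_{K\in\mathbb{Z}_+}\Lambda(K)<\infty$, such that for all $K\ge1$ $$\max\Big\{|\varphi(\bar{\mathbf{x}}^K)-\varphi(\mathbf{x}^* )|,\ d_{\Xi}(\bar{\mathbf{x}}^K)+\sum_{i\in\mathcal{N}}\|\theta_i^*\|\,d_{-\mathcal{K}_i}(g_i(\bar x_i^K))\Big\}\le\frac{\Lambda(K)}{\mathcal{W}_K}=\mathcal{O}(1/K^2),$$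 $$\|\mathbf{x}^K-\mathbf{x}^*\|^2\le\frac{\tilde\tau^K}{\gamma^K}\,4\gamma^0\,\Lambda(K)=\mathcal{O}(1/K^2),$$ and the parameters satisfy $\max\{\mathcal{W}_K,\gamma^K/\tilde\tau^K\}=\mathcal{O}(K^2)$, where $\mathcal{W}_K=\sum_{k=1}^K\gamma^{k-1}/\gamma^0$ and $\bar{\mathbf{x}}^K=\mathcal{W}_K^{-1}\sum_{k=1}^K\frac{\gamma^{k-1}}{\gamma^0}\mathbf{x}^k$ (with blocks $\bar x_i^K$).
   Context: Problem. $\mathcal{N}=\{1,\dots,N\}$. For $i\in\mathcal{N}$, $\varphi_i=\rho_i+f_i$ with $\rho_i:\mathbb{R}^n\to\mathbb{R}\cup\{+\infty\}$ proper closed convex (possibly non-smooth) and $f_i:\mathbb{R}^n\to\mathbb{R}$ convex and smooth; $\mathcal{K}_i\subseteq\mathbb{R}^{m_i}$ is a closed convex cone. Problem (P): $\min_{x\in\mathbb{R}^n}\{\sum_{i\in\mathcal{N}}\varphi_i(x):\ g_i(x)\in-\mathcal{K}_i,\ i\in\mathcal{N}\}$. Assumptions. (1) $f_i$ is differentiable on an open set containing $\mathrm{dom}\,\rho_i$ with $L_{f_i}$-Lipschitz gradient, $L_{f_i}>0$; $L_{\max}(f)=\max_i L_{f_i}$. (2) The duality gap for (P) is zero and a primal-dual solution $(x^*,\boldsymbol{\theta}^* )$ of (P) exists, $\boldsymbol{\theta}^*=[\theta_i^*]_{i\in\mathcal{N}}$, $\theta_i^*\in\mathcal{K}_i^*$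 being the multiplier of $g_i(x)\in-\mathcal{K}_i$; such a pair is fixed. (3) $g_i:\mathbb{R}^n\to\mathbb{R}^{m_i}$ is differentiable and $\mathcal{K}_i$-convex (i.e. $\lambda g_i(x)+(1-\lambda)g_i(y)-g_i(\lambda x+(1-\lambda)y)\in\mathcal{K}_i$ for all $x,y$, $\lambda\in[0,1]$), its Jacobian $\mathbf{J}g_i$ is $L_{g_i}$-Lipschitz, $L_{g_i}>0$, and $\|\mathbf{J}g_i(x)\|\le C_{g_i}$ for $x\in\mathrm{dom}\,\rho_i$, $C_{g_i}>0$; $L_{\max}(G)=\max_iL_{g_i}$. (4) $\bar f=\sum_i f_i$ is strongly convex with modulus $\bar\mu>0$, each $f_i$ is strongly convex with modulus $\mu_i>0$; $\underline\mu=\min_i\mu_i>0$. (5) Compact domains: $\Delta_i=\max_{x\in\mathrm{dom}\,\varphi_i}\|x\|$ and $\Delta=\max_i\Delta_i<\infty$. Notation. $\mathcal{X}=\prod_{i\in\mathcal{N}}\mathbb{R}^n$, $\mathbf{x}=[x_i]_{i\in\mathcal{N}}\in\mathcal{X}$, $\varphi(\mathbf{x})=\sum_i\varphi_i(x_i)$. $\Xi=\{\mathbf{x}\in\mathcal{X}:\exists\bar x\in\mathbb{R}^n,\ x_i=\bar x\ \forall i\}$ is the consensus set; $\mathcal{B}_0=\{x\in\mathbb{R}^n:\|x\|\le2\Delta\}$. $\mathcal{K}^*$ is the dual cone, $\mathcal{P}_S$ the Euclidean projection, $d_S(w)=\|\mathcal{P}_S(w)-w\|$, $\mathbf{prox}_{\tau\rho}(x)=\arg\min_y\{\tau\rho(y)+\frac12\|y-x\|^2\}$.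 Network and approximate averaging. $\{\mathcal{G}^t\}_{t\ge0}$, $\mathcal{G}^t=(\mathcal{N},\mathcal{E}^t)$, is a time-varying collection of either all directed or all undirected graphs; at time $t$ nodes may exchange data only with neighbors in $\mathcal{G}^t$ (for directed graphs, receive only from in-neighbors and send only to out-neighbors). Communication is synchronous and instantaneous, one communication round per tick of a global clock, and local operations of each node (projections onto $\mathcal{K}_i^*$, proximal maps of $\rho_i$, gradients of $f_i$) can be completed between two ticks. For each $k\ge0$ there is a map $\mathcal{R}^k=[\mathcal{R}_i^k]_{i\in\mathcal{N}}:\mathcal{X}\to\mathcal{X}$, with $\mathcal{R}_i^k$ computable from information locally available to node $i$, whose decentralized computation requires $q_k$ communication rounds, and there exist $\Gamma>0$, $\beta\in(0,1)$ such that for all $k\ge0$ $$\|\mathcal{R}^k(\boldsymbol{\omega})-\mathcal{P}_\Xi(\boldsymbol{\omega})\|\le N\,\Gamma\,\beta^{q_k}\|\boldsymbol{\omega}\|\qquad\forall\boldsymbol{\omega}\in\mathcal{X}.$$ Algorithm DPDA-TV$(\mathbf{x}^0,\boldsymbol{\theta}^0,\gamma^0,\mu,\delta,B,\{q_k\})$. Initialization: $\mathbf{x}^{-1}=\mathbf{x}^0$, $\boldsymbol{\theta}^{-1}=\boldsymbol{\theta}^0$, $\boldsymbol{\nu}^{-1}=\boldsymbol{\nu}^0=\mathbf{0}$, $\tilde\tau^0=\big(L_{\max}(f)+2\gamma^0(1+\delta)+2BL_{\max}(G)\big)^{-1}$, $\eta^0=0$, $\kappa_i^0=\gamma^0\delta/C_{g_i}^2$.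 For $k\ge0$ and all $i\in\mathcal{N}$: 1. $\tau^k=(1/\tilde\tau^k+\mu)^{-1}$; 2. $p_i^k=(1+\eta^k)\mathbf{J}g_i(x_i^k)^\top\theta_i^k-\eta^k\mathbf{J}g_i(x_i^{k-1})^\top\theta_i^{k-1}+(1+\eta^k)\nu_i^k-\eta^k\nu_i^{k-1}$; 3. $x_i^{k+1}=\mathbf{prox}_{\tau^k\rho_i}\big[x_i^k-\tau^k(\nabla f_i(x_i^k)+p_i^k)\big]$; 4. $\theta_i^{k+1}=\mathcal{P}_{\mathcal{K}_i^*}\big(\theta_i^k+\kappa_i^kg_i(x_i^{k+1})\big)$; 5. $\omega_i^k=\frac1{\gamma^k}\nu_i^k+x_i^{k+1}$; 6. (using $q_k$ communication rounds) $\nu_i^{k+1}=\gamma^k\big(\omega_i^k-\mathcal{P}_{\mathcal{B}_0}(\mathcal{R}_i^k(\boldsymbol{\omega}^k))\big)$, $\boldsymbol{\omega}^k=[\omega_i^k]_i$; 7. $\gamma^{k+1}=\gamma^k\sqrt{1+\mu\tilde\tau^k}$, $\eta^{k+1}=\gamma^k/\gamma^{k+1}$; 8. $\kappa_i^{k+1}=\gamma^{k+1}\delta/C_{g_i}^2$, $\tilde\tau^{k+1}=\tilde\tau^k\eta^{k+1}$. The $\mathcal{O}(\cdot)$ statements are as $K\to\infty$ with constants independent of $K$.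
   Formalization: The primal-dual solution (x*,θ* ) is additionally required to satisfy KKT stationarity with the sum of the nodes' subdifferentials, i.e. a multiplier for consensus exists; without it the claim fails, e.g. for two discs touching at one point. *)

theory Defs
  imports "HOL-Analysis.Analysis" "HOL-Library.Landau_Symbols"
begin

text \<open>
  The nodes are the elements of a finite type \<open>'i\<close> (so \<open>N = CARD('i)\<close>), the decision space is
  \<open>real ^ 'n\<close>, and the product space \<open>\<X>\<close> is \<open>(real ^ 'n) ^ 'i\<close> with its Euclidean norm.
\<close>

definition edom :: "('a \<Rightarrow> ereal) \<Rightarrow> 'a set" where
  "edom h = {x. h x < \<infinity>}"

definition ereal_epigraph :: "('a \<Rightarrow> ereal) \<Rightarrow> ('a \<times> real) set" where
  "ereal_epigraph h = {(x, r). h x \<le> ereal r}"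

definition proper_closed_convex :: "('a::euclidean_space \<Rightarrow> ereal) \<Rightarrow> bool" where
  "proper_closed_convex h \<longleftrightarrow>
     (\<forall>x. h x \<noteq> -\<infinity>) \<and> edom h \<noteq> {} \<and> closed (ereal_epigraph h) \<and> convex (ereal_epigraph h)"

definition strongly_convex :: "real \<Rightarrow> ('a::real_normed_vector \<Rightarrow> real) \<Rightarrow> bool" where
  "strongly_convex m h \<longleftrightarrow>
     (\<forall>x y. \<forall>t\<in>{0..1}. h (t *\<^sub>R x + (1 - t) *\<^sub>R y)
        \<le> t * h x + (1 - t) * h y - m / 2 * t * (1 - t) * (norm (x - y))\<^sup>2)"

definition cone_convex :: "'b set \<Rightarrow> ('a::real_vector \<Rightarrow> 'b::real_vector) \<Rightarrow> bool" where
  "cone_convex C h \<longleftrightarrow>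
     (\<forall>x y. \<forall>t\<in>{0..1}. t *\<^sub>R h x + (1 - t) *\<^sub>R h y - h (t *\<^sub>R x + (1 - t) *\<^sub>R y) \<in> C)"

definition prox :: "real \<Rightarrow> ('a::euclidean_space \<Rightarrow> ereal) \<Rightarrow> 'a \<Rightarrow> 'a" where
  "prox t h x = arg_min (\<lambda>y. ereal t * h y + ereal ((norm (y - x))\<^sup>2 / 2)) (\<lambda>_. True)"

definition proj_dist :: "'a::euclidean_space set \<Rightarrow> 'a \<Rightarrow> real" where
  "proj_dist S w = norm (closest_point S w - w)"

text \<open>Unspecified at points where \<open>h\<close> is not differentiable.\<close>

definition gradient :: "('a::real_inner \<Rightarrow> real) \<Rightarrow> 'a \<Rightarrow> 'a" where
  "gradient h x = (THE D. GDERIV h x :> D)"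

definition spectral_norm :: "real ^ 'n ^ 'm \<Rightarrow> real" where
  "spectral_norm A = onorm (\<lambda>v. A *v v)"

text \<open>
  The constraint space of a node has a dimension that depends on the node.  These spaces are
  represented inside one ambient space \<open>real ^ 'm\<close>: the space of node \<open>i\<close> is the coordinate subspace
  \<open>coord_space (J i)\<close> of dimension \<open>card (J i)\<close>, and dual cones are taken within that subspace.
  Since \<open>'m\<close> and \<open>J\<close> are arbitrary, every family of dimensions is covered.
\<close>

definition coord_space :: "'m set \<Rightarrow> (real ^ 'm) set" where
  "coord_space J = {v. \<forall>j. j \<notin> J \<longrightarrow> v $ j = 0}"

definition dual_cone :: "'m set \<Rightarrow> (real ^ 'm) set \<Rightarrow> (real ^ 'm) set" where
  "dual_cone J C = {\<theta> \<in> coord_space J. \<forall>w\<in>C. \<theta> \<bullet> w \<ge> 0}"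

definition phi ::
  "('i \<Rightarrow> 'a \<Rightarrow> ereal) \<Rightarrow> ('i \<Rightarrow> 'a \<Rightarrow> real) \<Rightarrow> 'i \<Rightarrow> 'a \<Rightarrow> ereal" where
  "phi \<rho> f i x = \<rho> i x + ereal (f i x)"

definition objective ::
  "('i::finite \<Rightarrow> 'a \<Rightarrow> ereal) \<Rightarrow> ('i \<Rightarrow> 'a \<Rightarrow> real) \<Rightarrow> 'a \<Rightarrow> ereal" where
  "objective \<rho> f x = (\<Sum>i\<in>UNIV. phi \<rho> f i x)"

definition sep_objective ::
  "('i::finite \<Rightarrow> 'a \<Rightarrow> ereal) \<Rightarrow> ('i \<Rightarrow> 'a \<Rightarrow> real) \<Rightarrow> 'a ^ 'i \<Rightarrow> ereal" where
  "sep_objective \<rho> f x = (\<Sum>i\<in>UNIV. phi \<rho> f i (x $ i))"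

definition feasible ::
  "('i \<Rightarrow> 'a \<Rightarrow> 'b::real_vector) \<Rightarrow> ('i \<Rightarrow> 'b set) \<Rightarrow> 'a set" where
  "feasible g K = {x. \<forall>i. g i x \<in> uminus ` K i}"

definition primal_solution ::
  "('i::finite \<Rightarrow> 'a \<Rightarrow> ereal) \<Rightarrow> ('i \<Rightarrow> 'a \<Rightarrow> real) \<Rightarrow> ('i \<Rightarrow> 'a \<Rightarrow> 'b::real_vector) \<Rightarrow>
   ('i \<Rightarrow> 'b set) \<Rightarrow> 'a \<Rightarrow> bool" where
  "primal_solution \<rho> f g K x \<longleftrightarrow>
     x \<in> feasible g K \<and> objective \<rho> f x < \<infinity> \<and>
     (\<forall>y\<in>feasible g K. objective \<rho> f x \<le> objective \<rho> f y)"

definition multipliers ::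
  "('i::finite \<Rightarrow> 'm set) \<Rightarrow> ('i \<Rightarrow> (real ^ 'm) set) \<Rightarrow> (real ^ 'm ^ 'i) set" where
  "multipliers J K = {\<theta>. \<forall>i. \<theta> $ i \<in> dual_cone (J i) (K i)}"

definition dual_function ::
  "('i::finite \<Rightarrow> 'a \<Rightarrow> ereal) \<Rightarrow> ('i \<Rightarrow> 'a \<Rightarrow> real) \<Rightarrow> ('i \<Rightarrow> 'a \<Rightarrow> real ^ 'm) \<Rightarrow>
   real ^ 'm ^ 'i \<Rightarrow> ereal" where
  "dual_function \<rho> f g \<theta> = (INF x. objective \<rho> f x + ereal (\<Sum>i\<in>UNIV. \<theta> $ i \<bullet> g i x))"

definition dual_solution ::
  "('i::finite \<Rightarrow> 'a \<Rightarrow> ereal) \<Rightarrow> ('i \<Rightarrow> 'a \<Rightarrow> real) \<Rightarrow> ('i \<Rightarrow> 'a \<Rightarrow> real ^ 'm) \<Rightarrow>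
   ('i \<Rightarrow> 'm set) \<Rightarrow> ('i \<Rightarrow> (real ^ 'm) set) \<Rightarrow> real ^ 'm ^ 'i \<Rightarrow> bool" where
  "dual_solution \<rho> f g J K \<theta> \<longleftrightarrow>
     \<theta> \<in> multipliers J K \<and>
     (\<forall>\<theta>'\<in>multipliers J K. dual_function \<rho> f g \<theta>' \<le> dual_function \<rho> f g \<theta>)"

definition subdifferential :: "('a::real_inner \<Rightarrow> ereal) \<Rightarrow> 'a \<Rightarrow> 'a set" where
  "subdifferential h x = {s. \<forall>y. h x + ereal (s \<bullet> (y - x)) \<le> h y}"

text \<open>
  The stationarity condition of the Karush-Kuhn-Tucker system,
  \<open>0 \<in> \<Sum>i. \<partial>\<phi>\<^sub>i(x) + Jg\<^sub>i(x)\<^sup>T \<theta>\<^sub>i\<close>, with the sum of the subdifferentials of the nodes.  It implies that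
  \<open>x\<close> minimizes the Lagrangian at \<open>\<theta>\<close>.  The converse is the sum rule for subdifferentials, which can
  fail when the relative interiors of the domains of the \<open>\<phi>\<^sub>i\<close> have no common point.
\<close>

definition stationary ::
  "('i::finite \<Rightarrow> real ^ 'n \<Rightarrow> ereal) \<Rightarrow> ('i \<Rightarrow> real ^ 'n \<Rightarrow> real) \<Rightarrow>
   ('i \<Rightarrow> real ^ 'n \<Rightarrow> real ^ 'm) \<Rightarrow> real ^ 'n \<Rightarrow> real ^ 'm ^ 'i \<Rightarrow> bool" where
  "stationary \<rho> f g x \<theta> \<longleftrightarrow>
     (\<exists>s. (\<forall>i. s i \<in> subdifferential (phi \<rho> f i) x) \<and>
          (\<Sum>i\<in>UNIV. s i + transpose (jacobian (g i) (at x)) *v (\<theta> $ i)) = 0)"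

definition primal_dual_solution ::
  "('i::finite \<Rightarrow> real ^ 'n \<Rightarrow> ereal) \<Rightarrow> ('i \<Rightarrow> real ^ 'n \<Rightarrow> real) \<Rightarrow>
   ('i \<Rightarrow> real ^ 'n \<Rightarrow> real ^ 'm) \<Rightarrow> ('i \<Rightarrow> 'm set) \<Rightarrow> ('i \<Rightarrow> (real ^ 'm) set) \<Rightarrow>
   real ^ 'n \<Rightarrow> real ^ 'm ^ 'i \<Rightarrow> bool" where
  "primal_dual_solution \<rho> f g J K x \<theta> \<longleftrightarrow>
     primal_solution \<rho> f g K x \<and> dual_solution \<rho> f g J K \<theta> \<and> stationary \<rho> f g x \<theta>"

definition zero_duality_gap ::
  "('i::finite \<Rightarrow> 'a \<Rightarrow> ereal) \<Rightarrow> ('i \<Rightarrow> 'a \<Rightarrow> real) \<Rightarrow> ('i \<Rightarrow> 'a \<Rightarrow> real ^ 'm) \<Rightarrow>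
   ('i \<Rightarrow> 'm set) \<Rightarrow> ('i \<Rightarrow> (real ^ 'm) set) \<Rightarrow> bool" where
  "zero_duality_gap \<rho> f g J K \<longleftrightarrow>
     (INF x\<in>feasible g K. objective \<rho> f x) = (SUP \<theta>\<in>multipliers J K. dual_function \<rho> f g \<theta>)"

text \<open>The suprema are attained, i.e. are the maxima \<open>\<Delta>\<^sub>i\<close>, when the domains are compact.\<close>

definition dom_radius ::
  "('i::finite \<Rightarrow> 'a::real_normed_vector \<Rightarrow> ereal) \<Rightarrow> ('i \<Rightarrow> 'a \<Rightarrow> real) \<Rightarrow> real" where
  "dom_radius \<rho> f = Max (range (\<lambda>i. SUP x\<in>edom (phi \<rho> f i). norm x))"

definition consensus :: "('a ^ 'i) set" where
  "consensus = {x. \<exists>xb. \<forall>i. x $ i = xb}"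

text \<open>
  \<open>(j, i) \<in> E t\<close> means that \<open>j\<close> can send to \<open>i\<close> at tick \<open>t\<close>; undirected graphs are the symmetric
  relations.  \<open>heard E t r i\<close> consists of the nodes whose data, held at tick \<open>t\<close>, can be known to
  node \<open>i\<close> after the \<open>r\<close> communication rounds at the ticks \<open>t, \<dots>, t + r - 1\<close>.
\<close>

primrec heard :: "(nat \<Rightarrow> ('i \<times> 'i) set) \<Rightarrow> nat \<Rightarrow> nat \<Rightarrow> 'i \<Rightarrow> 'i set" where
  "heard E t 0 i = {i}"
| "heard E t (Suc r) i = heard E t r i \<union> (\<Union>j\<in>{j. (j, i) \<in> E (t + r)}. heard E t r j)"

definition computable_in_rounds ::
  "(nat \<Rightarrow> ('i \<times> 'i) set) \<Rightarrow> nat \<Rightarrow> nat \<Rightarrow> ('a ^ 'i \<Rightarrow> 'a ^ 'i) \<Rightarrow> bool" where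
  "computable_in_rounds E t r F \<longleftrightarrow>
     (\<forall>i \<omega> \<omega>'. (\<forall>j\<in>heard E t r i. \<omega> $ j = \<omega>' $ j) \<longrightarrow> F \<omega> $ i = F \<omega>' $ i)"

text \<open>
  The index \<open>k - 1\<close> is truncated at \<open>k = 0\<close>, which is exactly the initialization of the iterates
  with index \<open>-1\<close> by those with index \<open>0\<close>.  The recursion determines all the sequences.
\<close>

definition DPDA_TV ::
  "('i::finite \<Rightarrow> real ^ 'n \<Rightarrow> ereal) \<Rightarrow> ('i \<Rightarrow> real ^ 'n \<Rightarrow> real) \<Rightarrow>
   ('i \<Rightarrow> real ^ 'n \<Rightarrow> real ^ 'm) \<Rightarrow> ('i \<Rightarrow> 'm set) \<Rightarrow> ('i \<Rightarrow> (real ^ 'm) set) \<Rightarrow>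
   ('i \<Rightarrow> real) \<Rightarrow> ('i \<Rightarrow> real) \<Rightarrow> ('i \<Rightarrow> real) \<Rightarrow>
   (nat \<Rightarrow> real ^ 'n ^ 'i \<Rightarrow> real ^ 'n ^ 'i) \<Rightarrow>
   real ^ 'n ^ 'i \<Rightarrow> real ^ 'm ^ 'i \<Rightarrow> real \<Rightarrow> real \<Rightarrow> real \<Rightarrow> real \<Rightarrow>
   (nat \<Rightarrow> real ^ 'n ^ 'i) \<Rightarrow> (nat \<Rightarrow> real ^ 'm ^ 'i) \<Rightarrow> (nat \<Rightarrow> real ^ 'n ^ 'i) \<Rightarrow>
   (nat \<Rightarrow> real ^ 'n ^ 'i) \<Rightarrow> (nat \<Rightarrow> real ^ 'n ^ 'i) \<Rightarrow>
   (nat \<Rightarrow> real) \<Rightarrow> (nat \<Rightarrow> real) \<Rightarrow> (nat \<Rightarrow> real) \<Rightarrow> (nat \<Rightarrow> real) \<Rightarrow>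
   (nat \<Rightarrow> 'i \<Rightarrow> real) \<Rightarrow> bool" where
  "DPDA_TV \<rho> f g J K Lf Lg Cg R x0 \<theta>0 \<gamma>0 \<mu> \<delta> B x \<theta> \<nu> p \<omega> \<gamma> \<tau> \<tau>t \<eta> \<kappa> \<longleftrightarrow>
     x 0 = x0 \<and> \<theta> 0 = \<theta>0 \<and> \<nu> 0 = 0 \<and> \<gamma> 0 = \<gamma>0 \<and> \<eta> 0 = 0 \<and>
     \<tau>t 0 = inverse (Max (range Lf) + 2 * \<gamma>0 * (1 + \<delta>) + 2 * B * Max (range Lg)) \<and>
     (\<forall>i. \<kappa> 0 i = \<gamma>0 * \<delta> / (Cg i)\<^sup>2) \<and>
     (\<forall>k.
        \<tau> k = inverse (1 / \<tau>t k + \<mu>) \<and>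
        (\<forall>i. p k $ i =
               (1 + \<eta> k) *\<^sub>R (transpose (jacobian (g i) (at (x k $ i))) *v (\<theta> k $ i))
               - \<eta> k *\<^sub>R (transpose (jacobian (g i) (at (x (k - 1) $ i))) *v (\<theta> (k - 1) $ i))
               + (1 + \<eta> k) *\<^sub>R (\<nu> k $ i) - \<eta> k *\<^sub>R (\<nu> (k - 1) $ i)) \<and>
        (\<forall>i. x (Suc k) $ i =
               prox (\<tau> k) (\<rho> i) (x k $ i - \<tau> k *\<^sub>R (gradient (f i) (x k $ i) + p k $ i))) \<and>
        (\<forall>i. \<theta> (Suc k) $ i =
               closest_point (dual_cone (J i) (K i)) (\<theta> k $ i + \<kappa> k i *\<^sub>R g i (x (Suc k) $ i))) \<and>
        (\<forall>i. \<omega> k $ i = (1 / \<gamma> k) *\<^sub>R (\<nu> k $ i) + x (Suc k) $ i) \<and>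
        (\<forall>i. \<nu> (Suc k) $ i =
               \<gamma> k *\<^sub>R (\<omega> k $ i - closest_point (cball 0 (2 * dom_radius \<rho> f)) (R k (\<omega> k) $ i))) \<and>
        \<gamma> (Suc k) = \<gamma> k * sqrt (1 + \<mu> * \<tau>t k) \<and>
        \<eta> (Suc k) = \<gamma> k / \<gamma> (Suc k) \<and>
        (\<forall>i. \<kappa> (Suc k) i = \<gamma> (Suc k) * \<delta> / (Cg i)\<^sup>2) \<and>
        \<tau>t (Suc k) = \<tau>t k * \<eta> (Suc k))"

definition weight_sum :: "(nat \<Rightarrow> real) \<Rightarrow> nat \<Rightarrow> real" where
  "weight_sum \<gamma> K = (\<Sum>k=1..K. \<gamma> (k - 1) / \<gamma> 0)"

definition ergodic_avg :: "(nat \<Rightarrow> real) \<Rightarrow> (nat \<Rightarrow> 'a::real_vector) \<Rightarrow> nat \<Rightarrow> 'a" where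
  "ergodic_avg \<gamma> x K = inverse (weight_sum \<gamma> K) *\<^sub>R (\<Sum>k=1..K. (\<gamma> (k - 1) / \<gamma> 0) *\<^sub>R x k)"

end

theory Submission
  imports Defs
begin

text \<open>
  The parameters satisfy \<open>\<gamma>\<^sub>k \<tau>t\<^sub>k = \<gamma>\<^sub>0 \<tau>t\<^sub>0\<close> and \<open>\<gamma>\<^sub>k\<close> grows linearly. Weighting the one-step inequality of the
  accelerated primal-dual method by \<open>\<gamma>\<^sub>k\<close> makes a Lyapunov function telescope; it contains
  \<open>\<parallel>x\<^sub>k - x\<^sup>*\<parallel>\<^sup>2\<close> with the weight \<open>\<gamma>\<^sub>k / \<tau>t\<^sub>k\<close> of order \<open>k\<^sup>2\<close>, and the averaging errors enter with \<open>\<beta>\<^bsup>q\<^sub>k\<^esup> k\<^sup>4\<close>, because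
  \<open>\<nu>\<^sub>k = O(k \<gamma>\<^sub>k)\<close> holds a priori. The step sizes absorb the curvature of the constraints as long as
  the multipliers stay below \<open>B\<close>; since the initial value of the Lyapunov function is affine in \<open>B\<close>, the
  multipliers are \<open>O(\<surd>B)\<close>, and an induction closes for large \<open>B\<close>. As all the errors are summable,
  \<open>\<Lambda>\<close> can be a constant that depends on the trajectory. The starting point may lie outside the
  domains, so that the telescoping starts after the first step, which lands in the compact domains.
\<close>

section \<open>Convex analysis\<close>

text \<open>In the product space the consensus constraint has a multiplier of its own,
  \<open>\<nu>s\<close>, whose blocks sum to zero. It is built from one subgradient per node in the
  stationarity condition, and it turns optimality for (P) into a saddle inequality that splits over
  the nodes. Origin of the power 4: the averaging error is \<beta>^q_k times the norm of \<omega>_k;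
  it meets \<nu>_(k+1), of size \<gamma>_k times the same norm, and the inequality is weighted by
  another \<gamma>_k. All four factors are O(k). For \<omega>_k this is due to the ball projection,
  which keeps the increments of \<nu> below a multiple of \<gamma>_k whatever the averaging map
  returns. The threshold for B must be fixed before the run, although B enters the step sizes. So
  every constant is made uniform in B, up to one affine term. Affine constraints follow the same
  argument with Lipschitz constant 0 for the Jacobians, where the condition on the multipliers is
  void. The Lyapunov inequality keeps the test multipliers free: the optimal ones bound the
  multipliers and the distance, others, chosen after the run, give the ergodic bounds.\<close>

lemma edom_phi: "edom (phi \<rho> f i) = edom (\<rho> i)"
proof -
  have "\<rho> i x + ereal (f i x) < \<infinity> \<longleftrightarrow> \<rho> i x < \<infinity>" for x by (cases "\<rho> i x") auto
  then show ?thesis by (simp add: edom_def phi_def)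
qed

lemma edom_eq_real:
  assumes "proper_closed_convex h" "x \<in> edom h"
  shows "h x = ereal (real_of_ereal (h x))"
  using assms by (cases "h x") (auto simp: proper_closed_convex_def edom_def)

lemma proper_convex_le:
  fixes h :: "'a::euclidean_space \<Rightarrow> ereal"
  assumes "proper_closed_convex h" "x \<in> edom h" "y \<in> edom h" "0 \<le> u" "0 \<le> v" "u + v = 1"
  shows "h (u *\<^sub>R x + v *\<^sub>R y) \<le> ereal (u * real_of_ereal (h x) + v * real_of_ereal (h y))"
proof -
  have "(x, real_of_ereal (h x)) \<in> ereal_epigraph h" "(y, real_of_ereal (h y)) \<in> ereal_epigraph h"
    using assms edom_eq_real[OF assms(1)] by (auto simp: ereal_epigraph_def)
  moreover have "convex (ereal_epigraph h)" using assms by (auto simp: proper_closed_convex_def)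
  ultimately have "u *\<^sub>R (x, real_of_ereal (h x)) + v *\<^sub>R (y, real_of_ereal (h y)) \<in> ereal_epigraph h"
    using assms by (meson convexD)
  then show ?thesis by (simp add: ereal_epigraph_def)
qed

lemma convex_edom:
  fixes h :: "'a::euclidean_space \<Rightarrow> ereal"
  assumes "proper_closed_convex h"
  shows "convex (edom h)"
proof (rule convexI)
  fix x y :: 'a and u v :: real
  assume "x \<in> edom h" "y \<in> edom h" "0 \<le> u" "0 \<le> v" "u + v = 1"
  from proper_convex_le[OF assms this] show "u *\<^sub>R x + v *\<^sub>R y \<in> edom h"
    by (auto simp: edom_def elim!: le_less_trans)
qed

lemma convex_on_real_of_ereal:
  fixes h :: "'a::euclidean_space \<Rightarrow> ereal"
  assumes "proper_closed_convex h"
  shows "convex_on (edom h) (\<lambda>x. real_of_ereal (h x))"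
proof (rule convex_onI[OF _ convex_edom[OF assms]])
  fix t :: real and x y :: 'a
  assume *: "0 < t" "t < 1" "x \<in> edom h" "y \<in> edom h"
  have "h ((1 - t) *\<^sub>R x + t *\<^sub>R y) \<le> ereal ((1 - t) * real_of_ereal (h x) + t * real_of_ereal (h y))"
    using proper_convex_le[OF assms *(3,4), of "1 - t" t] * by simp
  moreover have "(1 - t) *\<^sub>R x + t *\<^sub>R y \<in> edom h"
    using convex_edom[OF assms] * by (simp add: convex_alt)
  ultimately show "real_of_ereal (h ((1 - t) *\<^sub>R x + t *\<^sub>R y))
      \<le> (1 - t) * real_of_ereal (h x) + t * real_of_ereal (h y)"
    using edom_eq_real[OF assms] by (metis ereal_less_eq(3))
qed

text \<open>The sublevel sets of the prox objective are preimages of the closed epigraph, hence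
  compact inside the domain, and nested; a point common to all nonempty ones is a minimizer. As
  \<open>prox\<close> is an \<open>arg_min\<close> given by choice, it is a minimizer once one
  exists.\<close>

lemma prox_minimizer:
  fixes h :: "'a::euclidean_space \<Rightarrow> ereal"
  assumes h: "proper_closed_convex h" and cpt: "compact (edom h)" and t: "t > 0"
  shows "ereal t * h (prox t h v) + ereal ((norm (prox t h v - v))\<^sup>2 / 2)
       \<le> ereal t * h y + ereal ((norm (y - v))\<^sup>2 / 2)"
proof -
  define F where "F y = ereal t * h y + ereal ((norm (y - v))\<^sup>2 / 2)" for y
  define S where "S a = {y \<in> edom h. F y \<le> ereal a}" for a :: real
  have le_iff: "F y \<le> ereal a \<longleftrightarrow> h y \<le> ereal ((a - (norm (y - v))\<^sup>2 / 2) / t)" for y a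
    using t h by (cases "h y") (auto simp: F_def proper_closed_convex_def field_simps)
  have "closed (S a)" for a
  proof -
    have "S a = (\<lambda>y. (y, (a - (norm (y - v))\<^sup>2 / 2) / t)) -` ereal_epigraph h"
      using le_iff by (auto simp: S_def ereal_epigraph_def edom_def intro: le_less_trans)
    moreover have "closed \<dots>"
      using h t by (intro closed_vimage continuous_intros) (auto simp: proper_closed_convex_def)
    ultimately show ?thesis by simp
  qed
  then have S_compact: "compact (S a)" for a
    using compact_Int_closed[OF cpt] by (metis (no_types, lifting) Int_absorb1 S_def mem_Collect_eq subsetI)
  obtain z where z: "z \<in> edom h" using h by (auto simp: proper_closed_convex_def)
  have F_fin: "\<bar>F y\<bar> \<noteq> \<infinity>" if "y \<in> edom h" for y
    using h that by (cases "h y") (auto simp: F_def proper_closed_convex_def edom_def)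
  have mono: "S a \<subseteq> S b" if "a \<le> b" for a b
    using that by (auto simp: S_def elim!: order_trans)
  have "(\<Inter>a\<in>{a. S a \<noteq> {}}. S a) \<noteq> {}"
  proof -
    have "edom h \<inter> \<Inter>(S ` {a. S a \<noteq> {}}) \<noteq> {}"
    proof (rule compact_imp_fip[OF cpt])
      fix \<F> assume "finite \<F>" and sub: "\<F> \<subseteq> S ` {a. S a \<noteq> {}}"
      then obtain A where A: "finite A" "A \<subseteq> {a. S a \<noteq> {}}" "\<F> = S ` A"
        by (meson finite_subset_image)
      show "edom h \<inter> \<Inter>\<F> \<noteq> {}"
      proof (cases "A = {}")
        case True then show ?thesis using z A by auto
      next
        case False
        have "S (Min A) \<noteq> {}" using A False Min_in by blast
        moreover have "S (Min A) \<subseteq> edom h \<inter> \<Inter>\<F>"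
        proof -
          have "S (Min A) \<subseteq> S a" if "a \<in> A" for a using that A(1) by (intro mono) simp
          moreover have "S (Min A) \<subseteq> edom h" by (auto simp: S_def)
          ultimately show ?thesis using A(3) by blast
        qed
        ultimately show ?thesis by blast
      qed
    qed (use \<open>\<And>a. closed (S a)\<close> in auto)
    then show ?thesis by auto
  qed
  then obtain w where w: "w \<in> S a" if "S a \<noteq> {}" for a by auto
  have "F w \<le> F y" for y
  proof (cases "y \<in> edom h")
    case True
    then obtain a where a: "F y = ereal a" using F_fin[OF True] by (cases "F y") auto
    then have "y \<in> S a" using True by (auto simp: S_def)
    then have "w \<in> S a" using w[of a] by blast
    then show ?thesis using a by (simp add: S_def)
  next
    case False
    then have "F y = \<infinity>" using t by (auto simp: F_def edom_def)
    then show ?thesis by simp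
  qed
  then have "is_arg_min F (\<lambda>_. True) w" by (auto simp: is_arg_min_linorder)
  then have "is_arg_min F (\<lambda>_. True) (arg_min F (\<lambda>_. True))"
    unfolding arg_min_def by (rule someI)
  then have "F (arg_min F (\<lambda>_. True)) \<le> F y" by (auto simp: is_arg_min_linorder)
  moreover have "prox t h v = arg_min F (\<lambda>_. True)"
    by (simp add: prox_def F_def[abs_def])
  ultimately show ?thesis by (simp add: F_def)
qed

lemma prox_in_edom:
  fixes h :: "'a::euclidean_space \<Rightarrow> ereal"
  assumes h: "proper_closed_convex h" and cpt: "compact (edom h)" and t: "t > 0"
  shows "prox t h v \<in> edom h"
proof (rule ccontr)
  assume "prox t h v \<notin> edom h"
  then have "h (prox t h v) = \<infinity>" by (auto simp: edom_def)
  moreover obtain z where z: "z \<in> edom h" using h by (auto simp: proper_closed_convex_def)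
  ultimately have "ereal t * h z + ereal ((norm (z - v))\<^sup>2 / 2) = \<infinity>"
    using prox_minimizer[OF assms, of v z] t by simp
  then show False using edom_eq_real[OF h z] by (metis PInfty_neq_ereal(1) plus_ereal.simps(1) times_ereal.simps(1))
qed

text \<open>Divide by \<open>l\<close> and let it tend to zero. This extracts a first-order
  condition from minimality along a segment.\<close>

lemma nonneg_of_quadratic:
  fixes a b :: real
  assumes "\<And>l. 0 < l \<Longrightarrow> l < 1 \<Longrightarrow> 0 \<le> l * a + l\<^sup>2 * b"
  shows "0 \<le> a"
proof (rule tendsto_lowerbound)
  show "((\<lambda>l. a + l * b) \<longlongrightarrow> a) (at_right 0)"
    by (auto intro!: tendsto_eq_intros)
  have "\<forall>\<^sub>F l in at_right (0::real). 0 < l \<and> l < 1"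
    by (auto simp: eventually_at_right_less eventually_conj_iff
        intro: eventually_at_right_real[of 0 1, THEN eventually_mono])
  then show "\<forall>\<^sub>F l in at_right 0. 0 \<le> a + l * b"
  proof eventually_elim
    case (elim l)
    then have "0 \<le> l * (a + l * b)" using assms[of l] by (simp add: algebra_simps power2_eq_square)
    then show ?case using elim by (simp add: zero_le_mult_iff)
  qed
qed simp

text \<open>Comparing the prox point \<open>p\<close> with points of the segment towards
  \<open>y\<close> and keeping the first-order term shows that \<open>(v - p) / t\<close> acts as a
  subgradient of \<open>h\<close> at \<open>p\<close>.\<close>

lemma prox_variational:
  fixes h :: "'a::euclidean_space \<Rightarrow> ereal"
  assumes h: "proper_closed_convex h" and cpt: "compact (edom h)" and t: "t > 0"
    and y: "y \<in> edom h"
  shows "real_of_ereal (h (prox t h v)) + (1 / t) * ((v - prox t h v) \<bullet> (y - prox t h v))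
       \<le> real_of_ereal (h y)"
proof -
  define p where "p = prox t h v"
  define r where "r z = real_of_ereal (h z)" for z
  have p: "p \<in> edom h" unfolding p_def by (rule prox_in_edom[OF h cpt t])
  have hr: "h z = ereal (r z)" if "z \<in> edom h" for z
    unfolding r_def using edom_eq_real[OF h that] .
  have "0 \<le> t * (r y - r p) + (p - v) \<bullet> (y - p)"
  proof (rule nonneg_of_quadratic[where b = "(norm (y - p))\<^sup>2 / 2"])
    fix l :: real assume l: "0 < l" "l < 1"
    define z where "z = (1 - l) *\<^sub>R p + l *\<^sub>R y"
    have zp: "z = p + l *\<^sub>R (y - p)" by (simp add: z_def algebra_simps)
    have z: "z \<in> edom h" using convex_edom[OF h] p y l by (simp add: convex_alt z_def)
    have "r z \<le> (1 - l) * r p + l * r y"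
      using convex_onD[OF convex_on_real_of_ereal[OF h], of l p y] p y l by (simp add: z_def r_def)
    then have "t * r z \<le> t * r p + l * t * (r y - r p)"
      using t mult_left_mono[of "r z" "(1 - l) * r p + l * r y" t] by (simp add: algebra_simps)
    moreover have "t * r p + (norm (p - v))\<^sup>2 / 2 \<le> t * r z + (norm (z - v))\<^sup>2 / 2"
      using prox_minimizer[OF h cpt t, of v z] hr[OF p] hr[OF z] unfolding p_def[symmetric] by simp
    moreover have "(norm (z - v))\<^sup>2 = (norm (p - v))\<^sup>2 + 2 * l * ((p - v) \<bullet> (y - p)) + l\<^sup>2 * (norm (y - p))\<^sup>2"
      unfolding zp power2_norm_eq_inner
      by (simp add: algebra_simps inner_commute power2_eq_square)
    ultimately have "0 \<le> l * t * (r y - r p) + l * ((p - v) \<bullet> (y - p)) + l\<^sup>2 * (norm (y - p))\<^sup>2 / 2"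
      by argo
    then show "0 \<le> l * (t * (r y - r p) + (p - v) \<bullet> (y - p)) + l\<^sup>2 * ((norm (y - p))\<^sup>2 / 2)"
      by (simp only: distrib_left mult.assoc times_divide_eq_right)
  qed
  then have "(v - p) \<bullet> (y - p) \<le> t * (r y - r p)"
    by (simp add: inner_diff_left algebra_simps)
  then show ?thesis using t by (simp add: p_def r_def field_simps)
qed

text \<open>\<open>gradient\<close> is a definite description, so a representing vector and its
  uniqueness are both required. The vector is the Riesz representative of the derivative, expanded
  in the standard basis.\<close>

lemma gradient_has_derivative:
  fixes f :: "'a::euclidean_space \<Rightarrow> real"
  assumes "f differentiable (at x)"
  shows "(f has_derivative (\<lambda>h. h \<bullet> gradient f x)) (at x)"
proof -
  obtain D where D: "(f has_derivative D) (at x)" using assms by (auto simp: differentiable_def)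
  then have "linear D" by (rule has_derivative_linear)
  have "D h = h \<bullet> (\<Sum>b\<in>Basis. D b *\<^sub>R b)" for h
  proof -
    have "D h = D (\<Sum>b\<in>Basis. (h \<bullet> b) *\<^sub>R b)" by (simp add: euclidean_representation)
    also have "\<dots> = (\<Sum>b\<in>Basis. (h \<bullet> b) * D b)"
      using \<open>linear D\<close> by (simp add: linear_sum linear_scale)
    finally show ?thesis by (simp add: inner_sum_right mult.commute)
  qed
  then have "D = (\<lambda>h. h \<bullet> (\<Sum>b\<in>Basis. D b *\<^sub>R b))" by blast
  with D have ex: "GDERIV f x :> (\<Sum>b\<in>Basis. D b *\<^sub>R b)" unfolding gderiv_def by simp
  have "GDERIV f x :> gradient f x"
    unfolding gradient_def
  proof (rule theI[where P = "\<lambda>D. GDERIV f x :> D", OF ex])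
    fix E assume "GDERIV f x :> E"
    then have "(\<lambda>h. h \<bullet> E) = (\<lambda>h. h \<bullet> (\<Sum>b\<in>Basis. D b *\<^sub>R b))"
      using ex unfolding gderiv_def by (metis has_derivative_unique)
    then have "h \<bullet> (E - (\<Sum>b\<in>Basis. D b *\<^sub>R b)) = 0" for h
      unfolding inner_diff_right by (metis right_minus_eq)
    then have "E - (\<Sum>b\<in>Basis. D b *\<^sub>R b) = 0" by (metis inner_eq_zero_iff)
    then show "E = (\<Sum>b\<in>Basis. D b *\<^sub>R b)" by simp
  qed
  then show ?thesis by (simp add: gderiv_def)
qed

lemma has_derivative_along_segment:
  fixes f :: "'a::real_normed_vector \<Rightarrow> 'b::real_normed_vector"
  assumes "(f has_derivative D) (at (x + s *\<^sub>R v))"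
  shows "((\<lambda>s. f (x + s *\<^sub>R v)) has_vector_derivative D v) (at s)"
proof -
  have "((\<lambda>s. x + s *\<^sub>R v) has_derivative (\<lambda>s. s *\<^sub>R v)) (at s)"
    by (auto intro!: derivative_eq_intros)
  from has_derivative_compose[OF this assms] have
    "((\<lambda>s. f (x + s *\<^sub>R v)) has_derivative (\<lambda>s. D (s *\<^sub>R v))) (at s)" .
  moreover have "D (s *\<^sub>R v) = s *\<^sub>R D v" for s
    using has_derivative_linear[OF assms] by (simp add: linear_scale)
  ultimately show ?thesis by (simp add: has_vector_derivative_def)
qed

lemma strongly_convex_gradient:
  fixes f :: "'a::euclidean_space \<Rightarrow> real"
  assumes sc: "strongly_convex m f" and d: "(f has_derivative (\<lambda>h. h \<bullet> G)) (at x)"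
  shows "f y \<ge> f x + G \<bullet> (y - x) + m / 2 * (norm (y - x))\<^sup>2"
proof -
  define D where "D = f y - f x - m / 2 * (norm (y - x))\<^sup>2"
  have "((\<lambda>s. f (x + s *\<^sub>R (y - x))) has_vector_derivative (y - x) \<bullet> G) (at 0)"
    by (rule has_derivative_along_segment) (use d in simp)
  then have "((\<lambda>s. f (x + s *\<^sub>R (y - x))) has_real_derivative (y - x) \<bullet> G) (at 0)"
    by (simp add: has_real_derivative_iff_has_vector_derivative)
  then have "((\<lambda>s. (f (x + s *\<^sub>R (y - x)) - f x) / s) \<longlongrightarrow> (y - x) \<bullet> G) (at 0)"
    by (simp add: has_field_derivative_iff)
  then have lim: "((\<lambda>s. (f (x + s *\<^sub>R (y - x)) - f x) / s) \<longlongrightarrow> (y - x) \<bullet> G) (at_right 0)"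
    by (rule filterlim_mono[OF _ order_refl at_le]) simp
  have "((\<lambda>s::real. D + s * (m / 2 * (norm (y - x))\<^sup>2)) \<longlongrightarrow> D) (at_right 0)"
    by (auto intro!: tendsto_eq_intros)
  from this lim have "(y - x) \<bullet> G \<le> D"
  proof (rule tendsto_le[rotated 1])
    have "\<forall>\<^sub>F s in at_right (0::real). s \<in> {0<..<1}"
      by (rule eventually_at_right_real) simp
    then show "\<forall>\<^sub>F s in at_right 0. (f (x + s *\<^sub>R (y - x)) - f x) / s \<le> D + s * (m / 2 * (norm (y - x))\<^sup>2)"
    proof eventually_elim
      case (elim s)
      have "f (s *\<^sub>R y + (1 - s) *\<^sub>R x) \<le> s * f y + (1 - s) * f x - m / 2 * s * (1 - s) * (norm (y - x))\<^sup>2"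
        using sc elim by (auto simp: strongly_convex_def)
      moreover have "s *\<^sub>R y + (1 - s) *\<^sub>R x = x + s *\<^sub>R (y - x)" by (simp add: algebra_simps)
      ultimately have "f (x + s *\<^sub>R (y - x)) - f x \<le> s * (D + s * (m / 2 * (norm (y - x))\<^sup>2))"
        unfolding D_def by (simp add: field_simps)
      then show ?case using elim by (simp add: divide_le_eq mult.commute)
    qed
  qed simp
  then show ?thesis by (simp add: D_def inner_commute)
qed

text \<open>The descent lemma: \<open>F\<close> is \<open>f\<close> along the segment minus the
  linear and quadratic terms of the bound, and the Lipschitz condition makes its derivative
  nonpositive.\<close>

lemma lipschitz_gradient_upper_bound:
  fixes f :: "'a::euclidean_space \<Rightarrow> real"
  assumes d: "\<And>x. x \<in> U \<Longrightarrow> (f has_derivative (\<lambda>h. h \<bullet> G x)) (at x)"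
    and lip: "L-lipschitz_on U G" and seg: "closed_segment x y \<subseteq> U"
  shows "f y \<le> f x + G x \<bullet> (y - x) + L / 2 * (norm (y - x))\<^sup>2"
proof -
  define v where "v = y - x"
  define F where "F s = f (x + s *\<^sub>R v) - s * (G x \<bullet> v) - L / 2 * s\<^sup>2 * (norm v)\<^sup>2" for s
  have U: "x + s *\<^sub>R v \<in> U" if "0 \<le> s" "s \<le> 1" for s
    using seg that unfolding v_def closed_segment_def
    by (smt (verit) in_mono mem_Collect_eq add_diff_eq diff_add_eq scaleR_diff_left scaleR_diff_right scaleR_one add.commute)
  have "F 1 \<le> F 0"
  proof (rule DERIV_nonpos_imp_nonincreasing[where f = F])
    fix s :: real assume s: "0 \<le> s" "s \<le> 1"
    have "((\<lambda>s. f (x + s *\<^sub>R v)) has_real_derivative v \<bullet> G (x + s *\<^sub>R v)) (at s)"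
      unfolding has_real_derivative_iff_has_vector_derivative
      by (rule has_derivative_along_segment[OF d[OF U[OF s]]])
    then have D: "(F has_real_derivative v \<bullet> G (x + s *\<^sub>R v) - G x \<bullet> v - L * s * (norm v)\<^sup>2) (at s)"
      unfolding F_def by (auto intro!: derivative_eq_intros simp: power2_eq_square)
    have "v \<bullet> G (x + s *\<^sub>R v) - G x \<bullet> v = v \<bullet> (G (x + s *\<^sub>R v) - G x)"
      by (simp add: inner_diff_right inner_commute)
    also have "\<dots> \<le> norm v * norm (G (x + s *\<^sub>R v) - G x)" by (rule norm_cauchy_schwarz)
    also have "\<dots> \<le> norm v * (L * norm (s *\<^sub>R v))"
      using lipschitz_onD[OF lip U[OF s] U[of 0]] by (intro mult_left_mono) (simp_all add: dist_norm)
    finally have "v \<bullet> G (x + s *\<^sub>R v) - G x \<bullet> v \<le> L * s * (norm v)\<^sup>2"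
      using s by (simp add: power2_eq_square mult_left_mono mult_ac)
    then show "\<exists>y. (F has_real_derivative y) (at s) \<and> y \<le> 0" using D by (metis diff_le_0_iff_le)
  qed simp
  then show ?thesis by (simp add: F_def v_def)
qed

text \<open>Pairing with a dual vector makes the cone-convex map an ordinary convex function, to
  which the gradient inequality with modulus 0 applies.\<close>

lemma inner_cone_convex_gradient:
  fixes g :: "real ^ 'n \<Rightarrow> real ^ 'm"
  assumes g: "cone_convex C g" and dif: "g differentiable (at x)" and th: "\<And>w. w \<in> C \<Longrightarrow> 0 \<le> \<theta> \<bullet> w"
  shows "\<theta> \<bullet> g x + (transpose (jacobian g (at x)) *v \<theta>) \<bullet> (y - x) \<le> \<theta> \<bullet> g y"
proof -
  have "strongly_convex 0 (\<lambda>x. \<theta> \<bullet> g x)"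
    unfolding strongly_convex_def
  proof (intro allI ballI)
    fix x y t assume "t \<in> {0..1::real}"
    then have "0 \<le> \<theta> \<bullet> (t *\<^sub>R g x + (1 - t) *\<^sub>R g y - g (t *\<^sub>R x + (1 - t) *\<^sub>R y))"
      using g th by (auto simp: cone_convex_def)
    then show "\<theta> \<bullet> g (t *\<^sub>R x + (1 - t) *\<^sub>R y)
        \<le> t * (\<theta> \<bullet> g x) + (1 - t) * (\<theta> \<bullet> g y) - 0 / 2 * t * (1 - t) * (norm (x - y))\<^sup>2"
      by (simp add: inner_diff_right inner_add_right)
  qed
  moreover have "((\<lambda>x. \<theta> \<bullet> g x) has_derivative (\<lambda>h. h \<bullet> (transpose (jacobian g (at x)) *v \<theta>))) (at x)"
  proof -
    have "(g has_derivative (\<lambda>h. jacobian g (at x) *v h)) (at x)"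
      using dif jacobian_works by blast
    from has_derivative_inner_right[OF this, of \<theta>]
    show ?thesis
      by (rule has_derivative_eq_rhs) (simp add: dot_lmul_matrix[symmetric] vector_transpose_matrix inner_commute)
  qed
  ultimately show ?thesis
    using strongly_convex_gradient[of 0 "\<lambda>x. \<theta> \<bullet> g x" _ x y] by simp
qed

lemma norm_matrix_vector_le:
  fixes A :: "real ^ 'n ^ 'm"
  shows "norm (A *v v) \<le> spectral_norm A * norm v"
  unfolding spectral_norm_def by (rule onorm) (rule matrix_vector_mul_bounded_linear)

text \<open>The transpose is the adjoint: the square of the left norm is
  \<open>v \<bullet> (A *v (transpose A *v v))\<close>, and one factor cancels.\<close>

lemma norm_transpose_vector_le:
  fixes A :: "real ^ 'n ^ 'm"
  shows "norm (transpose A *v v) \<le> spectral_norm A * norm v"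
proof -
  let ?w = "transpose A *v v"
  have "(norm ?w)\<^sup>2 = v \<bullet> (A *v ?w)"
    by (simp add: power2_norm_eq_inner dot_lmul_matrix[symmetric] vector_transpose_matrix)
  also have "\<dots> \<le> norm v * norm (A *v ?w)" by (rule norm_cauchy_schwarz)
  also have "\<dots> \<le> norm v * (spectral_norm A * norm ?w)"
    by (intro mult_left_mono norm_matrix_vector_le) simp
  finally have "norm ?w * norm ?w \<le> (spectral_norm A * norm v) * norm ?w"
    by (simp add: power2_eq_square mult_ac)
  moreover have "0 \<le> spectral_norm A"
    unfolding spectral_norm_def by (rule onorm_pos_le) (rule matrix_vector_mul_bounded_linear)
  ultimately show ?thesis by (cases "norm ?w = 0") auto
qed

section \<open>Dual cones and projections onto negative cones\<close>

lemma closed_dual_cone: "closed (dual_cone J C)"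
proof -
  have "dual_cone J C = (\<Inter>j\<in>-J. {v. v $ j = 0}) \<inter> (\<Inter>w\<in>C. {v. 0 \<le> v \<bullet> w})"
    by (auto simp: dual_cone_def coord_space_def)
  moreover have "closed {v :: real^'a. v $ j = 0}" for j
    by (intro closed_Collect_eq continuous_intros)
  moreover have "closed {v. 0 \<le> v \<bullet> w}" for w :: "real^'a"
    by (intro closed_Collect_le continuous_intros)
  ultimately show ?thesis by (auto intro!: closed_Int closed_INT)
qed

lemma convex_dual_cone: "convex (dual_cone J C)"
  by (auto simp: convex_def dual_cone_def coord_space_def inner_add_left)

lemma zero_in_dual_cone: "0 \<in> dual_cone J C"
  by (auto simp: dual_cone_def coord_space_def)

lemma dual_cone_scaleR: "v \<in> dual_cone J C \<Longrightarrow> 0 \<le> a \<Longrightarrow> a *\<^sub>R v \<in> dual_cone J C"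
  by (auto simp: dual_cone_def coord_space_def)

text \<open>The variational inequality of the projection, rewritten by the three-point identity so
  that squared distances telescope over the iterations.\<close>

lemma dual_cone_step:
  fixes \<theta> \<theta>' w :: "real ^ 'm"
  assumes "\<kappa> > 0" "\<theta>' \<in> dual_cone J C"
  defines "c \<equiv> closest_point (dual_cone J C) (\<theta> + \<kappa> *\<^sub>R w)"
  shows "(\<theta>' - c) \<bullet> w \<le> ((norm (\<theta>' - \<theta>))\<^sup>2 - (norm (\<theta>' - c))\<^sup>2 - (norm (c - \<theta>))\<^sup>2) / (2 * \<kappa>)"
proof -
  have "(\<theta> + \<kappa> *\<^sub>R w - c) \<bullet> (\<theta>' - c) \<le> 0"
    unfolding c_def by (rule closest_point_dot[OF convex_dual_cone closed_dual_cone assms(2)])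
  then have "2 * \<kappa> * ((\<theta>' - c) \<bullet> w) \<le> (norm (\<theta>' - \<theta>))\<^sup>2 - (norm (\<theta>' - c))\<^sup>2 - (norm (c - \<theta>))\<^sup>2"
    unfolding power2_norm_eq_inner by (simp add: algebra_simps inner_commute)
  then show ?thesis using assms(1) by (simp add: field_simps)
qed

lemma closest_point_dual_cone: "closest_point (dual_cone J C) v \<in> dual_cone J C"
  using closest_point_in_set[OF closed_dual_cone] zero_in_dual_cone by blast

context
  fixes C :: "(real ^ 'm) set" and J and w
  assumes C: "closed C" "convex_cone C" "C \<subseteq> coord_space J" and w: "w \<in> coord_space J"
begin

text \<open>Moreau's decomposition of \<open>w\<close> with respect to the cone of negatives of
  \<open>C\<close>.\<close>

private lemma closest_point_neg_cone:
  shows "closest_point (uminus ` C) w \<in> uminus ` C"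
    and "(w - closest_point (uminus ` C) w) \<bullet> closest_point (uminus ` C) w = 0"
    and "z \<in> C \<Longrightarrow> 0 \<le> (w - closest_point (uminus ` C) w) \<bullet> z"
proof -
  let ?S = "uminus ` C" let ?P = "closest_point ?S w"
  have cS: "closed ?S" and nS: "?S \<noteq> {}" and coS: "convex ?S" and conS: "conic ?S"
    using C by (auto simp: closed_negations convex_negations conic_negations convex_cone_def)
  show P: "?P \<in> ?S" by (rule closest_point_in_set[OF cS nS])
  have var: "(w - ?P) \<bullet> (z - ?P) \<le> 0" if "z \<in> ?S" for z
    by (rule closest_point_dot[OF coS cS that])
  \<comment> \<open>Scaling the projection by 0 and by 2 stays in the cone and tests the variational
    inequality in both directions.\<close>
  have "(w - ?P) \<bullet> (0 *\<^sub>R ?P - ?P) \<le> 0" "(w - ?P) \<bullet> (2 *\<^sub>R ?P - ?P) \<le> 0"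
    by (intro var conicD[OF conS P]; simp)+
  then show eq: "(w - ?P) \<bullet> ?P = 0" by (simp add: scaleR_2)
  assume "z \<in> C"
  then have "(w - ?P) \<bullet> (- z - ?P) \<le> 0" by (intro var) auto
  with eq show "0 \<le> (w - ?P) \<bullet> z" by (simp add: inner_diff_right)
qed

text \<open>Makes the constraint residual a legitimate test multiplier. Membership in the coordinate
  subspace has to be checked because dual cones are taken inside it.\<close>

lemma residual_in_dual_cone: "w - closest_point (uminus ` C) w \<in> dual_cone J C"
proof -
  have "closest_point (uminus ` C) w \<in> coord_space J"
    using closest_point_neg_cone(1) C(3) by (auto simp: coord_space_def)
  then show ?thesis using closest_point_neg_cone(3) w by (auto simp: dual_cone_def coord_space_def)
qed

lemma inner_residual: "(w - closest_point (uminus ` C) w) \<bullet> w = (proj_dist (uminus ` C) w)\<^sup>2"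
  using closest_point_neg_cone(2)
  by (simp add: proj_dist_def norm_minus_commute power2_norm_eq_inner inner_diff_right)

text \<open>The projection is the negative of a point of \<open>C\<close>, so subtracting it from
  \<open>w\<close> can only increase the pairing with a dual vector.\<close>

lemma inner_dual_cone_le:
  assumes "\<theta> \<in> dual_cone J C"
  shows "\<theta> \<bullet> w \<le> norm \<theta> * proj_dist (uminus ` C) w"
proof -
  obtain z where z: "z \<in> C" "closest_point (uminus ` C) w = - z"
    using closest_point_neg_cone(1) by auto
  then have "\<theta> \<bullet> w \<le> \<theta> \<bullet> (w - closest_point (uminus ` C) w)"
    using assms by (auto simp: dual_cone_def inner_diff_right inner_add_right)
  also have "\<dots> \<le> norm \<theta> * norm (w - closest_point (uminus ` C) w)" by (rule norm_cauchy_schwarz)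
  finally show ?thesis by (simp add: proj_dist_def norm_minus_commute)
qed

end

section \<open>The consensus subspace and inexact averaging\<close>

lemma subspace_consensus: "subspace (consensus :: ('a::real_vector ^ 'i) set)"
  unfolding subspace_def consensus_def by (force simp: vector_add_component)

text \<open>The sum condition says that \<open>c\<close> is the mean of the blocks. It follows by
  testing the projection with its translate by the residual sum itself, which is again a consensus
  vector.\<close>

lemma closest_point_consensus:
  fixes w :: "'a::euclidean_space ^ 'i::finite"
  obtains c where "\<And>i. closest_point consensus w $ i = c" "(\<Sum>i\<in>UNIV. w $ i - c) = 0"
proof -
  let ?P = "closest_point consensus w"
  have cl: "closed (consensus :: ('a ^ 'i) set)" by (rule closed_subspace[OF subspace_consensus])
  have co: "convex (consensus :: ('a ^ 'i) set)" by (rule subspace_imp_convex[OF subspace_consensus])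
  have P: "?P \<in> consensus"
    using closest_point_in_set[OF cl] subspace_0[OF subspace_consensus] by blast
  then obtain c where c: "\<And>i. ?P $ i = c" by (auto simp: consensus_def)
  let ?s = "\<Sum>i\<in>UNIV. w $ i - c"
  have "?P + (\<chi> i. ?s) \<in> consensus" using c by (auto simp: consensus_def)
  from closest_point_dot[OF co cl this, of w] have "(w - ?P) \<bullet> (\<chi> i. ?s) \<le> 0" by simp
  then have "?s \<bullet> ?s \<le> 0" by (simp add: inner_vec_def c inner_sum_left)
  then have "?s = 0" by (metis inner_eq_zero_iff inner_ge_zero order_antisym)
  then show ?thesis using c that by blast
qed

lemma norm_vec_le_const:
  fixes x :: "'a::real_normed_vector ^ 'i::finite"
  assumes "\<And>i. norm (x $ i) \<le> b"
  shows "norm x \<le> real CARD('i) * b"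
proof -
  have "norm x \<le> (\<Sum>i\<in>UNIV. norm (x $ i))" by (simp add: norm_vec_def L2_set_le_sum)
  also have "\<dots> \<le> (\<Sum>i\<in>(UNIV::'i set). b)" by (intro sum_mono assms)
  finally show ?thesis by simp
qed

lemma norm_vec_mono:
  fixes x :: "'a::real_normed_vector ^ 'i::finite" and y :: "'b::real_normed_vector ^ 'i"
  assumes "\<And>i. norm (x $ i) \<le> norm (y $ i)"
  shows "norm x \<le> norm y"
  unfolding norm_vec_def by (rule L2_set_mono) (use assms in auto)

lemma power2_norm_vec: "(norm (x :: 'a::real_inner ^ 'i::finite))\<^sup>2 = (\<Sum>i\<in>UNIV. (norm (x $ i))\<^sup>2)"
  by (simp add: power2_norm_eq_inner inner_vec_def)

text \<open>
  The two inner products that vanish, or have the right sign, when the averaging is exact: the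
  first because the projected average is a consensus vector, the second because it is a projection.
\<close>

lemma approximate_consensus_projection:
  fixes w v R :: "'a::euclidean_space ^ 'i::finite" and xs :: 'a
  assumes xs: "norm xs \<le> r" and v: "(\<Sum>i\<in>UNIV. v $ i) = 0"
    and R: "norm (R - closest_point consensus w) \<le> \<epsilon>"
  defines "y \<equiv> \<chi> i. closest_point (cball 0 r) (R $ i)"
  shows "v \<bullet> y \<le> norm v * \<epsilon>"
    and "(w - y) \<bullet> ((\<chi> i. xs) - y) \<le> \<epsilon> * (norm w + real CARD('i) * (3 * r))"
proof -
  have r: "0 \<le> r" using xs norm_ge_zero order_trans by blast
  let ?b = "closest_point (cball 0 r) :: 'a \<Rightarrow> 'a"
  obtain c where c: "\<And>i. closest_point consensus w $ i = c" "(\<Sum>i\<in>UNIV. w $ i - c) = 0"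
    by (rule closest_point_consensus[of w]) blast
  \<comment> \<open>What exact averaging would produce. The ball projection is nonexpansive block by
    block, so \<open>y\<close> lies within \<open>\<epsilon>\<close> of \<open>z\<close>.\<close>
  define z :: "'a ^ 'i" where "z = (\<chi> i. ?b c)"
  have b_le: "norm (?b u) \<le> r" for u
    using closest_point_in_set[of "cball 0 r" u] r by (simp add: dist_norm)
  have "norm (y - z) \<le> norm (R - closest_point consensus w)"
  proof (rule norm_vec_mono)
    fix i show "norm ((y - z) $ i) \<le> norm ((R - closest_point consensus w) $ i)"
      using closest_point_lipschitz[of "cball 0 r" "R $ i" c] r by (simp add: y_def z_def c dist_norm)
  qed
  with R have yz: "norm (y - z) \<le> \<epsilon>" by linarith
  have "v \<bullet> z = (\<Sum>i\<in>UNIV. v $ i) \<bullet> ?b c" by (simp add: inner_vec_def z_def inner_sum_left)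
  with v have "v \<bullet> y = v \<bullet> (y - z)" by (simp add: inner_diff_right)
  also have "\<dots> \<le> norm v * norm (y - z)" by (rule norm_cauchy_schwarz)
  also have "\<dots> \<le> norm v * \<epsilon>" by (intro mult_left_mono yz) simp
  finally show "v \<bullet> y \<le> norm v * \<epsilon>" .
  have nz: "norm z \<le> real CARD('i) * r" by (rule norm_vec_le_const) (simp add: z_def b_le)
  have ny: "norm ((\<chi> i. xs) - y) \<le> real CARD('i) * (2 * r)"
  proof (rule norm_vec_le_const)
    fix i show "norm (((\<chi> i. xs) - y) $ i) \<le> 2 * r"
      using xs b_le[of "R $ i"] norm_triangle_ineq4[of xs "y $ i"] by (simp add: y_def)
  qed
  have "(w - z) \<bullet> ((\<chi> i. xs) - z) = (\<Sum>i\<in>UNIV. w $ i - ?b c) \<bullet> (xs - ?b c)"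
    by (simp add: inner_vec_def z_def inner_sum_left)
  \<comment> \<open>The deviations from the mean cancel; what remains is a multiple of
    \<open>c - ?b c\<close>, and the sign comes from the projection of \<open>c\<close> onto the
    ball, which contains \<open>xs\<close>.\<close>
  also have "(\<Sum>i\<in>UNIV. w $ i - ?b c) = (\<Sum>i\<in>UNIV. (w $ i - c) + (c - ?b c))" by simp
  also have "\<dots> = real CARD('i) *\<^sub>R (c - ?b c)"
    unfolding sum.distrib c(2) by (simp add: scaleR_conv_of_real sum_constant_scaleR)
  also have "\<dots> \<bullet> (xs - ?b c) = real CARD('i) * ((c - ?b c) \<bullet> (xs - ?b c))" by simp
  also have "\<dots> \<le> 0"
    using closest_point_dot[of "cball 0 r" xs c] xs by (simp add: mult_nonneg_nonpos)
  finally have 1: "(w - z) \<bullet> ((\<chi> i. xs) - z) \<le> 0" .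
  have "(w - z) \<bullet> (z - y) \<le> norm (w - z) * norm (z - y)" by (rule norm_cauchy_schwarz)
  also have "\<dots> \<le> (norm w + real CARD('i) * r) * \<epsilon>"
    using norm_triangle_ineq4[of w z] nz yz r
    by (intro mult_mono) (auto simp: norm_minus_commute)
  finally have 2: "(w - z) \<bullet> (z - y) \<le> (norm w + real CARD('i) * r) * \<epsilon>" .
  have "(z - y) \<bullet> ((\<chi> i. xs) - y) \<le> norm (z - y) * norm ((\<chi> i. xs) - y)" by (rule norm_cauchy_schwarz)
  also have "\<dots> \<le> \<epsilon> * (real CARD('i) * (2 * r))"
    using yz ny r by (intro mult_mono) (auto simp: norm_minus_commute order_trans[OF norm_ge_zero yz])
  finally have 3: "(z - y) \<bullet> ((\<chi> i. xs) - y) \<le> \<epsilon> * (real CARD('i) * (2 * r))" .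
  have "(w - y) \<bullet> ((\<chi> i. xs) - y) =
      (w - z) \<bullet> ((\<chi> i. xs) - z) + (w - z) \<bullet> (z - y) + (z - y) \<bullet> ((\<chi> i. xs) - y)"
    by (simp add: algebra_simps)
  with 1 2 3 show "(w - y) \<bullet> ((\<chi> i. xs) - y) \<le> \<epsilon> * (norm w + real CARD('i) * (3 * r))"
    by (simp add: algebra_simps)
qed

text \<open>The sum of the optimality condition of the prox step, the descent lemma from
  \<open>x\<close> to \<open>x'\<close>, and strong convexity at \<open>x\<close>. Strong convexity
  lowers the coefficient of the old distance to \<open>1 / \<tau> - \<mu>\<close>, while the new
  distance keeps \<open>1 / \<tau>\<close>; the acceleration exploits this difference.\<close>

lemma proximal_gradient_step:
  fixes h :: "'a::euclidean_space \<Rightarrow> ereal" and f :: "'a \<Rightarrow> real" and p :: 'a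
  assumes h: "proper_closed_convex h" and cpt: "compact (edom h)" and \<tau>: "\<tau> > 0"
    and U: "edom h \<subseteq> U" "\<And>x. x \<in> U \<Longrightarrow> f differentiable (at x)" "L-lipschitz_on U (gradient f)"
    and sc: "strongly_convex m f" and m: "\<mu> \<le> m"
    and x: "x \<in> edom h" and y: "y \<in> edom h"
  defines "x' \<equiv> prox \<tau> h (x - \<tau> *\<^sub>R (gradient f x + p))"
  shows "real_of_ereal (h x') + f x' - (real_of_ereal (h y) + f y) + p \<bullet> (x' - y)
     \<le> (1 / \<tau> - \<mu>) / 2 * (norm (x - y))\<^sup>2 - 1 / \<tau> / 2 * (norm (x' - y))\<^sup>2
        - (1 / \<tau> - L) / 2 * (norm (x' - x))\<^sup>2"
proof -
  let ?G = "gradient f x"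
  have x': "x' \<in> edom h" unfolding x'_def by (rule prox_in_edom[OF h cpt \<tau>])
  have pv: "real_of_ereal (h x') + (1 / \<tau>) * ((x - \<tau> *\<^sub>R (?G + p) - x') \<bullet> (y - x')) \<le> real_of_ereal (h y)"
    unfolding x'_def by (rule prox_variational[OF h cpt \<tau> y])
  have "closed_segment x x' \<subseteq> U"
    using closed_segment_subset[OF x x' convex_edom[OF h]] U(1) by blast
  then have d: "f x' \<le> f x + ?G \<bullet> (x' - x) + L / 2 * (norm (x' - x))\<^sup>2"
    using lipschitz_gradient_upper_bound[OF gradient_has_derivative[OF U(2)] U(3)] by blast
  have "f x + ?G \<bullet> (y - x) + m / 2 * (norm (y - x))\<^sup>2 \<le> f y"
    using strongly_convex_gradient[OF sc gradient_has_derivative[OF U(2)]] x U(1) by blast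
  moreover have "\<mu> / 2 * (norm (y - x))\<^sup>2 \<le> m / 2 * (norm (y - x))\<^sup>2"
    using m by (intro mult_right_mono) auto
  ultimately have s: "f x + ?G \<bullet> (y - x) + \<mu> / 2 * (norm (x - y))\<^sup>2 \<le> f y"
    by (simp add: norm_minus_commute)
  have "(1 / \<tau>) * ((x - \<tau> *\<^sub>R (?G + p) - x') \<bullet> (y - x'))
      = (1 / \<tau>) * ((x - x') \<bullet> (y - x')) - (?G + p) \<bullet> (y - x')"
  proof -
    have "x - \<tau> *\<^sub>R (?G + p) - x' = (x - x') - \<tau> *\<^sub>R (?G + p)" by simp
    then show ?thesis using \<tau> by (simp only: inner_diff_left inner_scaleR_left) (simp add: right_diff_distrib)
  qed
  moreover have "(1 / \<tau>) * ((x - x') \<bullet> (y - x')) = (1 / \<tau>) * (norm (x' - y))\<^sup>2 / 2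
      + (1 / \<tau>) * (norm (x' - x))\<^sup>2 / 2 - (1 / \<tau>) * (norm (x - y))\<^sup>2 / 2"
  proof -
    have "(x - x') \<bullet> (y - x') = (norm (x' - y))\<^sup>2 / 2 + (norm (x' - x))\<^sup>2 / 2 - (norm (x - y))\<^sup>2 / 2"
      unfolding power2_norm_eq_inner by (simp add: inner_diff_left inner_diff_right inner_commute field_simps)
    then show ?thesis by (simp only: distrib_left right_diff_distrib times_divide_eq_right)
  qed
  moreover have "(?G + p) \<bullet> (y - x') = ?G \<bullet> (y - x) - ?G \<bullet> (x' - x) - p \<bullet> (x' - y)"
    by (simp add: algebra_simps)
  ultimately have "(1 / \<tau>) * ((x - \<tau> *\<^sub>R (?G + p) - x') \<bullet> (y - x'))
     = (1 / \<tau>) * (norm (x' - y))\<^sup>2 / 2 + (1 / \<tau>) * (norm (x' - x))\<^sup>2 / 2 - (1 / \<tau>) * (norm (x - y))\<^sup>2 / 2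
       - ?G \<bullet> (y - x) + ?G \<bullet> (x' - x) + p \<bullet> (x' - y)"
    by linarith
  moreover have "(1 / \<tau> - \<mu>) / 2 * (norm (x - y))\<^sup>2 - 1 / \<tau> / 2 * (norm (x' - y))\<^sup>2 - (1 / \<tau> - L) / 2 * (norm (x' - x))\<^sup>2
     = (1 / \<tau>) * (norm (x - y))\<^sup>2 / 2 - \<mu> / 2 * (norm (x - y))\<^sup>2 - (1 / \<tau>) * (norm (x' - y))\<^sup>2 / 2
       - (1 / \<tau>) * (norm (x' - x))\<^sup>2 / 2 + L / 2 * (norm (x' - x))\<^sup>2"
    by (simp add: left_diff_distrib diff_divide_distrib)
  ultimately show ?thesis using pv d s by linarith
qed

lemma young:
  fixes a b c :: real
  assumes "c > 0"
  shows "a * b \<le> a\<^sup>2 / (2 * c) + c / 2 * b\<^sup>2"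
proof -
  have "0 \<le> (a - c * b)\<^sup>2 / (2 * c)" using assms by simp
  also have "\<dots> = a\<^sup>2 / (2 * c) + c / 2 * b\<^sup>2 - a * b"
    using assms by (simp add: field_simps power2_eq_square)
  finally show ?thesis by simp
qed

text \<open>The difference splits into the transpose of \<open>A\<close> applied to
  \<open>\<theta> - \<theta>'\<close> and the transpose of \<open>A - A'\<close> applied to
  \<open>\<theta>'\<close>. The first part is paid for by the dual step; the second is the curvature
  of the constraints, scaled by the multiplier, and is the reason why multipliers must be
  bounded.\<close>

lemma jacobian_coupling_bound:
  fixes A A' :: "real ^ 'n ^ 'm"
  assumes A: "spectral_norm A \<le> C" and AA: "spectral_norm (A - A') \<le> l * norm u"
    and pos: "C > 0" "c > 0" "l \<ge> 0"
  shows "\<bar>(transpose A *v \<theta> - transpose A' *v \<theta>') \<bullet> v\<bar>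
    \<le> C\<^sup>2 / (2 * c) * (norm (\<theta> - \<theta>'))\<^sup>2 + c / 2 * (norm v)\<^sup>2
      + l * norm \<theta>' / 2 * ((norm u)\<^sup>2 + (norm v)\<^sup>2)"
proof -
  have eq: "transpose A *v \<theta> - transpose A' *v \<theta>' = transpose A *v (\<theta> - \<theta>') + transpose (A - A') *v \<theta>'"
  proof -
    have "transpose (A - A') = transpose A - transpose A'" by (simp add: transpose_def vec_eq_iff)
    then show ?thesis
      by (simp add: matrix_vector_mult_diff_distrib matrix_vector_mult_diff_rdistrib)
  qed
  have "norm (transpose A *v \<theta> - transpose A' *v \<theta>') \<le> C * norm (\<theta> - \<theta>') + l * norm u * norm \<theta>'"
    unfolding eq
    using norm_triangle_ineq norm_transpose_vector_le[of A "\<theta> - \<theta>'"]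
      norm_transpose_vector_le[of "A - A'" \<theta>'] mult_right_mono[OF A, of "norm (\<theta> - \<theta>')"]
      mult_right_mono[OF AA, of "norm \<theta>'"]
    by (smt (verit) norm_ge_zero)
  then have "\<bar>(transpose A *v \<theta> - transpose A' *v \<theta>') \<bullet> v\<bar> \<le> (C * norm (\<theta> - \<theta>') + l * norm u * norm \<theta>') * norm v"
    using Cauchy_Schwarz_ineq2 mult_right_mono norm_ge_zero order_trans by meson
  also have "\<dots> = C * norm (\<theta> - \<theta>') * norm v + l * norm \<theta>' * (norm u * norm v)"
    by (simp add: algebra_simps)
  also have "C * norm (\<theta> - \<theta>') * norm v \<le> (C * norm (\<theta> - \<theta>'))\<^sup>2 / (2 * c) + c / 2 * (norm v)\<^sup>2"
    by (rule young[OF pos(2)])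
  also have "l * norm \<theta>' * (norm u * norm v) \<le> l * norm \<theta>' * (((norm u)\<^sup>2 + (norm v)\<^sup>2) / 2)"
    using young[of 1 "norm u" "norm v"] pos(3) by (intro mult_left_mono) auto
  finally show ?thesis by (simp add: power_mult_distrib)
qed

section \<open>Step sizes\<close>

locale accelerated_steps =
  fixes \<gamma> \<tau>t \<eta> :: "nat \<Rightarrow> real" and \<mu> :: real
  assumes \<gamma>_init: "\<gamma> 0 > 0" and \<tau>t_init: "\<tau>t 0 > 0" and \<mu>_pos: "\<mu> > 0"
    and \<gamma>_Suc: "\<And>k. \<gamma> (Suc k) = \<gamma> k * sqrt (1 + \<mu> * \<tau>t k)"
    and \<eta>_Suc: "\<And>k. \<eta> (Suc k) = \<gamma> k / \<gamma> (Suc k)"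
    and \<tau>t_Suc: "\<And>k. \<tau>t (Suc k) = \<tau>t k * \<eta> (Suc k)"
begin

lemma \<gamma>_\<tau>t_invariant: "\<gamma> k > 0 \<and> \<tau>t k > 0 \<and> \<gamma> k * \<tau>t k = \<gamma> 0 * \<tau>t 0"
proof (induction k)
  case (Suc k)
  have "1 + \<mu> * \<tau>t k > 0" using Suc \<mu>_pos by (simp add: add_pos_pos)
  then have "\<gamma> (Suc k) > 0" using Suc by (simp add: \<gamma>_Suc)
  moreover from this have "\<tau>t (Suc k) > 0" using Suc by (simp add: \<tau>t_Suc \<eta>_Suc)
  moreover have "\<gamma> (Suc k) * \<tau>t (Suc k) = \<gamma> k * \<tau>t k"
    using \<open>\<gamma> (Suc k) > 0\<close> by (simp add: \<tau>t_Suc \<eta>_Suc)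
  ultimately show ?case using Suc by simp
qed (simp add: \<gamma>_init \<tau>t_init)

lemma \<gamma>_pos: "\<gamma> k > 0" and \<tau>t_pos: "\<tau>t k > 0" and \<gamma>_\<tau>t: "\<gamma> k * \<tau>t k = \<gamma> 0 * \<tau>t 0"
  using \<gamma>_\<tau>t_invariant by auto

text \<open>With \<open>c = \<mu> * \<gamma> 0 * \<tau>t 0\<close>, the square grows by
  \<open>c * \<gamma> k\<close>, a discrete form of growth with slope \<open>c / 2\<close>. Both
  linear bounds on \<open>\<gamma>\<close> are derived from this recursion.\<close>

lemma \<gamma>_Suc_square: "(\<gamma> (Suc k))\<^sup>2 = (\<gamma> k)\<^sup>2 + \<mu> * \<gamma> 0 * \<tau>t 0 * \<gamma> k"
proof -
  have "(\<gamma> (Suc k))\<^sup>2 = (\<gamma> k)\<^sup>2 * (1 + \<mu> * \<tau>t k)"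
    using \<mu>_pos \<tau>t_pos[of k] by (simp add: \<gamma>_Suc power_mult_distrib add_nonneg_nonneg)
  also have "\<dots> = (\<gamma> k)\<^sup>2 + \<mu> * \<gamma> k * (\<gamma> k * \<tau>t k)"
    by (simp add: algebra_simps power2_eq_square)
  finally show ?thesis unfolding \<gamma>_\<tau>t[of k] by (simp add: mult_ac)
qed

lemma \<gamma>_le_Suc: "\<gamma> k \<le> \<gamma> (Suc k)"
  using \<mu>_pos \<tau>t_pos[of k] \<gamma>_pos[of k] by (simp add: \<gamma>_Suc)

lemma \<gamma>_mono: "j \<le> k \<Longrightarrow> \<gamma> j \<le> \<gamma> k"
  using lift_Suc_mono_le[of \<gamma>] \<gamma>_le_Suc by blast

lemma \<gamma>_upper: "\<gamma> k \<le> \<gamma> 0 + \<mu> * \<gamma> 0 * \<tau>t 0 / 2 * real k"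
proof (induction k)
  case (Suc k)
  let ?c = "\<mu> * \<gamma> 0 * \<tau>t 0"
  have "(\<gamma> (Suc k))\<^sup>2 \<le> (\<gamma> k + ?c / 2)\<^sup>2"
    unfolding \<gamma>_Suc_square by (simp add: power2_sum)
  moreover have "0 \<le> \<gamma> k + ?c / 2"
    using \<gamma>_pos \<mu>_pos \<tau>t_pos by (simp add: less_imp_le)
  ultimately have "\<gamma> (Suc k) \<le> \<gamma> k + ?c / 2" by (rule power2_le_imp_le)
  moreover have "?c / 2 * real (Suc k) = ?c / 2 + ?c / 2 * real k"
    by (simp add: distrib_left)
  ultimately show ?case using Suc by linarith
qed simp

lemma \<gamma>_lower: "\<gamma> 0 + min (\<mu> * \<gamma> 0 * \<tau>t 0 / 4) (\<gamma> 0) * real k \<le> \<gamma> k"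
proof (induction k)
  case (Suc k)
  let ?c = "\<mu> * \<gamma> 0 * \<tau>t 0"
  \<comment> \<open>The slope \<open>a\<close> is admissible if
    \<open>a * a + 2 * (\<gamma> k * a)\<close> is at most \<open>?c * \<gamma> k\<close>. The bound
    by \<open>?c / 4\<close> takes care of the second summand, and together with
    \<open>a \<le> \<gamma> k\<close> of the first.\<close>
  define a where "a = min (?c / 4) (\<gamma> 0)"
  have c: "0 < ?c" using \<gamma>_pos \<mu>_pos \<tau>t_pos by simp
  have a: "0 < a" "a \<le> ?c / 4" "a \<le> \<gamma> k"
    using c \<gamma>_pos[of 0] \<gamma>_mono[of 0 k] unfolding a_def by linarith+
  have "a * a \<le> ?c / 4 * \<gamma> k" using a c by (intro mult_mono) auto
  moreover have "\<gamma> k * a \<le> \<gamma> k * (?c / 4)"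
    using a(2) \<gamma>_pos[of k] by (intro mult_left_mono) auto
  moreover have "0 \<le> ?c * \<gamma> k" using c \<gamma>_pos[of k] by simp
  moreover have "\<gamma> k * (?c / 4) = ?c * \<gamma> k / 4" "?c / 4 * \<gamma> k = ?c * \<gamma> k / 4" by simp_all
  ultimately have "a * a + 2 * (\<gamma> k * a) \<le> ?c * \<gamma> k" by linarith
  then have "(\<gamma> k + a)\<^sup>2 \<le> (\<gamma> (Suc k))\<^sup>2"
    unfolding \<gamma>_Suc_square power2_sum by (simp add: power2_eq_square)
  then have "\<gamma> k + a \<le> \<gamma> (Suc k)" by (rule power2_le_imp_le) (simp add: \<gamma>_pos less_imp_le)
  then show ?case using Suc unfolding a_def[symmetric] by (simp add: algebra_simps)
qed simp

text \<open>\<open>1 / \<tau>t k + \<mu>\<close> is the inverse of the step \<open>\<tau> k\<close>.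
  The weighted coefficient of the new distance in one step is thus the coefficient of the old
  distance in the next, so the primal terms telescope.\<close>

lemma ratio_Suc: "\<gamma> (Suc k) / \<tau>t (Suc k) = \<gamma> k * (1 / \<tau>t k + \<mu>)"
proof -
  have "\<gamma> (Suc k) / \<tau>t (Suc k) = (\<gamma> (Suc k))\<^sup>2 / (\<gamma> k * \<tau>t k)"
    using \<gamma>_pos[of "Suc k"] by (simp add: \<tau>t_Suc \<eta>_Suc power2_eq_square field_simps)
  also have "\<dots> = ((\<gamma> k)\<^sup>2 + \<mu> * \<gamma> k * (\<gamma> k * \<tau>t k)) / (\<gamma> k * \<tau>t k)"
    unfolding \<gamma>_Suc_square \<gamma>_\<tau>t[of k] by (simp add: mult_ac)
  also have "\<dots> = \<gamma> k * (1 / \<tau>t k + \<mu>)"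
    using \<gamma>_pos[of k] \<tau>t_pos[of k] by (simp add: field_simps power2_eq_square)
  finally show ?thesis .
qed

lemma ratio_eq: "\<gamma> k / \<tau>t k = (\<gamma> k)\<^sup>2 / (\<gamma> 0 * \<tau>t 0)"
  unfolding \<gamma>_\<tau>t[of k, symmetric] using \<gamma>_pos[of k] by (simp add: power2_eq_square)

lemma inverse_\<tau>t: "1 / \<tau>t k = \<gamma> k / \<gamma> 0 * (1 / \<tau>t 0)"
  using \<gamma>_\<tau>t[of k] \<gamma>_pos[of k] \<gamma>_pos[of 0] \<tau>t_pos[of k] \<tau>t_pos[of 0] by (simp add: field_simps)

lemma \<gamma>_\<eta>: "\<gamma> (Suc k) * \<eta> (Suc k) = \<gamma> k"
  using \<gamma>_pos[of "Suc k"] by (simp add: \<eta>_Suc)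

lemma weight_sum_eq: "weight_sum \<gamma> n = (\<Sum>k<n. \<gamma> k / \<gamma> 0)"
  unfolding weight_sum_def by (rule sum.reindex_bij_witness[of _ Suc "\<lambda>k. k - 1"]) auto

lemma weight_sum_lower:
  obtains b where "b > 0" "\<And>n. b * (real n)\<^sup>2 \<le> weight_sum \<gamma> n"
proof -
  \<comment> \<open>Capping at 1 lets the summand, at least \<open>1 + a * real n\<close>, cover the
    increment \<open>a * real n + a / 2\<close> of the quadratic lower bound.\<close>
  define a where "a = min (min (\<mu> * \<gamma> 0 * \<tau>t 0 / 4) (\<gamma> 0) / \<gamma> 0) 1"
  have a: "0 < a" "a \<le> 1" "a \<le> min (\<mu> * \<gamma> 0 * \<tau>t 0 / 4) (\<gamma> 0) / \<gamma> 0"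
    unfolding a_def using \<gamma>_pos \<mu>_pos \<tau>t_pos by auto
  have t: "1 + a * real k \<le> \<gamma> k / \<gamma> 0" for k
  proof -
    have "a * \<gamma> 0 \<le> min (\<mu> * \<gamma> 0 * \<tau>t 0 / 4) (\<gamma> 0)"
      using a(3) \<gamma>_pos[of 0] by (simp add: pos_le_divide_eq)
    then have "a * \<gamma> 0 * real k \<le> min (\<mu> * \<gamma> 0 * \<tau>t 0 / 4) (\<gamma> 0) * real k"
      by (rule mult_right_mono) simp
    with \<gamma>_lower[of k] have "\<gamma> 0 + a * \<gamma> 0 * real k \<le> \<gamma> k" by linarith
    then show ?thesis using \<gamma>_pos[of 0] by (simp add: pos_le_divide_eq algebra_simps)
  qed
  have "a / 2 * (real n)\<^sup>2 \<le> weight_sum \<gamma> n" for n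
  proof (induction n)
    case (Suc n)
    have "a / 2 * (real (Suc n))\<^sup>2 = a / 2 * (real n)\<^sup>2 + (a * real n + a / 2)"
      by (simp add: power2_eq_square algebra_simps)
    also have "a * real n + a / 2 \<le> \<gamma> n / \<gamma> 0" using t[of n] a by linarith
    finally show ?case using Suc by (simp add: weight_sum_eq)
  qed (simp add: weight_sum_def)
  then show ?thesis using a that[of "a / 2"] by simp
qed

lemma \<gamma>_linear: "\<gamma> k \<le> (\<gamma> 0 + \<mu> * \<gamma> 0 * \<tau>t 0 / 2) * real (Suc k)"
proof -
  have "0 \<le> \<gamma> 0 * real k + \<mu> * \<gamma> 0 * \<tau>t 0 / 2"
    using \<gamma>_pos \<mu>_pos \<tau>t_pos by (simp add: less_imp_le)
  moreover have "(\<gamma> 0 + \<mu> * \<gamma> 0 * \<tau>t 0 / 2) * real (Suc k)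
      = \<gamma> 0 + \<mu> * \<gamma> 0 * \<tau>t 0 / 2 * real k + (\<gamma> 0 * real k + \<mu> * \<gamma> 0 * \<tau>t 0 / 2)"
    by (simp add: distrib_left distrib_right)
  ultimately show ?thesis using \<gamma>_upper[of k] by linarith
qed

lemma weight_sum_bigo: "weight_sum \<gamma> \<in> O(\<lambda>n. (real n)\<^sup>2)"
proof (rule bigoI[of _ "(\<gamma> 0 + \<mu> * \<gamma> 0 * \<tau>t 0 / 2) / \<gamma> 0"], rule always_eventually, rule allI)
  fix n
  let ?C = "\<gamma> 0 + \<mu> * \<gamma> 0 * \<tau>t 0 / 2"
  have C: "0 \<le> ?C" using \<gamma>_pos \<mu>_pos \<tau>t_pos by (simp add: less_imp_le)
  have "weight_sum \<gamma> n \<le> (\<Sum>k<n. ?C / \<gamma> 0 * real n)"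
    unfolding weight_sum_eq
  proof (rule sum_mono)
    fix k assume "k \<in> {..<n}"
    then have "?C * real (Suc k) \<le> ?C * real n" by (intro mult_left_mono C) simp
    then have "\<gamma> k \<le> ?C * real n" using \<gamma>_linear[of k] by linarith
    then show "\<gamma> k / \<gamma> 0 \<le> ?C / \<gamma> 0 * real n" using \<gamma>_pos[of 0] by (simp add: divide_right_mono)
  qed
  moreover have "0 \<le> weight_sum \<gamma> n"
    unfolding weight_sum_eq by (intro sum_nonneg divide_nonneg_nonneg) (simp_all add: \<gamma>_pos less_imp_le)
  ultimately show "norm (weight_sum \<gamma> n) \<le> ?C / \<gamma> 0 * norm ((real n)\<^sup>2)"
    by (simp add: power2_eq_square mult_ac)
qed

lemma ratio_bigo: "(\<lambda>n. \<gamma> n / \<tau>t n) \<in> O(\<lambda>n. (real n)\<^sup>2)"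
proof (rule bigoI)
  let ?C = "\<gamma> 0 + \<mu> * \<gamma> 0 * \<tau>t 0 / 2"
  have C: "0 \<le> ?C" using \<gamma>_pos \<mu>_pos \<tau>t_pos by (simp add: less_imp_le)
  show "\<forall>\<^sub>F n in sequentially. norm (\<gamma> n / \<tau>t n) \<le> (?C * 2)\<^sup>2 / (\<gamma> 0 * \<tau>t 0) * norm ((real n)\<^sup>2)"
    using eventually_gt_at_top[of 0]
  proof eventually_elim
    case (elim n)
    have "?C * real (Suc n) \<le> ?C * (2 * real n)" using elim by (intro mult_left_mono C) simp
    then have "\<gamma> n \<le> ?C * 2 * real n" using \<gamma>_linear[of n] by linarith
    then have "(\<gamma> n)\<^sup>2 \<le> (?C * 2 * real n)\<^sup>2" by (rule power_mono) (simp add: \<gamma>_pos less_imp_le)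
    then have "\<gamma> n / \<tau>t n \<le> (?C * 2 * real n)\<^sup>2 / (\<gamma> 0 * \<tau>t 0)"
      unfolding ratio_eq using \<gamma>_pos[of 0] \<tau>t_pos[of 0] by (intro divide_right_mono) auto
    moreover have "0 \<le> \<gamma> n / \<tau>t n" using \<gamma>_pos[of n] \<tau>t_pos[of n] by simp
    ultimately show ?case by (simp add: power_mult_distrib)
  qed
qed

lemma ratio_lower:
  obtains b where "b > 0" "\<And>n. b * (real n)\<^sup>2 \<le> \<gamma> n / \<tau>t n"
proof -
  define a where "a = min (\<mu> * \<gamma> 0 * \<tau>t 0 / 4) (\<gamma> 0)"
  have a: "0 < a" unfolding a_def using \<gamma>_pos \<mu>_pos \<tau>t_pos by auto
  have "a\<^sup>2 / (\<gamma> 0 * \<tau>t 0) * (real n)\<^sup>2 \<le> \<gamma> n / \<tau>t n" for n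
  proof -
    have "a * real n \<le> \<gamma> n" using \<gamma>_lower[of n] \<gamma>_pos[of 0] unfolding a_def by linarith
    then have "(a * real n)\<^sup>2 \<le> (\<gamma> n)\<^sup>2" using a by (intro power_mono) auto
    then show ?thesis unfolding ratio_eq using \<gamma>_pos[of 0] \<tau>t_pos[of 0]
      by (simp add: power_mult_distrib divide_right_mono)
  qed
  moreover have "a\<^sup>2 / (\<gamma> 0 * \<tau>t 0) > 0" using a \<gamma>_pos[of 0] \<tau>t_pos[of 0] by simp
  ultimately show ?thesis using that by blast
qed

end

section \<open>The algorithm\<close>

text \<open>\<open>B\<close>, \<open>x0\<close> and the trajectory are kept out of this locale,
  because the threshold \<open>B_bar\<close> has to be defined before them. Optimality enters only
  through \<open>saddle\<close>, with \<open>\<nu>s\<close> the multiplier of the consensus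
  constraint; orthogonality to the consensus vectors is the condition that its blocks sum to
  zero.\<close>

locale dpda_problem =
  fixes \<rho> :: "'i::finite \<Rightarrow> real ^ 'n \<Rightarrow> ereal"
    and f :: "'i \<Rightarrow> real ^ 'n \<Rightarrow> real"
    and g :: "'i \<Rightarrow> real ^ 'n \<Rightarrow> real ^ 'm"
    and J :: "'i \<Rightarrow> 'm set"
    and K :: "'i \<Rightarrow> (real ^ 'm) set"
    and Lf Lg Cg \<mu>s :: "'i \<Rightarrow> real"
    and \<mu> \<delta> \<gamma>0 \<Gamma> \<beta> :: real
    and xs :: "real ^ 'n" and \<theta>s :: "real ^ 'm ^ 'i" and \<nu>s :: "real ^ 'n ^ 'i"
    and q :: "nat \<Rightarrow> nat"
    and R :: "nat \<Rightarrow> real ^ 'n ^ 'i \<Rightarrow> real ^ 'n ^ 'i"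
    and Gm :: real
  assumes rho: "\<And>i. proper_closed_convex (\<rho> i)"
    and cones: "\<And>i. K i \<subseteq> coord_space (J i)" "\<And>i. closed (K i)" "\<And>i. convex_cone (K i)"
    and Lf_pos: "\<And>i. Lf i > 0"
    and f_smooth: "\<And>i. \<exists>U. open U \<and> edom (\<rho> i) \<subseteq> U \<and>
           (\<forall>x\<in>U. f i differentiable (at x)) \<and> (Lf i)-lipschitz_on U (gradient (f i))"
    and g_space: "\<And>i x. g i x \<in> coord_space (J i)"
    and g_diff: "\<And>i x. g i differentiable (at x)"
    and g_convex: "\<And>i. cone_convex (K i) (g i)"
    and Lg_pos: "\<And>i. Lg i > 0"
    and Cg_pos: "\<And>i. Cg i > 0"
    and g_bound: "\<And>i x. x \<in> edom (\<rho> i) \<Longrightarrow> spectral_norm (jacobian (g i) (at x)) \<le> Cg i"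
    and f_strong: "\<And>i. strongly_convex (\<mu>s i) (f i)"
    and f_convex: "\<And>i. convex_on UNIV (f i)"
    and compact_dom: "\<And>i. compact (edom (phi \<rho> f i))"
    and averaging: "\<Gamma> > 0" "0 < \<beta>" "\<beta> < 1"
      "\<And>k w. norm (R k w - closest_point consensus w) \<le> real CARD('i) * \<Gamma> * \<beta> ^ q k * norm w"
    and mu: "0 < \<mu>" "\<mu> \<le> Min (range \<mu>s)"
    and delta: "\<delta> > 0"
    and gamma0: "\<gamma>0 > 0"
    and q_summable: "summable (\<lambda>k. \<beta> ^ q k * real (Suc k) ^ 4)"
    and xs_dom: "\<And>i. xs \<in> edom (\<rho> i)"
    and xs_feasible: "\<And>i. g i xs \<in> uminus ` K i"
    and \<theta>s_dual: "\<And>i. \<theta>s $ i \<in> dual_cone (J i) (K i)"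
    and \<nu>s_sum: "(\<Sum>i\<in>UNIV. \<nu>s $ i) = 0"
    and saddle: "\<And>z. (\<And>i. z $ i \<in> edom (\<rho> i)) \<Longrightarrow>
       0 \<le> (\<Sum>i\<in>UNIV. real_of_ereal (\<rho> i (z $ i)) + f i (z $ i))
          - (\<Sum>i\<in>UNIV. real_of_ereal (\<rho> i xs) + f i xs)
          + (\<Sum>i\<in>UNIV. \<theta>s $ i \<bullet> g i (z $ i)) + \<nu>s \<bullet> z"
    and g_le_Gm: "\<And>i z. z \<in> edom (\<rho> i) \<Longrightarrow> norm (g i z) \<le> Gm"
begin

abbreviation r :: real where "r \<equiv> dom_radius \<rho> f"

definition X\<^sub>s :: "real ^ 'n ^ 'i" where "X\<^sub>s = (\<chi> i. xs)"

text \<open>The Lagrangian of the consensus form of (P) at \<open>z\<close>, minus the optimal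
  value. The extended-valued terms enter through their real parts, which is faithful on the
  domains.\<close>

definition lagrangian_gap :: "real ^ 'm ^ 'i \<Rightarrow> real ^ 'n ^ 'i \<Rightarrow> real ^ 'n ^ 'i \<Rightarrow> real" where
  "lagrangian_gap \<theta> \<nu> z =
     (\<Sum>i\<in>UNIV. real_of_ereal (\<rho> i (z $ i)) + f i (z $ i))
      - (\<Sum>i\<in>UNIV. real_of_ereal (\<rho> i xs) + f i xs)
      + (\<Sum>i\<in>UNIV. \<theta> $ i \<bullet> g i (z $ i)) + \<nu> \<bullet> z"

lemma compact_edom: "compact (edom (\<rho> i))"
  using compact_dom[of i] by (simp add: edom_phi)

lemma norm_le_dom_radius: "z \<in> edom (\<rho> i) \<Longrightarrow> norm z \<le> r"
proof -
  assume z: "z \<in> edom (\<rho> i)"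
  have "bounded (edom (\<rho> i))" using compact_edom by (rule compact_imp_bounded)
  then have "bdd_above (norm ` edom (\<rho> i))"
    unfolding bounded_iff by (auto intro: bdd_aboveI2)
  then have "norm z \<le> (SUP x\<in>edom (phi \<rho> f i). norm x)"
    unfolding edom_phi using z by (rule cSUP_upper[rotated])
  also have "\<dots> \<le> r" unfolding dom_radius_def by (rule Max_ge) auto
  finally show ?thesis .
qed

lemma dom_radius_nonneg: "0 \<le> r"
  using norm_le_dom_radius[OF xs_dom] norm_ge_zero order_trans by blast

lemma norm_X\<^sub>s: "norm X\<^sub>s \<le> real CARD('i) * r"
  by (rule norm_vec_le_const) (simp add: X\<^sub>s_def norm_le_dom_radius[OF xs_dom])

lemma norm_in_dom: "(\<And>i. z $ i \<in> edom (\<rho> i)) \<Longrightarrow> norm z \<le> real CARD('i) * r"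
  by (rule norm_vec_le_const) (use norm_le_dom_radius in blast)

lemma mu_le: "\<mu> \<le> \<mu>s i"
  by (rule order_trans[OF mu(2) Min_le]) auto

lemma Gm_nonneg: "0 \<le> Gm"
  using g_le_Gm[OF xs_dom] norm_ge_zero order_trans by blast

end

text \<open>\<open>l\<close> is a common Lipschitz constant of the Jacobians, separate from the
  constants \<open>Lg\<close> in the step sizes: it can be 0 for affine constraints, so that one
  argument also covers \<open>B = 0\<close>.\<close>

locale dpda_run = dpda_problem \<rho> f g J K Lf Lg Cg \<mu>s \<mu> \<delta> \<gamma>0 \<Gamma> \<beta> xs \<theta>s \<nu>s q R Gm
  for \<rho> :: "'i::finite \<Rightarrow> real ^ 'n \<Rightarrow> ereal"
    and f :: "'i \<Rightarrow> real ^ 'n \<Rightarrow> real"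
    and g :: "'i \<Rightarrow> real ^ 'n \<Rightarrow> real ^ 'm"
    and J :: "'i \<Rightarrow> 'm set"
    and K :: "'i \<Rightarrow> (real ^ 'm) set"
    and Lf Lg Cg \<mu>s :: "'i \<Rightarrow> real"
    and \<mu> \<delta> \<gamma>0 \<Gamma> \<beta> :: real
    and xs :: "real ^ 'n" and \<theta>s :: "real ^ 'm ^ 'i" and \<nu>s :: "real ^ 'n ^ 'i"
    and q :: "nat \<Rightarrow> nat"
    and R :: "nat \<Rightarrow> real ^ 'n ^ 'i \<Rightarrow> real ^ 'n ^ 'i"
    and Gm :: real +
  fixes x0 :: "real ^ 'n ^ 'i" and B l :: real
    and x :: "nat \<Rightarrow> real ^ 'n ^ 'i" and \<theta> :: "nat \<Rightarrow> real ^ 'm ^ 'i"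
    and \<nu> p \<omega> :: "nat \<Rightarrow> real ^ 'n ^ 'i"
    and \<gamma> \<tau> \<tau>t \<eta> :: "nat \<Rightarrow> real" and \<kappa> :: "nat \<Rightarrow> 'i \<Rightarrow> real"
  assumes B_nonneg: "0 \<le> B"
    and run: "DPDA_TV \<rho> f g J K Lf Lg Cg R x0 0 \<gamma>0 \<mu> \<delta> B x \<theta> \<nu> p \<omega> \<gamma> \<tau> \<tau>t \<eta> \<kappa>"
    and l_nonneg: "0 \<le> l"
    and g_lipschitz: "\<And>i x y. spectral_norm (jacobian (g i) (at x) - jacobian (g i) (at y))
           \<le> l * norm (x - y)"
begin

abbreviation Lf\<^sub>m :: real where "Lf\<^sub>m \<equiv> Max (range Lf)"
abbreviation Lg\<^sub>m :: real where "Lg\<^sub>m \<equiv> Max (range Lg)"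

lemma init: "\<theta> 0 = 0" "\<nu> 0 = 0" "\<gamma> 0 = \<gamma>0"
  and \<tau>t_0: "\<tau>t 0 = inverse (Lf\<^sub>m + 2 * \<gamma>0 * (1 + \<delta>) + 2 * B * Lg\<^sub>m)"
  and \<kappa>_0: "\<kappa> 0 i = \<gamma>0 * \<delta> / (Cg i)\<^sup>2"
  using run unfolding DPDA_TV_def by blast+

lemma iteration:
  shows "\<tau> k = inverse (1 / \<tau>t k + \<mu>)"
    and "p k $ i = (1 + \<eta> k) *\<^sub>R (transpose (jacobian (g i) (at (x k $ i))) *v (\<theta> k $ i))
               - \<eta> k *\<^sub>R (transpose (jacobian (g i) (at (x (k - 1) $ i))) *v (\<theta> (k - 1) $ i))
               + (1 + \<eta> k) *\<^sub>R (\<nu> k $ i) - \<eta> k *\<^sub>R (\<nu> (k - 1) $ i)"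
    and "x (Suc k) $ i = prox (\<tau> k) (\<rho> i) (x k $ i - \<tau> k *\<^sub>R (gradient (f i) (x k $ i) + p k $ i))"
    and "\<theta> (Suc k) $ i = closest_point (dual_cone (J i) (K i)) (\<theta> k $ i + \<kappa> k i *\<^sub>R g i (x (Suc k) $ i))"
    and "\<omega> k $ i = (1 / \<gamma> k) *\<^sub>R (\<nu> k $ i) + x (Suc k) $ i"
    and "\<nu> (Suc k) $ i = \<gamma> k *\<^sub>R (\<omega> k $ i - closest_point (cball 0 (2 * r)) (R k (\<omega> k) $ i))"
    and "\<gamma> (Suc k) = \<gamma> k * sqrt (1 + \<mu> * \<tau>t k)"
    and "\<eta> (Suc k) = \<gamma> k / \<gamma> (Suc k)"
    and "\<kappa> (Suc k) i = \<gamma> (Suc k) * \<delta> / (Cg i)\<^sup>2"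
    and "\<tau>t (Suc k) = \<tau>t k * \<eta> (Suc k)"
  using run unfolding DPDA_TV_def by blast+

lemma Lf\<^sub>m: "Lf i \<le> Lf\<^sub>m" "0 < Lf\<^sub>m" and Lg\<^sub>m: "Lg i \<le> Lg\<^sub>m" "0 < Lg\<^sub>m"
proof -
  show 1: "Lf i \<le> Lf\<^sub>m" "Lg i \<le> Lg\<^sub>m" for i by auto
  show "0 < Lf\<^sub>m" "0 < Lg\<^sub>m"
    using 1[THEN less_le_trans[rotated]] Lf_pos Lg_pos by blast+
qed

lemma inverse_\<tau>t_0: "1 / \<tau>t 0 = Lf\<^sub>m + 2 * \<gamma>0 * (1 + \<delta>) + 2 * B * Lg\<^sub>m"
  by (simp add: \<tau>t_0 inverse_eq_divide)

lemma inverse_\<tau>t_0_ge: "2 * \<gamma>0 * (1 + \<delta>) \<le> 1 / \<tau>t 0"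
  using Lf\<^sub>m(2) Lg\<^sub>m(2) B_nonneg unfolding inverse_\<tau>t_0 by simp

sublocale accelerated_steps \<gamma> \<tau>t \<eta> \<mu>
proof
  show "\<gamma> 0 > 0" using gamma0 init by simp
  have "2 * \<gamma>0 * (1 + \<delta>) > 0" using gamma0 delta by simp
  then show "\<tau>t 0 > 0" using inverse_\<tau>t_0_ge by (metis less_le_trans zero_less_divide_1_iff)
qed (use mu iteration in auto)

lemma \<kappa>_eq: "\<kappa> k i = \<gamma> k * \<delta> / (Cg i)\<^sup>2"
  by (cases k) (simp_all add: \<kappa>_0 init iteration)

lemma \<kappa>_pos: "\<kappa> k i > 0"
  using \<gamma>_pos[of k] delta Cg_pos[of i] by (simp add: \<kappa>_eq)

lemma inverse_\<tau>: "1 / \<tau> k = 1 / \<tau>t k + \<mu>" and \<tau>_pos: "\<tau> k > 0"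
proof -
  have "1 / \<tau>t k + \<mu> > 0" using \<tau>t_pos[of k] mu by (simp add: add_pos_pos)
  then show "1 / \<tau> k = 1 / \<tau>t k + \<mu>" "\<tau> k > 0" by (simp_all add: iteration(1) inverse_eq_divide)
qed

lemma \<gamma>_ge: "\<gamma>0 \<le> \<gamma> k"
  using \<gamma>_mono[of 0 k] init by simp

text \<open>The three parts pay for the smooth terms, for the dual steps, and for the curvature of
  the constraints. All of them grow with the factor \<open>\<gamma> k / \<gamma>0\<close>; the
  growth is kept only where it is matched by growing dual steps.\<close>

lemma inverse_\<tau>t_ge: "Lf\<^sub>m + 2 * (\<gamma> k * (1 + \<delta>)) + 2 * (B * Lg\<^sub>m) \<le> 1 / \<tau>t k"
proof -
  let ?t = "\<gamma> k / \<gamma>0"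
  have t: "1 \<le> ?t" using \<gamma>_ge[of k] gamma0 by simp
  have "1 / \<tau>t k = ?t * (Lf\<^sub>m + 2 * B * Lg\<^sub>m) + 2 * \<gamma> k * (1 + \<delta>)"
    unfolding inverse_\<tau>t[of k] inverse_\<tau>t_0 init using gamma0 by (simp add: field_simps)
  moreover have "1 * (Lf\<^sub>m + 2 * B * Lg\<^sub>m) \<le> ?t * (Lf\<^sub>m + 2 * B * Lg\<^sub>m)"
    using t Lf\<^sub>m(2) Lg\<^sub>m(2) B_nonneg by (intro mult_right_mono) auto
  ultimately have "1 * (Lf\<^sub>m + 2 * B * Lg\<^sub>m) + 2 * \<gamma> k * (1 + \<delta>) \<le> 1 / \<tau>t k"
    by (metis add_le_cancel_right)
  then show ?thesis by (simp add: mult.assoc)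
qed

lemma x_dom: "x (Suc k) $ i \<in> edom (\<rho> i)"
  unfolding iteration(3) by (rule prox_in_edom[OF rho compact_edom \<tau>_pos])

lemma \<theta>_dual: "\<theta> k $ i \<in> dual_cone (J i) (K i)"
  by (cases k) (simp_all add: init iteration zero_in_dual_cone closest_point_dual_cone)

definition jt :: "nat \<Rightarrow> real ^ 'n ^ 'i" where
  "jt k = (\<chi> i. transpose (jacobian (g i) (at (x k $ i))) *v (\<theta> k $ i))"

text \<open>The gradient in the primal variable of the coupling terms of the Lagrangian. Its
  increment \<open>d\<close> is what the algorithm extrapolates; truncation of \<open>k - 1\<close>
  makes \<open>d 0\<close> zero.\<close>

definition u :: "nat \<Rightarrow> real ^ 'n ^ 'i" where "u k = jt k + \<nu> k"

definition d :: "nat \<Rightarrow> real ^ 'n ^ 'i" where "d k = u k - u (k - 1)"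

lemma p_eq: "p k = u k + \<eta> k *\<^sub>R d k"
  by (simp add: vec_eq_iff iteration(2) u_def d_def jt_def algebra_simps)

text \<open>Stated from index 1 on, as the one-node estimate requires the old point to lie in the
  domain. The coefficient \<open>1 / \<tau> - \<mu>\<close> of that estimate is
  \<open>1 / \<tau>t\<close>.\<close>

lemma x_step:
  "(\<Sum>i\<in>UNIV. real_of_ereal (\<rho> i (x (Suc (Suc k)) $ i)) + f i (x (Suc (Suc k)) $ i))
      - (\<Sum>i\<in>UNIV. real_of_ereal (\<rho> i xs) + f i xs) + p (Suc k) \<bullet> (x (Suc (Suc k)) - X\<^sub>s)
   \<le> 1 / \<tau>t (Suc k) / 2 * (norm (x (Suc k) - X\<^sub>s))\<^sup>2 - 1 / \<tau> (Suc k) / 2 * (norm (x (Suc (Suc k)) - X\<^sub>s))\<^sup>2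
     - (1 / \<tau> (Suc k) - Lf\<^sub>m) / 2 * (norm (x (Suc (Suc k)) - x (Suc k)))\<^sup>2"
proof -
  let ?k = "Suc k" and ?k' = "Suc (Suc k)"
  have i: "real_of_ereal (\<rho> i (x ?k' $ i)) + f i (x ?k' $ i) - (real_of_ereal (\<rho> i xs) + f i xs)
      + p ?k $ i \<bullet> (x ?k' $ i - xs)
     \<le> 1 / \<tau>t ?k / 2 * (norm (x ?k $ i - xs))\<^sup>2 - 1 / \<tau> ?k / 2 * (norm (x ?k' $ i - xs))\<^sup>2
        - (1 / \<tau> ?k - Lf\<^sub>m) / 2 * (norm (x ?k' $ i - x ?k $ i))\<^sup>2" for i
  proof -
    obtain U where U: "edom (\<rho> i) \<subseteq> U" "\<And>x. x \<in> U \<Longrightarrow> f i differentiable (at x)"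
      "(Lf i)-lipschitz_on U (gradient (f i))"
      using f_smooth[of i] by blast
    have L: "Lf\<^sub>m-lipschitz_on U (gradient (f i))"
      by (rule lipschitz_on_mono[OF U(3)]) (use Lf\<^sub>m in auto)
    show ?thesis
      using proximal_gradient_step[OF rho[of i] compact_edom \<tau>_pos[of ?k] U(1,2) L f_strong mu_le
          x_dom[of k i] xs_dom, of "p ?k $ i"]
      unfolding iteration(3)[symmetric] inverse_\<tau> by simp
  qed
  have norm_eq: "(\<Sum>i\<in>UNIV. (norm (v $ i - w $ i))\<^sup>2) = (norm (v - w))\<^sup>2" for v w :: "real ^ 'n ^ 'i"
    unfolding power2_norm_vec[of "v - w"] by simp
  have inner_eq: "(\<Sum>i\<in>UNIV. v $ i \<bullet> (w $ i - z $ i)) = v \<bullet> (w - z)" for v w z :: "real ^ 'n ^ 'i"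
    unfolding inner_vec_def[of v] by simp
  have "(\<Sum>i\<in>UNIV. real_of_ereal (\<rho> i (x ?k' $ i)) + f i (x ?k' $ i) - (real_of_ereal (\<rho> i xs) + f i xs)
      + p ?k $ i \<bullet> (x ?k' $ i - X\<^sub>s $ i))
     \<le> (\<Sum>i\<in>UNIV. 1 / \<tau>t ?k / 2 * (norm (x ?k $ i - X\<^sub>s $ i))\<^sup>2 - 1 / \<tau> ?k / 2 * (norm (x ?k' $ i - X\<^sub>s $ i))\<^sup>2
        - (1 / \<tau> ?k - Lf\<^sub>m) / 2 * (norm (x ?k' $ i - x ?k $ i))\<^sup>2)"
    by (rule sum_mono) (use i in \<open>simp add: X\<^sub>s_def\<close>)
  then show ?thesis
    unfolding sum.distrib[of "\<lambda>i. _ i - _ i"] sum_subtractf sum_distrib_left[symmetric] norm_eq inner_eq .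
qed

text \<open>The projection step compares \<open>\<theta>'\<close> with the new multiplier.
  Convexity, linearized at the new point and evaluated at \<open>xs\<close>, then replaces the new
  multiplier's constraint term by \<open>jt\<close>, because its pairing with \<open>g i xs\<close>
  is nonpositive.\<close>

lemma \<theta>_step:
  assumes "\<And>i. \<theta>' $ i \<in> dual_cone (J i) (K i)"
  shows "(\<Sum>i\<in>UNIV. \<theta>' $ i \<bullet> g i (x (Suc k) $ i))
    \<le> (\<Sum>i\<in>UNIV. ((norm (\<theta>' $ i - \<theta> k $ i))\<^sup>2 - (norm (\<theta>' $ i - \<theta> (Suc k) $ i))\<^sup>2
          - (norm (\<theta> (Suc k) $ i - \<theta> k $ i))\<^sup>2) / (2 * \<kappa> k i))
      + jt (Suc k) \<bullet> (x (Suc k) - X\<^sub>s)"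
proof -
  let ?x = "x (Suc k)"
  have "\<theta>' $ i \<bullet> g i (?x $ i) \<le> ((norm (\<theta>' $ i - \<theta> k $ i))\<^sup>2 - (norm (\<theta>' $ i - \<theta> (Suc k) $ i))\<^sup>2
          - (norm (\<theta> (Suc k) $ i - \<theta> k $ i))\<^sup>2) / (2 * \<kappa> k i) + jt (Suc k) $ i \<bullet> (?x $ i - xs)" for i
  proof -
    let ?\<theta> = "\<theta> (Suc k) $ i"
    have "(\<theta>' $ i - ?\<theta>) \<bullet> g i (?x $ i) \<le> ((norm (\<theta>' $ i - \<theta> k $ i))\<^sup>2 - (norm (\<theta>' $ i - ?\<theta>))\<^sup>2
          - (norm (?\<theta> - \<theta> k $ i))\<^sup>2) / (2 * \<kappa> k i)"
      unfolding iteration(4) by (rule dual_cone_step[OF \<kappa>_pos assms])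
    moreover have "?\<theta> \<bullet> g i (?x $ i) + jt (Suc k) $ i \<bullet> (xs - ?x $ i) \<le> ?\<theta> \<bullet> g i xs"
      unfolding jt_def vec_lambda_beta
      by (rule inner_cone_convex_gradient[OF g_convex g_diff])
        (use \<theta>_dual[of "Suc k" i] in \<open>auto simp: dual_cone_def\<close>)
    moreover have "?\<theta> \<bullet> g i xs \<le> 0"
      using xs_feasible[of i] \<theta>_dual[of "Suc k" i] by (auto simp: dual_cone_def)
    ultimately show ?thesis by (simp add: inner_diff_left inner_diff_right)
  qed
  from sum_mono[OF this, where K = UNIV] show ?thesis
    by (simp add: inner_vec_def X\<^sub>s_def sum.distrib)
qed

definition \<epsilon> :: "nat \<Rightarrow> real" where "\<epsilon> k = real CARD('i) * \<Gamma> * \<beta> ^ q k * norm (\<omega> k)"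

text \<open>The two defects of inexact averaging: \<open>norm \<nu>'\<close> for the test multiplier
  that no longer annihilates the projected average, the rest for the projection inequality behind
  the new \<open>\<nu>\<close>, taken in the ball of radius \<open>2 * r\<close>.\<close>

definition err :: "real ^ 'n ^ 'i \<Rightarrow> nat \<Rightarrow> real" where
  "err \<nu>' k = \<epsilon> k * (\<gamma> k * (norm (\<omega> k) + real CARD('i) * (3 * (2 * r))) + norm \<nu>')"

text \<open>Two readings of the update: a scaled residual of the approximate projection, and an
  ascent step along the disagreement between \<open>x (Suc k)\<close> and its consensus estimate
  \<open>y k\<close>.\<close>

lemma \<nu>_Suc_eq:
  defines "y k \<equiv> \<chi> i. closest_point (cball 0 (2 * r)) (R k (\<omega> k) $ i)"
  shows "\<nu> (Suc k) = \<gamma> k *\<^sub>R (\<omega> k - y k)" and "\<nu> (Suc k) = \<nu> k + \<gamma> k *\<^sub>R (x (Suc k) - y k)"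
proof -
  show 1: "\<nu> (Suc k) = \<gamma> k *\<^sub>R (\<omega> k - y k)" by (simp add: vec_eq_iff iteration(6) y_def)
  have "\<omega> k = (1 / \<gamma> k) *\<^sub>R \<nu> k + x (Suc k)" by (simp add: vec_eq_iff iteration(5))
  with 1 show "\<nu> (Suc k) = \<nu> k + \<gamma> k *\<^sub>R (x (Suc k) - y k)"
    using \<gamma>_pos[of k] by (simp add: algebra_simps)
qed

text \<open>The counterpart of \<open>\<theta>_step\<close> for the consensus constraint. The ascent
  form of the update gives the telescoping distances by the three-point identity, and the residual
  form, with the projection inequality, replaces \<open>y\<close> by \<open>X\<^sub>s\<close> up to
  \<open>err\<close>.\<close>

lemma \<nu>_step:
  assumes "(\<Sum>i\<in>UNIV. \<nu>' $ i) = 0"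
  shows "\<nu>' \<bullet> x (Suc k) \<le> ((norm (\<nu>' - \<nu> k))\<^sup>2 - (norm (\<nu>' - \<nu> (Suc k)))\<^sup>2 - (norm (\<nu> (Suc k) - \<nu> k))\<^sup>2) / (2 * \<gamma> k)
     + \<nu> (Suc k) \<bullet> (x (Suc k) - X\<^sub>s) + err \<nu>' k"
proof -
  define y where "y = (\<chi> i. closest_point (cball 0 (2 * r)) (R k (\<omega> k) $ i))"
  have "norm xs \<le> 2 * r" using norm_le_dom_radius[OF xs_dom] dom_radius_nonneg by simp
  note ap = approximate_consensus_projection[OF this assms averaging(4)[of k "\<omega> k"], folded y_def \<epsilon>_def X\<^sub>s_def]
  have "\<nu> (Suc k) \<bullet> (X\<^sub>s - y) \<le> \<gamma> k * (\<epsilon> k * (norm (\<omega> k) + real CARD('i) * (3 * (2 * r))))"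
    unfolding \<nu>_Suc_eq(1) y_def[symmetric] inner_scaleR_left
    by (rule mult_left_mono[OF ap(2)]) (simp add: \<gamma>_pos less_imp_le)
  with ap(1) have e: "\<nu>' \<bullet> y + \<nu> (Suc k) \<bullet> (X\<^sub>s - y) \<le> err \<nu>' k"
    by (simp add: err_def algebra_simps)
  have "2 * \<gamma> k * ((\<nu>' - \<nu> (Suc k)) \<bullet> (x (Suc k) - y)) = 2 * ((\<nu>' - \<nu> (Suc k)) \<bullet> (\<nu> (Suc k) - \<nu> k))"
    using \<nu>_Suc_eq(2)[of k] unfolding y_def[symmetric] by simp
  also have "\<dots> = (norm (\<nu>' - \<nu> k))\<^sup>2 - (norm (\<nu>' - \<nu> (Suc k)))\<^sup>2 - (norm (\<nu> (Suc k) - \<nu> k))\<^sup>2"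
    unfolding power2_norm_eq_inner by (simp add: algebra_simps inner_commute)
  finally have "(\<nu>' - \<nu> (Suc k)) \<bullet> (x (Suc k) - y)
      = ((norm (\<nu>' - \<nu> k))\<^sup>2 - (norm (\<nu>' - \<nu> (Suc k)))\<^sup>2 - (norm (\<nu> (Suc k) - \<nu> k))\<^sup>2) / (2 * \<gamma> k)"
    using \<gamma>_pos[of k] by (simp add: field_simps)
  moreover have "\<nu>' \<bullet> x (Suc k) = (\<nu>' - \<nu> (Suc k)) \<bullet> (x (Suc k) - y)
      + \<nu> (Suc k) \<bullet> (x (Suc k) - X\<^sub>s) + (\<nu>' \<bullet> y + \<nu> (Suc k) \<bullet> (X\<^sub>s - y))"
    by (simp add: algebra_simps)
  ultimately show ?thesis using e by linarith
qed

section \<open>The Lyapunov function and its one-step decrease\<close>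

definition E :: "nat \<Rightarrow> real" where
  "E k = (\<Sum>i\<in>UNIV. (norm (\<theta> k $ i - \<theta> (k - 1) $ i))\<^sup>2 / (2 * \<kappa> (k - 1) i))
     + (norm (\<nu> k - \<nu> (k - 1)))\<^sup>2 / (2 * \<gamma> (k - 1))
     + (\<Sum>i\<in>UNIV. l * norm (\<theta> (k - 1) $ i) / 2 * (norm (x k $ i - x (k - 1) $ i))\<^sup>2)"

text \<open>The initial step sizes serve as fixed weights: \<open>\<kappa> k\<close> and
  \<open>\<gamma> k\<close> grow at the same rate, so the factor
  \<open>\<gamma> k / \<gamma>0\<close> reduces the metric of every step to this one.\<close>

definition dual_dist :: "real ^ 'm ^ 'i \<Rightarrow> real ^ 'n ^ 'i \<Rightarrow> nat \<Rightarrow> real" where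
  "dual_dist \<theta>' \<nu>' k = (\<Sum>i\<in>UNIV. (norm (\<theta>' $ i - \<theta> k $ i))\<^sup>2 / (2 * \<kappa> 0 i)) + (norm (\<nu>' - \<nu> k))\<^sup>2 / (2 * \<gamma>0)"

text \<open>The Lyapunov function; the iteration starts to decrease it at \<open>k = 1\<close>, since \<open>x 0\<close> is arbitrary.\<close>

definition V :: "real ^ 'm ^ 'i \<Rightarrow> real ^ 'n ^ 'i \<Rightarrow> nat \<Rightarrow> real" where
  "V \<theta>' \<nu>' k = \<gamma> k / \<gamma>0 / \<tau>t k / 2 * (norm (x k - X\<^sub>s))\<^sup>2 + dual_dist \<theta>' \<nu>' k
     + \<gamma> (k - 1) / \<gamma>0 * (E k - d k \<bullet> (x k - X\<^sub>s))"

text \<open>\<open>E\<close> collects the squared dual steps and the curvature term that Young's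
  inequality produces from the extrapolated increment. The weight
  \<open>\<gamma> k * \<delta>\<close> is tuned to \<open>\<kappa>\<close>: with it,
  \<open>(Cg i)\<^sup>2 / (2 * (\<gamma> k * \<delta>))\<close> is
  \<open>1 / (2 * \<kappa> k i)\<close>. The \<open>\<nu>\<close> part takes the weight
  \<open>\<gamma> k\<close>.\<close>

lemma d_bound:
  assumes l: "\<And>i. l * norm (\<theta> k $ i) \<le> B * Lg\<^sub>m"
  shows "\<bar>d (Suc k) \<bullet> v\<bar> \<le> E (Suc k) + (\<gamma> k * (1 + \<delta>) + B * Lg\<^sub>m) / 2 * (norm v)\<^sup>2"
proof -
  let ?a = "\<lambda>i. (norm (\<theta> (Suc k) $ i - \<theta> k $ i))\<^sup>2 / (2 * \<kappa> k i)"
  let ?b = "\<lambda>i. l * norm (\<theta> k $ i) / 2 * (norm (x (Suc k) $ i - x k $ i))\<^sup>2"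
  let ?c = "\<lambda>i. (\<gamma> k * \<delta> + B * Lg\<^sub>m) / 2 * (norm (v $ i))\<^sup>2"
  have "\<bar>(jt (Suc k) - jt k) $ i \<bullet> v $ i\<bar> \<le> ?a i + ?b i + ?c i" for i
  proof -
    let ?A = "jacobian (g i) (at (x (Suc k) $ i))" and ?A' = "jacobian (g i) (at (x k $ i))"
    have c: "\<gamma> k * \<delta> > 0" using \<gamma>_pos[of k] delta by simp
    have "(Cg i)\<^sup>2 / (2 * (\<gamma> k * \<delta>)) * (norm (\<theta> (Suc k) $ i - \<theta> k $ i))\<^sup>2 = ?a i"
      using Cg_pos[of i] c by (simp add: \<kappa>_eq field_simps)
    moreover have "l * norm (\<theta> k $ i) / 2 * ((norm (x (Suc k) $ i - x k $ i))\<^sup>2 + (norm (v $ i))\<^sup>2)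
        \<le> ?b i + B * Lg\<^sub>m / 2 * (norm (v $ i))\<^sup>2"
      unfolding distrib_left using mult_right_mono[OF l, of "(norm (v $ i))\<^sup>2 / 2" i] by simp
    moreover have "\<gamma> k * \<delta> / 2 * (norm (v $ i))\<^sup>2 + B * Lg\<^sub>m / 2 * (norm (v $ i))\<^sup>2 = ?c i"
      by (simp add: add_divide_distrib distrib_right)
    ultimately show ?thesis
      using jacobian_coupling_bound[where u = "x (Suc k) $ i - x k $ i" and \<theta> = "\<theta> (Suc k) $ i"
          and \<theta>' = "\<theta> k $ i" and v = "v $ i", OF g_bound[OF x_dom[of k i]] g_lipschitz Cg_pos c l_nonneg]
      unfolding jt_def vector_minus_component vec_lambda_beta by linarith
  qed
  then have "(\<Sum>i\<in>UNIV. \<bar>(jt (Suc k) - jt k) $ i \<bullet> v $ i\<bar>) \<le> (\<Sum>i\<in>UNIV. ?a i + ?b i + ?c i)"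
    by (rule sum_mono)
  also have "\<dots> = (\<Sum>i\<in>UNIV. ?a i) + (\<Sum>i\<in>UNIV. ?b i) + (\<gamma> k * \<delta> + B * Lg\<^sub>m) / 2 * (norm v)\<^sup>2"
    unfolding power2_norm_vec[of v] sum_distrib_left by (simp only: sum.distrib)
  finally have jt: "(\<Sum>i\<in>UNIV. \<bar>(jt (Suc k) - jt k) $ i \<bullet> v $ i\<bar>)
      \<le> (\<Sum>i\<in>UNIV. ?a i) + (\<Sum>i\<in>UNIV. ?b i) + (\<gamma> k * \<delta> + B * Lg\<^sub>m) / 2 * (norm v)\<^sup>2" .
  have "\<bar>(jt (Suc k) - jt k) \<bullet> v\<bar> \<le> (\<Sum>i\<in>UNIV. ?a i) + (\<Sum>i\<in>UNIV. ?b i) + (\<gamma> k * \<delta> + B * Lg\<^sub>m) / 2 * (norm v)\<^sup>2"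
    unfolding inner_vec_def[of "jt (Suc k) - jt k"] by (rule order_trans[OF sum_abs jt])
  moreover have "\<bar>(\<nu> (Suc k) - \<nu> k) \<bullet> v\<bar> \<le> (norm (\<nu> (Suc k) - \<nu> k))\<^sup>2 / (2 * \<gamma> k) + \<gamma> k / 2 * (norm v)\<^sup>2"
    by (rule order_trans[OF Cauchy_Schwarz_ineq2 young[OF \<gamma>_pos]])
  moreover have "d (Suc k) \<bullet> v = (jt (Suc k) - jt k) \<bullet> v + (\<nu> (Suc k) - \<nu> k) \<bullet> v"
    by (simp add: d_def u_def algebra_simps)
  moreover have "(\<gamma> k * (1 + \<delta>) + B * Lg\<^sub>m) / 2 * (norm v)\<^sup>2
      = \<gamma> k / 2 * (norm v)\<^sup>2 + (\<gamma> k * \<delta> + B * Lg\<^sub>m) / 2 * (norm v)\<^sup>2"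
    by (simp add: distrib_left distrib_right add_divide_distrib)
  ultimately show ?thesis unfolding E_def diff_Suc_1 by linarith
qed

text \<open>The step size is at most half of what would just absorb the cross term, so this term
  consumes no more than half of the primal distance in \<open>V\<close>. The coefficient 1/2 becomes
  1/4.\<close>

lemma V_lower:
  assumes l: "\<And>i. l * norm (\<theta> k $ i) \<le> B * Lg\<^sub>m"
  shows "\<gamma> (Suc k) / \<gamma>0 / \<tau>t (Suc k) / 4 * (norm (x (Suc k) - X\<^sub>s))\<^sup>2 + dual_dist \<theta>' \<nu>' (Suc k) \<le> V \<theta>' \<nu>' (Suc k)"
proof -
  let ?n = "(norm (x (Suc k) - X\<^sub>s))\<^sup>2" and ?c = "\<gamma> k * (1 + \<delta>) + B * Lg\<^sub>m"
  have BL: "0 \<le> B * Lg\<^sub>m" using B_nonneg Lg\<^sub>m(2) by simp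
  have \<gamma>k: "\<gamma> k / \<gamma>0 \<le> \<gamma> (Suc k) / \<gamma>0" "0 \<le> \<gamma> k / \<gamma>0"
    using \<gamma>_le_Suc[of k] \<gamma>_pos[of k] gamma0 by (auto simp: divide_right_mono)
  have "\<gamma> k * (1 + \<delta>) \<le> \<gamma> (Suc k) * (1 + \<delta>)"
    using \<gamma>_le_Suc[of k] delta by (intro mult_right_mono) auto
  then have c: "?c \<le> 1 / \<tau>t (Suc k) / 2"
    using inverse_\<tau>t_ge[of "Suc k"] Lf\<^sub>m(2) by simp
  have c0: "0 \<le> ?c" using BL \<gamma>_pos[of k] delta by simp
  have "\<gamma> k / \<gamma>0 * (?c / 2 * ?n) \<le> \<gamma> (Suc k) / \<gamma>0 * (1 / \<tau>t (Suc k) / 4 * ?n)"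
    using c c0 \<gamma>k by (intro mult_mono mult_right_mono) auto
  also have "\<dots> = \<gamma> (Suc k) / \<gamma>0 / \<tau>t (Suc k) / 4 * ?n" by simp
  finally have 1: "\<gamma> k / \<gamma>0 * (?c / 2 * ?n) \<le> \<gamma> (Suc k) / \<gamma>0 / \<tau>t (Suc k) / 4 * ?n" .
  have "- (?c / 2 * ?n) \<le> E (Suc k) - d (Suc k) \<bullet> (x (Suc k) - X\<^sub>s)"
    using d_bound[OF l, of "x (Suc k) - X\<^sub>s"] by linarith
  from mult_left_mono[OF this \<gamma>k(2)]
  have 2: "- (\<gamma> k / \<gamma>0 * (?c / 2 * ?n)) \<le> \<gamma> k / \<gamma>0 * (E (Suc k) - d (Suc k) \<bullet> (x (Suc k) - X\<^sub>s))"
    by simp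
  have "\<gamma> (Suc k) / \<gamma>0 / \<tau>t (Suc k) / 2 * ?n
      = \<gamma> (Suc k) / \<gamma>0 / \<tau>t (Suc k) / 4 * ?n + \<gamma> (Suc k) / \<gamma>0 / \<tau>t (Suc k) / 4 * ?n"
    by simp
  with 1 2 show ?thesis unfolding V_def by simp
qed

lemma dual_dist_nonneg: "0 \<le> dual_dist \<theta>' \<nu>' k"
  unfolding dual_dist_def using \<kappa>_pos[of 0] gamma0
  by (intro add_nonneg_nonneg sum_nonneg divide_nonneg_nonneg) (auto simp: less_imp_le)

lemma V_nonneg:
  assumes l: "\<And>i. l * norm (\<theta> k $ i) \<le> B * Lg\<^sub>m"
  shows "0 \<le> V \<theta>' \<nu>' (Suc k)"
proof -
  have "0 \<le> \<gamma> (Suc k) / \<gamma>0 / \<tau>t (Suc k) / 4 * (norm (x (Suc k) - X\<^sub>s))\<^sup>2"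
    using \<gamma>_pos[of "Suc k"] \<tau>t_pos[of "Suc k"] gamma0 by simp
  then show ?thesis using V_lower[OF l, of \<theta>' \<nu>'] dual_dist_nonneg[of \<theta>' \<nu>' "Suc k"] by linarith
qed

lemma V_step:
  assumes l: "\<And>i. l * norm (\<theta> k $ i) \<le> B * Lg\<^sub>m" "\<And>i. l * norm (\<theta> (Suc k) $ i) \<le> B * Lg\<^sub>m"
    and dual: "\<And>i. \<theta>' $ i \<in> dual_cone (J i) (K i)" "(\<Sum>i\<in>UNIV. \<nu>' $ i) = 0"
  shows "\<gamma> (Suc k) / \<gamma>0 * lagrangian_gap \<theta>' \<nu>' (x (Suc (Suc k))) + V \<theta>' \<nu>' (Suc (Suc k))
    \<le> V \<theta>' \<nu>' (Suc k) + \<gamma> (Suc k) / \<gamma>0 * err \<nu>' (Suc k)"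
proof -
  let ?k = "Suc k" and ?k' = "Suc (Suc k)"
  let ?t = "\<gamma> ?k / \<gamma>0"
  define \<Delta> where "\<Delta> = x ?k' - x ?k"
  define a where "a = (\<Sum>i\<in>UNIV. (norm (\<theta>' $ i - \<theta> ?k $ i))\<^sup>2 / (2 * \<kappa> ?k i)) + (norm (\<nu>' - \<nu> ?k))\<^sup>2 / (2 * \<gamma> ?k)"
  define a' where "a' = (\<Sum>i\<in>UNIV. (norm (\<theta>' $ i - \<theta> ?k' $ i))\<^sup>2 / (2 * \<kappa> ?k i)) + (norm (\<nu>' - \<nu> ?k'))\<^sup>2 / (2 * \<gamma> ?k)"
  define b where "b = (\<Sum>i\<in>UNIV. (norm (\<theta> ?k' $ i - \<theta> ?k $ i))\<^sup>2 / (2 * \<kappa> ?k i)) + (norm (\<nu> ?k' - \<nu> ?k))\<^sup>2 / (2 * \<gamma> ?k)"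
  have t0: "0 < ?t" using \<gamma>_pos[of ?k] gamma0 by simp
  have dd: "?t * (\<Sum>i\<in>UNIV. (norm (\<theta>' $ i - \<theta> j $ i))\<^sup>2 / (2 * \<kappa> ?k i)) + ?t * ((norm (\<nu>' - \<nu> j))\<^sup>2 / (2 * \<gamma> ?k))
     = dual_dist \<theta>' \<nu>' j" for j
  proof -
    have "?t * ((norm (\<theta>' $ i - \<theta> j $ i))\<^sup>2 / (2 * \<kappa> ?k i)) = (norm (\<theta>' $ i - \<theta> j $ i))\<^sup>2 / (2 * \<kappa> 0 i)" for i
      using \<gamma>_pos[of ?k] gamma0 delta Cg_pos[of i] by (simp add: \<kappa>_eq init field_simps)
    moreover have "?t * ((norm (\<nu>' - \<nu> j))\<^sup>2 / (2 * \<gamma> ?k)) = (norm (\<nu>' - \<nu> j))\<^sup>2 / (2 * \<gamma>0)"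
      using \<gamma>_pos[of ?k] by simp
    ultimately show ?thesis unfolding dual_dist_def sum_distrib_left by simp
  qed
  have ta: "?t * a = dual_dist \<theta>' \<nu>' ?k" and ta': "?t * a' = dual_dist \<theta>' \<nu>' ?k'"
    unfolding a_def a'_def distrib_left using dd by blast+
  have "(\<Sum>i\<in>UNIV. \<theta>' $ i \<bullet> g i (x ?k' $ i)) + \<nu>' \<bullet> x ?k'
      \<le> a - a' - b + u ?k' \<bullet> (x ?k' - X\<^sub>s) + err \<nu>' ?k"
    using \<theta>_step[OF dual(1), of ?k] \<nu>_step[OF dual(2), of ?k]
    unfolding a_def a'_def b_def u_def diff_divide_distrib sum_subtractf inner_add_left by linarith
  \<comment> \<open>Extrapolation makes the increments telescope: the new \<open>d\<close> is
    carried to the next step, the old one is split at \<open>x ?k\<close> into the part inherited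
    from the previous step and a cross term with \<open>\<Delta>\<close>.\<close>
  moreover have "u ?k' \<bullet> (x ?k' - X\<^sub>s) - p ?k \<bullet> (x ?k' - X\<^sub>s)
      = d ?k' \<bullet> (x ?k' - X\<^sub>s) - \<eta> ?k * (d ?k \<bullet> (x ?k - X\<^sub>s)) - \<eta> ?k * (d ?k \<bullet> \<Delta>)"
    unfolding p_eq[of ?k] \<Delta>_def by (simp add: d_def[of ?k'] algebra_simps)
  ultimately have gap: "lagrangian_gap \<theta>' \<nu>' (x ?k') \<le> 1 / \<tau>t ?k / 2 * (norm (x ?k - X\<^sub>s))\<^sup>2
      - 1 / \<tau> ?k / 2 * (norm (x ?k' - X\<^sub>s))\<^sup>2 - (1 / \<tau> ?k - Lf\<^sub>m) / 2 * (norm \<Delta>)\<^sup>2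
      + a - a' - b + d ?k' \<bullet> (x ?k' - X\<^sub>s) - \<eta> ?k * (d ?k \<bullet> (x ?k - X\<^sub>s)) - \<eta> ?k * (d ?k \<bullet> \<Delta>) + err \<nu>' ?k"
    using x_step[of k] unfolding lagrangian_gap_def \<Delta>_def by linarith
  have E': "E ?k' \<le> b + B * Lg\<^sub>m / 2 * (norm \<Delta>)\<^sup>2"
  proof -
    have "(\<Sum>i\<in>UNIV. l * norm (\<theta> ?k $ i) / 2 * (norm (x ?k' $ i - x ?k $ i))\<^sup>2)
        \<le> (\<Sum>i\<in>UNIV. B * Lg\<^sub>m / 2 * (norm (\<Delta> $ i))\<^sup>2)"
      unfolding \<Delta>_def vector_minus_component by (intro sum_mono mult_right_mono divide_right_mono l) auto
    also have "\<dots> = B * Lg\<^sub>m / 2 * (norm \<Delta>)\<^sup>2" unfolding power2_norm_vec[of \<Delta>] sum_distrib_left ..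
    finally show ?thesis by (simp add: E_def b_def)
  qed
  define s where "s = \<gamma> k / \<gamma>0"
  have s: "0 \<le> s" "s \<le> ?t" "?t * \<eta> ?k = s"
    using \<gamma>_pos[of k] \<gamma>_le_Suc[of k] gamma0 \<gamma>_\<eta>[of k] by (auto simp: s_def divide_right_mono)
  define c where "c = \<gamma> k * (1 + \<delta>) + B * Lg\<^sub>m"
  have BL: "0 \<le> B * Lg\<^sub>m" using B_nonneg Lg\<^sub>m(2) by simp
  \<comment> \<open>The budget for \<open>\<Delta>\<close>: the negative square from the prox step
    must cover the cross term of the old increment, weighted by the older \<open>s\<close>, and the
    curvature part of the new \<open>E\<close>.\<close>
  have coeff: "s * (c / 2) + ?t * (B * Lg\<^sub>m / 2) \<le> ?t * ((1 / \<tau> ?k - Lf\<^sub>m) / 2)"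
  proof -
    have "\<gamma> k * (1 + \<delta>) \<le> \<gamma> ?k * (1 + \<delta>)"
      using \<gamma>_le_Suc[of k] delta by (intro mult_right_mono) auto
    moreover have "0 \<le> \<gamma> ?k * (1 + \<delta>)" using \<gamma>_pos[of ?k] delta by simp
    moreover have "Lf\<^sub>m + 2 * (\<gamma> ?k * (1 + \<delta>)) + 2 * (B * Lg\<^sub>m) \<le> 1 / \<tau> ?k"
      using inverse_\<tau>t_ge[of ?k] mu(1) unfolding inverse_\<tau>[of ?k] by linarith
    moreover have "(a + b) / 2 + b / 2 \<le> (v - w) / 2"
      if "a \<le> a'" "0 \<le> a'" "w + 2 * a' + 2 * b \<le> v" for a a' b v w :: real
      using that by argo
    ultimately have c: "c / 2 + B * Lg\<^sub>m / 2 \<le> (1 / \<tau> ?k - Lf\<^sub>m) / 2"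
      unfolding c_def by blast
    have "0 \<le> c" unfolding c_def using BL \<gamma>_pos[of k] delta by simp
    then have "s * (c / 2) \<le> ?t * (c / 2)" using s by (intro mult_right_mono) auto
    moreover have "?t * (c / 2 + B * Lg\<^sub>m / 2) \<le> ?t * ((1 / \<tau> ?k - Lf\<^sub>m) / 2)"
      using t0 by (intro mult_left_mono c) auto
    ultimately show ?thesis unfolding distrib_left by linarith
  qed
  have cross: "- (d ?k \<bullet> \<Delta>) \<le> E ?k + c / 2 * (norm \<Delta>)\<^sup>2"
    using d_bound[OF l(1), of \<Delta>] unfolding c_def by linarith
  \<comment> \<open>The coefficient left in front of the new distance is the one with which the next
    \<open>V\<close> begins.\<close>
  have ratio: "?t * (1 / \<tau> ?k) = \<gamma> ?k' / \<gamma>0 / \<tau>t ?k'"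
  proof -
    have "?t * (1 / \<tau> ?k) = \<gamma> ?k * (1 / \<tau>t ?k + \<mu>) / \<gamma>0" by (simp add: inverse_\<tau>)
    then show ?thesis unfolding ratio_Suc[symmetric] by simp
  qed
  have "?t * lagrangian_gap \<theta>' \<nu>' (x ?k') \<le> ?t * (1 / \<tau>t ?k / 2 * (norm (x ?k - X\<^sub>s))\<^sup>2
      - 1 / \<tau> ?k / 2 * (norm (x ?k' - X\<^sub>s))\<^sup>2 - (1 / \<tau> ?k - Lf\<^sub>m) / 2 * (norm \<Delta>)\<^sup>2
      + a - a' - b + d ?k' \<bullet> (x ?k' - X\<^sub>s) - \<eta> ?k * (d ?k \<bullet> (x ?k - X\<^sub>s)) - \<eta> ?k * (d ?k \<bullet> \<Delta>) + err \<nu>' ?k)"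
    using gap t0 by (intro mult_left_mono) auto
  also have "\<dots> = ?t / \<tau>t ?k / 2 * (norm (x ?k - X\<^sub>s))\<^sup>2 - ?t * (1 / \<tau> ?k) / 2 * (norm (x ?k' - X\<^sub>s))\<^sup>2
      - ?t * ((1 / \<tau> ?k - Lf\<^sub>m) / 2) * (norm \<Delta>)\<^sup>2 + ?t * a - ?t * a' - ?t * b
      + ?t * (d ?k' \<bullet> (x ?k' - X\<^sub>s)) - (?t * \<eta> ?k) * (d ?k \<bullet> (x ?k - X\<^sub>s)) - (?t * \<eta> ?k) * (d ?k \<bullet> \<Delta>) + ?t * err \<nu>' ?k"
    by (simp only: distrib_left right_diff_distrib mult.assoc) simp
  finally have main: "?t * lagrangian_gap \<theta>' \<nu>' (x ?k') \<le> ?t / \<tau>t ?k / 2 * (norm (x ?k - X\<^sub>s))\<^sup>2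
      - \<gamma> ?k' / \<gamma>0 / \<tau>t ?k' / 2 * (norm (x ?k' - X\<^sub>s))\<^sup>2
      - ?t * ((1 / \<tau> ?k - Lf\<^sub>m) / 2) * (norm \<Delta>)\<^sup>2 + dual_dist \<theta>' \<nu>' ?k - dual_dist \<theta>' \<nu>' ?k' - ?t * b
      + ?t * (d ?k' \<bullet> (x ?k' - X\<^sub>s)) - s * (d ?k \<bullet> (x ?k - X\<^sub>s)) - s * (d ?k \<bullet> \<Delta>) + ?t * err \<nu>' ?k"
    unfolding ratio s(3) ta ta' .
  have 1: "?t * E ?k' \<le> ?t * b + ?t * (B * Lg\<^sub>m / 2) * (norm \<Delta>)\<^sup>2"
    using mult_left_mono[OF E', of ?t] t0 by (simp only: distrib_left mult.assoc less_imp_le)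
  have 2: "- (s * (d ?k \<bullet> \<Delta>)) \<le> s * E ?k + s * (c / 2) * (norm \<Delta>)\<^sup>2"
    using mult_left_mono[OF cross s(1)] by (simp only: distrib_left mult.assoc mult_minus_right)
  have 3: "s * (c / 2) * (norm \<Delta>)\<^sup>2 + ?t * (B * Lg\<^sub>m / 2) * (norm \<Delta>)\<^sup>2 \<le> ?t * ((1 / \<tau> ?k - Lf\<^sub>m) / 2) * (norm \<Delta>)\<^sup>2"
    using mult_right_mono[OF coeff, of "(norm \<Delta>)\<^sup>2"] by (simp only: distrib_right zero_le_power2)
  have V1: "V \<theta>' \<nu>' ?k' = \<gamma> ?k' / \<gamma>0 / \<tau>t ?k' / 2 * (norm (x ?k' - X\<^sub>s))\<^sup>2 + dual_dist \<theta>' \<nu>' ?k'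
      + (?t * E ?k' - ?t * (d ?k' \<bullet> (x ?k' - X\<^sub>s)))"
    unfolding V_def right_diff_distrib diff_Suc_1 ..
  have V2: "V \<theta>' \<nu>' ?k = ?t / \<tau>t ?k / 2 * (norm (x ?k - X\<^sub>s))\<^sup>2 + dual_dist \<theta>' \<nu>' ?k
      + (s * E ?k - s * (d ?k \<bullet> (x ?k - X\<^sub>s)))"
    unfolding V_def right_diff_distrib diff_Suc_1 s_def ..
  show ?thesis unfolding V1 V2 using main 1 2 3 by linarith
qed

end

section \<open>Uniform bounds\<close>

context dpda_problem
begin

text \<open>\<open>M\<close> bounds the test multiplier for consensus. The factors
  \<open>\<gamma>0 + \<mu>\<close> come from a growth bound on \<open>\<gamma>\<close> that is valid
  for every \<open>B\<close>, so the constant does not depend on \<open>B\<close>.\<close>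

definition err_const :: "real \<Rightarrow> real" where
  "err_const M = (\<gamma>0 + \<mu>) / \<gamma>0 * (real CARD('i) * \<Gamma> * (3 * (real CARD('i) * r)))
     * ((\<gamma>0 + \<mu>) * (9 * (real CARD('i) * r)) + M)"

definition err_total :: real where "err_total = (\<Sum>k. \<beta> ^ q k * real (Suc k) ^ 4)"

text \<open>Bounds \<open>V\<close> at index 1 without its primal term: the first two summands
  belong to \<open>dual_dist\<close>, the next two to \<open>E\<close>, the last to the cross term
  with \<open>d\<close>. The term \<open>\<gamma>0 * \<delta> / (Cg i)\<^sup>2\<close> is the
  initial dual step.\<close>

definition init_const :: "real \<Rightarrow> real" where
  "init_const M = (\<Sum>i\<in>UNIV. (M + \<gamma>0 * \<delta> / (Cg i)\<^sup>2 * Gm)\<^sup>2 / (2 * (\<gamma>0 * \<delta> / (Cg i)\<^sup>2)))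
     + (M + \<gamma>0 * (3 * (real CARD('i) * r)))\<^sup>2 / (2 * \<gamma>0)
     + (\<Sum>i\<in>UNIV. (\<gamma>0 * \<delta> / (Cg i)\<^sup>2 * Gm)\<^sup>2 / (2 * (\<gamma>0 * \<delta> / (Cg i)\<^sup>2)))
     + (\<gamma>0 * (3 * (real CARD('i) * r)))\<^sup>2 / (2 * \<gamma>0)
     + ((\<Sum>i\<in>UNIV. Cg i * (\<gamma>0 * \<delta> / (Cg i)\<^sup>2 * Gm)) + \<gamma>0 * (3 * (real CARD('i) * r))) * (2 * (real CARD('i) * r))"

definition saddle_norm :: real where "saddle_norm = norm \<theta>s + norm \<nu>s"

definition dual_const :: real where
  "dual_const = init_const saddle_norm
     + (Max (range Lf) + 2 * \<gamma>0 * (1 + \<delta>) + \<mu>) / 2 * (2 * (real CARD('i) * r))\<^sup>2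
     + err_const saddle_norm * err_total"

text \<open>Three demands in one sum: \<open>B\<close> is at least 1, at least twice the size of the
  saddle multipliers, and large enough that the distance of the multipliers to
  \<open>\<theta>s\<close> stays below \<open>B / 2\<close>. The 8 compensates
  \<open>(B / 2)\<^sup>2\<close> and the factor 2 in the weights of
  \<open>dual_dist\<close>.\<close>

definition B_bar :: real where
  "B_bar = 2 * saddle_norm + 1 + 8 * (\<Sum>i\<in>UNIV. \<gamma>0 * \<delta> / (Cg i)\<^sup>2)
     * (dual_const + Max (range Lg) * (2 * (real CARD('i) * r))\<^sup>2)"

lemma err_const_nonneg: "0 \<le> M \<Longrightarrow> 0 \<le> err_const M"
  unfolding err_const_def using gamma0 mu averaging dom_radius_nonneg by simp

lemma err_total_ge: "(\<Sum>k\<in>A. \<beta> ^ q k * real (Suc k) ^ 4) \<le> err_total" if "finite A"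
  unfolding err_total_def using averaging by (intro sum_le_suminf[OF q_summable that]) simp

lemma err_total_nonneg: "0 \<le> err_total"
  using err_total_ge[of "{}"] by simp

lemma init_const_nonneg: "0 \<le> M \<Longrightarrow> 0 \<le> init_const M"
  unfolding init_const_def using gamma0 delta dom_radius_nonneg Gm_nonneg Cg_pos
  by (intro add_nonneg_nonneg sum_nonneg mult_nonneg_nonneg divide_nonneg_nonneg) (auto simp: less_imp_le)

end

context dpda_run
begin

section \<open>A priori growth of the iterates and of the averaging errors\<close>

abbreviation D :: real where "D \<equiv> 3 * (real CARD('i) * r)"

lemma norm_x: "norm (x (Suc k)) \<le> real CARD('i) * r"
  by (rule norm_in_dom) (rule x_dom)

lemma norm_x_diff: "norm (x (Suc k) - X\<^sub>s) \<le> 2 * (real CARD('i) * r)"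
  using norm_triangle_ineq4[of "x (Suc k)" X\<^sub>s] norm_x[of k] norm_X\<^sub>s by linarith

text \<open>Domain points have norm at most \<open>r\<close> in each block and ball projections at
  most \<open>2 * r\<close>, whatever the averaging map returns; hence the 3 in
  \<open>D\<close>.\<close>

lemma norm_\<nu>_Suc_le: "norm (\<nu> (Suc k)) \<le> norm (\<nu> k) + \<gamma> k * D"
proof -
  define y where "y = (\<chi> i. closest_point (cball 0 (2 * r)) (R k (\<omega> k) $ i))"
  have y: "norm y \<le> real CARD('i) * (2 * r)"
  proof (rule norm_vec_le_const)
    fix i show "norm (y $ i) \<le> 2 * r"
      using closest_point_in_set[of "cball 0 (2 * r)" "R k (\<omega> k) $ i"] dom_radius_nonneg
      by (simp add: y_def dist_norm)
  qed
  have "norm (x (Suc k) - y) \<le> D"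
    using norm_triangle_ineq4[of "x (Suc k)" y] norm_x[of k] y by simp
  then have "norm (\<gamma> k *\<^sub>R (x (Suc k) - y)) \<le> \<gamma> k * D"
    using \<gamma>_pos[of k] by simp
  then show ?thesis
    unfolding \<nu>_Suc_eq(2)[of k, folded y_def] using norm_triangle_ineq order_trans add_left_mono by blast
qed

lemma D_nonneg: "0 \<le> D" using dom_radius_nonneg by simp

lemma norm_\<nu>_le: "norm (\<nu> k) \<le> \<gamma> k * (real k * D)"
proof (induction k)
  case (Suc k)
  have "norm (\<nu> (Suc k)) \<le> \<gamma> k * (real k * D) + \<gamma> k * D"
    using Suc norm_\<nu>_Suc_le[of k] by linarith
  also have "\<dots> = \<gamma> k * (real (Suc k) * D)" by (simp add: distrib_left distrib_right)
  also have "\<dots> \<le> \<gamma> (Suc k) * (real (Suc k) * D)"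
    using \<gamma>_le_Suc[of k] D_nonneg by (intro mult_right_mono) auto
  finally show ?case .
qed (simp add: init)

lemma norm_\<omega>_le: "norm (\<omega> k) \<le> D * real (Suc k)"
proof -
  have "\<omega> k = (1 / \<gamma> k) *\<^sub>R \<nu> k + x (Suc k)" by (simp add: vec_eq_iff iteration(5))
  then have "norm (\<omega> k) \<le> norm (\<nu> k) / \<gamma> k + norm (x (Suc k))"
    using norm_triangle_ineq[of "(1 / \<gamma> k) *\<^sub>R \<nu> k" "x (Suc k)"] \<gamma>_pos[of k] by simp
  moreover have "norm (\<nu> k) / \<gamma> k \<le> real k * D"
    using norm_\<nu>_le[of k] \<gamma>_pos[of k] by (simp add: pos_divide_le_eq mult.commute)
  moreover have "D * real (Suc k) = real k * D + D" by (simp add: distrib_right distrib_left)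
  moreover have "0 \<le> real CARD('i) * r" using dom_radius_nonneg by simp
  ultimately show ?thesis using norm_x[of k] by linarith
qed

text \<open>The step size satisfies \<open>2 * \<gamma>0 * \<tau>t 0 \<le> 1\<close> for every
  \<open>B\<close>, so the slope of \<open>\<gamma>\<close> is bounded independently of
  \<open>B\<close>.\<close>

lemma \<gamma>_linear_uniform: "\<gamma> k \<le> (\<gamma>0 + \<mu>) * real (Suc k)"
proof -
  have "2 * \<gamma>0 * 1 \<le> 2 * \<gamma>0 * (1 + \<delta>)" using gamma0 delta by (intro mult_left_mono) auto
  then have "2 * \<gamma>0 \<le> 1 / \<tau>t 0" using inverse_\<tau>t_0_ge by linarith
  then have "2 * \<gamma>0 * \<tau>t 0 \<le> 1" using \<tau>t_pos[of 0] by (simp add: pos_le_divide_eq)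
  then have "\<mu> * (\<gamma>0 * \<tau>t 0) \<le> \<mu> * 1" using mu(1) by (intro mult_left_mono) auto
  then have "\<gamma> 0 + \<mu> * \<gamma> 0 * \<tau>t 0 / 2 \<le> \<gamma>0 + \<mu>" using mu(1) by (simp add: init mult.assoc)
  then have "(\<gamma> 0 + \<mu> * \<gamma> 0 * \<tau>t 0 / 2) * real (Suc k) \<le> (\<gamma>0 + \<mu>) * real (Suc k)"
    by (rule mult_right_mono) simp
  then show ?thesis using \<gamma>_linear[of k] by linarith
qed

text \<open>Powers of \<open>?s\<close>: one from the weight, one from
  \<open>norm (\<omega> k)\<close> in \<open>\<epsilon> k\<close>, two from
  \<open>\<gamma> k * norm (\<omega> k)\<close> in the bracket.\<close>

lemma err_bound:
  assumes M: "norm \<nu>' \<le> M"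
  shows "\<gamma> k / \<gamma>0 * err \<nu>' k \<le> err_const M * (\<beta> ^ q k * real (Suc k) ^ 4)"
proof -
  let ?s = "real (Suc k)" and ?G = "\<gamma>0 + \<mu>" and ?c = "real CARD('i) * \<Gamma> * \<beta> ^ q k"
  have M0: "0 \<le> M" using M norm_ge_zero order_trans by blast
  have s: "1 \<le> ?s" by simp
  have c: "0 \<le> ?c" using averaging by simp
  have G: "0 \<le> ?G" using gamma0 mu by simp
  have 1: "\<gamma> k / \<gamma>0 \<le> ?G / \<gamma>0 * ?s"
    using divide_right_mono[OF \<gamma>_linear_uniform, of \<gamma>0 k] gamma0 by simp
  have 2: "\<epsilon> k \<le> ?c * (D * ?s)"
    unfolding \<epsilon>_def by (intro mult_left_mono norm_\<omega>_le c)
  have e0: "0 \<le> \<epsilon> k" unfolding \<epsilon>_def using c by simp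
  have "D \<le> D * ?s" using mult_left_mono[OF s D_nonneg] by simp
  then have "norm (\<omega> k) + real CARD('i) * (3 * (2 * r)) \<le> 9 * (real CARD('i) * r) * ?s"
  proof -
    have "real CARD('i) * (3 * (2 * r)) = 2 * D" "9 * (real CARD('i) * r) * ?s = 3 * (D * ?s)" by simp_all
    with \<open>D \<le> D * ?s\<close> norm_\<omega>_le[of k] show ?thesis by linarith
  qed
  then have "\<gamma> k * (norm (\<omega> k) + real CARD('i) * (3 * (2 * r))) \<le> ?G * ?s * (9 * (real CARD('i) * r) * ?s)"
    using \<gamma>_linear_uniform[of k] \<gamma>_pos[of k] G dom_radius_nonneg by (intro mult_mono) auto
  moreover have "M * 1 \<le> M * (?s * ?s)"
    using M0 mult_mono[OF s s] by (intro mult_left_mono) auto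
  ultimately have 3: "\<gamma> k * (norm (\<omega> k) + real CARD('i) * (3 * (2 * r))) + norm \<nu>'
      \<le> (?G * (9 * (real CARD('i) * r)) + M) * (?s * ?s)"
    using M by (simp add: algebra_simps)
  have "\<gamma> k / \<gamma>0 * err \<nu>' k \<le> ?G / \<gamma>0 * ?s * (?c * (D * ?s) * ((?G * (9 * (real CARD('i) * r)) + M) * (?s * ?s)))"
    unfolding err_def
    using \<gamma>_pos[of k] gamma0 e0 dom_radius_nonneg c G M0 D_nonneg
    by (intro mult_mono 1 2 3) (auto intro!: mult_nonneg_nonneg add_nonneg_nonneg)
  also have "\<dots> = err_const M * (\<beta> ^ q k * ?s ^ 4)"
    unfolding err_const_def power4_eq_xxxx by (simp only: mult_ac)
  finally show ?thesis .
qed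

lemma norm_\<theta>_1: "norm (\<theta> (Suc 0) $ i) \<le> \<kappa> 0 i * Gm"
proof -
  let ?C = "dual_cone (J i) (K i)"
  have "dist (closest_point ?C (\<kappa> 0 i *\<^sub>R g i (x (Suc 0) $ i))) (closest_point ?C 0) \<le> dist (\<kappa> 0 i *\<^sub>R g i (x (Suc 0) $ i)) 0"
    by (rule closest_point_lipschitz) (use convex_dual_cone closed_dual_cone zero_in_dual_cone in blast)+
  also have "\<dots> \<le> \<kappa> 0 i * Gm"
    using \<kappa>_pos[of 0 i] g_le_Gm[OF x_dom[of 0 i]] by simp
  finally show ?thesis
    by (simp add: iteration(4) init closest_point_self[OF zero_in_dual_cone] dist_norm)
qed

lemma norm_\<nu>_1: "norm (\<nu> (Suc 0)) \<le> \<gamma>0 * D"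
  using norm_\<nu>_Suc_le[of 0] by (simp add: init)

lemma V_init:
  assumes M: "\<And>i. norm (\<theta>' $ i) \<le> M" "norm \<nu>' \<le> M"
  shows "V \<theta>' \<nu>' (Suc 0) \<le> init_const M + (1 / \<tau>t 0 + \<mu>) / 2 * (2 * (real CARD('i) * r))\<^sup>2"
proof -
  have x1: "norm (x (Suc 0) - X\<^sub>s) \<le> 2 * (real CARD('i) * r)" by (rule norm_x_diff)
  have "\<gamma> (Suc 0) / \<gamma>0 / \<tau>t (Suc 0) = (\<gamma> (Suc 0) / \<tau>t (Suc 0)) / \<gamma>0" by simp
  also have "\<dots> = 1 / \<tau>t 0 + \<mu>" unfolding ratio_Suc init using gamma0 by simp
  finally have "\<gamma> (Suc 0) / \<gamma>0 / \<tau>t (Suc 0) / 2 * (norm (x (Suc 0) - X\<^sub>s))\<^sup>2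
      = (1 / \<tau>t 0 + \<mu>) / 2 * (norm (x (Suc 0) - X\<^sub>s))\<^sup>2" by simp
  also have "\<dots> \<le> (1 / \<tau>t 0 + \<mu>) / 2 * (2 * (real CARD('i) * r))\<^sup>2"
    using mu(1) \<tau>t_pos[of 0] by (intro mult_left_mono power_mono x1) auto
  finally have 1: "\<gamma> (Suc 0) / \<gamma>0 / \<tau>t (Suc 0) / 2 * (norm (x (Suc 0) - X\<^sub>s))\<^sup>2
      \<le> (1 / \<tau>t 0 + \<mu>) / 2 * (2 * (real CARD('i) * r))\<^sup>2" .
  have \<kappa>0: "0 \<le> 2 * \<kappa> 0 i" for i using \<kappa>_pos[of 0 i] by simp
  have 2: "dual_dist \<theta>' \<nu>' (Suc 0) \<le> (\<Sum>i\<in>UNIV. (M + \<kappa> 0 i * Gm)\<^sup>2 / (2 * \<kappa> 0 i)) + (M + \<gamma>0 * D)\<^sup>2 / (2 * \<gamma>0)"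
    unfolding dual_dist_def
  proof (intro add_mono sum_mono divide_right_mono power_mono \<kappa>0)
    fix i show "norm (\<theta>' $ i - \<theta> (Suc 0) $ i) \<le> M + \<kappa> 0 i * Gm"
      using norm_triangle_ineq4[of "\<theta>' $ i" "\<theta> (Suc 0) $ i"] M(1)[of i] norm_\<theta>_1[of i] by linarith
    show "norm (\<nu>' - \<nu> (Suc 0)) \<le> M + \<gamma>0 * D"
      using norm_triangle_ineq4[of \<nu>' "\<nu> (Suc 0)"] M(2) norm_\<nu>_1 by linarith
  qed (use gamma0 in auto)
  \<comment> \<open>\<open>\<theta> 0 = 0\<close> removes the curvature part, in which the arbitrary
    point \<open>x 0\<close> would occur.\<close>
  have "E (Suc 0) = (\<Sum>i\<in>UNIV. (norm (\<theta> (Suc 0) $ i))\<^sup>2 / (2 * \<kappa> 0 i)) + (norm (\<nu> (Suc 0)))\<^sup>2 / (2 * \<gamma>0)"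
    by (simp add: E_def init)
  also have "\<dots> \<le> (\<Sum>i\<in>UNIV. (\<kappa> 0 i * Gm)\<^sup>2 / (2 * \<kappa> 0 i)) + (\<gamma>0 * D)\<^sup>2 / (2 * \<gamma>0)"
    using gamma0 by (intro add_mono sum_mono divide_right_mono power_mono \<kappa>0 norm_\<theta>_1 norm_\<nu>_1) auto
  finally have 3: "E (Suc 0) \<le> (\<Sum>i\<in>UNIV. (\<kappa> 0 i * Gm)\<^sup>2 / (2 * \<kappa> 0 i)) + (\<gamma>0 * D)\<^sup>2 / (2 * \<gamma>0)" .
  \<comment> \<open>The Jacobian at \<open>x 0\<close>, where no bound by \<open>Cg\<close> is
    available, is multiplied by the zero multiplier; hence \<open>d (Suc 0)\<close> is
    \<open>u (Suc 0)\<close>.\<close>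
  have u0: "u 0 = 0" by (simp add: u_def jt_def init vec_eq_iff)
  have "norm (jt (Suc 0)) \<le> (\<Sum>i\<in>UNIV. norm (jt (Suc 0) $ i))" by (simp add: norm_vec_def L2_set_le_sum)
  also have "\<dots> \<le> (\<Sum>i\<in>UNIV. Cg i * (\<kappa> 0 i * Gm))"
  proof (rule sum_mono)
    fix i
    have "norm (jt (Suc 0) $ i) \<le> spectral_norm (jacobian (g i) (at (x (Suc 0) $ i))) * norm (\<theta> (Suc 0) $ i)"
      unfolding jt_def vec_lambda_beta by (rule norm_transpose_vector_le)
    also have "\<dots> \<le> Cg i * (\<kappa> 0 i * Gm)"
      using Cg_pos[of i] by (intro mult_mono g_bound x_dom norm_\<theta>_1) auto
    finally show "norm (jt (Suc 0) $ i) \<le> Cg i * (\<kappa> 0 i * Gm)" .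
  qed
  finally have "norm (d (Suc 0)) \<le> (\<Sum>i\<in>UNIV. Cg i * (\<kappa> 0 i * Gm)) + \<gamma>0 * D"
    using norm_triangle_ineq[of "jt (Suc 0)" "\<nu> (Suc 0)"] norm_\<nu>_1
    by (simp add: d_def u0 u_def[of "Suc 0"])
  then have "norm (d (Suc 0)) * norm (x (Suc 0) - X\<^sub>s)
      \<le> ((\<Sum>i\<in>UNIV. Cg i * (\<kappa> 0 i * Gm)) + \<gamma>0 * D) * (2 * (real CARD('i) * r))"
    by (intro mult_mono x1) (auto intro: order_trans[OF norm_ge_zero])
  then have 4: "- (d (Suc 0) \<bullet> (x (Suc 0) - X\<^sub>s)) \<le> ((\<Sum>i\<in>UNIV. Cg i * (\<kappa> 0 i * Gm)) + \<gamma>0 * D) * (2 * (real CARD('i) * r))"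
    using Cauchy_Schwarz_ineq2[of "d (Suc 0)" "x (Suc 0) - X\<^sub>s"] by linarith
  have V: "V \<theta>' \<nu>' (Suc 0) = \<gamma> (Suc 0) / \<gamma>0 / \<tau>t (Suc 0) / 2 * (norm (x (Suc 0) - X\<^sub>s))\<^sup>2
     + dual_dist \<theta>' \<nu>' (Suc 0) + (E (Suc 0) - d (Suc 0) \<bullet> (x (Suc 0) - X\<^sub>s))"
    unfolding V_def using gamma0 by (simp add: init)
  show ?thesis unfolding V init_const_def \<kappa>_0[symmetric] using 1 2 3 4 by linarith
qed

text \<open>Telescoping starts at index 1. The multipliers are controlled up to \<open>n\<close>
  only, while the conclusion reaches \<open>Suc n\<close>; the induction that bounds the multipliers
  rests on this lead of one index.\<close>

lemma V_sum:
  assumes l: "\<And>j i. j \<le> n \<Longrightarrow> l * norm (\<theta> j $ i) \<le> B * Lg\<^sub>m"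
    and dual: "\<And>i. \<theta>' $ i \<in> dual_cone (J i) (K i)" "(\<Sum>i\<in>UNIV. \<nu>' $ i) = 0"
    and M: "\<And>i. norm (\<theta>' $ i) \<le> M" "norm \<nu>' \<le> M"
  shows "(\<Sum>k<n. \<gamma> (Suc k) / \<gamma>0 * lagrangian_gap \<theta>' \<nu>' (x (Suc (Suc k)))) + V \<theta>' \<nu>' (Suc n)
    \<le> init_const M + (1 / \<tau>t 0 + \<mu>) / 2 * (2 * (real CARD('i) * r))\<^sup>2 + err_const M * err_total"
proof -
  have M0: "0 \<le> M" using M(2) norm_ge_zero order_trans by blast
  have "(\<Sum>k<n. \<gamma> (Suc k) / \<gamma>0 * lagrangian_gap \<theta>' \<nu>' (x (Suc (Suc k)))) + V \<theta>' \<nu>' (Suc n)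
    \<le> V \<theta>' \<nu>' (Suc 0) + err_const M * (\<Sum>k<n. \<beta> ^ q (Suc k) * real (Suc (Suc k)) ^ 4)"
    using l
  proof (induction n)
    case (Suc n)
    have "\<gamma> (Suc n) / \<gamma>0 * lagrangian_gap \<theta>' \<nu>' (x (Suc (Suc n))) + V \<theta>' \<nu>' (Suc (Suc n))
      \<le> V \<theta>' \<nu>' (Suc n) + \<gamma> (Suc n) / \<gamma>0 * err \<nu>' (Suc n)"
      by (rule V_step[OF Suc.prems Suc.prems dual]) auto
    moreover note err_bound[OF M(2), of "Suc n"]
    moreover note Suc.IH[OF Suc.prems]
    ultimately show ?case
      unfolding sum.lessThan_Suc distrib_left by (smt (verit, best) le_SucI)
  qed simp
  moreover have "(\<Sum>k<n. \<beta> ^ q (Suc k) * real (Suc (Suc k)) ^ 4) = (\<Sum>k\<in>Suc ` {..<n}. \<beta> ^ q k * real (Suc k) ^ 4)"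
    by (subst sum.reindex) auto
  then have "err_const M * (\<Sum>k<n. \<beta> ^ q (Suc k) * real (Suc (Suc k)) ^ 4) \<le> err_const M * err_total"
    using err_total_ge[of "Suc ` {..<n}"] err_const_nonneg[OF M0] by (intro mult_left_mono) auto
  ultimately show ?thesis using V_init[OF M] by linarith
qed

lemma gap_saddle_nonneg: "0 \<le> lagrangian_gap \<theta>s \<nu>s (x (Suc k))"
  unfolding lagrangian_gap_def by (rule saddle) (rule x_dom)

lemma saddle_norm_ge: "norm (\<theta>s $ i) \<le> saddle_norm" "norm \<nu>s \<le> saddle_norm" "0 \<le> saddle_norm"
  unfolding saddle_norm_def using Finite_Cartesian_Product.norm_nth_le[of \<theta>s i] by (auto intro: add_increasing2)

lemma V_saddle_le:
  assumes l: "\<And>j i. j \<le> n \<Longrightarrow> l * norm (\<theta> j $ i) \<le> B * Lg\<^sub>m"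
  shows "V \<theta>s \<nu>s (Suc n) \<le> dual_const + B * (Lg\<^sub>m * (2 * (real CARD('i) * r))\<^sup>2)"
proof -
  have "0 \<le> (\<Sum>k<n. \<gamma> (Suc k) / \<gamma>0 * lagrangian_gap \<theta>s \<nu>s (x (Suc (Suc k))))"
    using \<gamma>_pos gamma0 gap_saddle_nonneg by (intro sum_nonneg mult_nonneg_nonneg) (auto simp: less_imp_le)
  moreover have "(1 / \<tau>t 0 + \<mu>) / 2 * (2 * (real CARD('i) * r))\<^sup>2
      = (Lf\<^sub>m + 2 * \<gamma>0 * (1 + \<delta>) + \<mu>) / 2 * (2 * (real CARD('i) * r))\<^sup>2 + B * (Lg\<^sub>m * (2 * (real CARD('i) * r))\<^sup>2)"
    unfolding inverse_\<tau>t_0 by (simp add: add_divide_distrib distrib_right)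
  ultimately show ?thesis
    using V_sum[OF l \<theta>s_dual \<nu>s_sum saddle_norm_ge(1,2)] unfolding dual_const_def by fastforce
qed

text \<open>Strong induction: multipliers up to \<open>n\<close> below \<open>B\<close> validate the
  Lyapunov bound at \<open>Suc n\<close>, which controls the next distance to
  \<open>\<theta>s\<close> by the square root of an affine function of \<open>B\<close>.\<close>

lemma \<theta>_bounded:
  assumes l: "l \<le> Lg\<^sub>m" and B: "B_bar \<le> B"
  shows "norm (\<theta> k $ i) \<le> B"
proof (induction k arbitrary: i rule: less_induct)
  case (less k)
  show ?case
  proof (cases k)
    case 0
    then show ?thesis using B_nonneg by (simp add: init)
  next
    case (Suc n)
    let ?Q = "Lg\<^sub>m * (2 * (real CARD('i) * r))\<^sup>2" and ?s = "\<Sum>i\<in>UNIV. \<kappa> 0 i"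
    have lj: "l * norm (\<theta> j $ i) \<le> B * Lg\<^sub>m" if "j \<le> n" for j i
    proof -
      have "l * norm (\<theta> j $ i) \<le> Lg\<^sub>m * B"
        using less[of j i] that Suc l l_nonneg by (intro mult_mono) auto
      then show ?thesis by (simp add: mult.commute)
    qed
    have Q: "0 \<le> ?Q" using Lg\<^sub>m(2) by simp
    have P: "0 \<le> dual_const"
      unfolding dual_const_def using init_const_nonneg[OF saddle_norm_ge(3)] err_const_nonneg[OF saddle_norm_ge(3)]
        err_total_nonneg Lf\<^sub>m(2) gamma0 delta mu(1) by simp
    have s: "\<kappa> 0 i \<le> ?s" using \<kappa>_pos[of 0] by (intro member_le_sum) (auto simp: less_imp_le)
    have s0: "0 \<le> ?s" using \<kappa>_pos[of 0] by (intro sum_nonneg) (auto simp: less_imp_le)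
    have Bb: "2 * saddle_norm + 1 + 8 * ?s * (dual_const + ?Q) \<le> B"
      using B unfolding B_bar_def \<kappa>_0 .
    moreover have "0 \<le> 8 * ?s * (dual_const + ?Q)" using s0 P Q by simp
    ultimately have B1: "1 \<le> B" "2 * saddle_norm \<le> B" "8 * ?s * (dual_const + ?Q) \<le> B"
      using saddle_norm_ge(3) by linarith+
    have "(norm (\<theta>s $ i - \<theta> (Suc n) $ i))\<^sup>2 / (2 * \<kappa> 0 i) \<le> (\<Sum>i\<in>UNIV. (norm (\<theta>s $ i - \<theta> (Suc n) $ i))\<^sup>2 / (2 * \<kappa> 0 i))"
      using \<kappa>_pos[of 0] by (intro member_le_sum) (auto simp: less_imp_le)
    also have "\<dots> \<le> dual_dist \<theta>s \<nu>s (Suc n)" unfolding dual_dist_def using gamma0 by simp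
    also have "\<dots> \<le> V \<theta>s \<nu>s (Suc n)"
    proof -
      have "0 \<le> \<gamma> (Suc n) / \<gamma>0 / \<tau>t (Suc n) / 4 * (norm (x (Suc n) - X\<^sub>s))\<^sup>2"
        using \<gamma>_pos[of "Suc n"] \<tau>t_pos[of "Suc n"] gamma0 by simp
      then show ?thesis using V_lower[OF lj[OF order_refl], of \<theta>s \<nu>s] by linarith
    qed
    also have "\<dots> \<le> dual_const + B * ?Q" by (rule V_saddle_le[OF lj])
    \<comment> \<open>\<open>B \<ge> 1\<close> makes the affine bound homogeneous in
      \<open>B\<close>, so that it compares with \<open>(B / 2)\<^sup>2\<close>.\<close>
    also have "\<dots> \<le> B * (dual_const + ?Q)"
      using mult_right_mono[OF B1(1) P] by (simp add: distrib_left)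
    finally have "(norm (\<theta>s $ i - \<theta> (Suc n) $ i))\<^sup>2 \<le> 2 * \<kappa> 0 i * (B * (dual_const + ?Q))"
      using \<kappa>_pos[of 0 i] by (simp add: pos_divide_le_eq mult.commute)
    also have "\<dots> \<le> 2 * ?s * (B * (dual_const + ?Q))"
      using s P Q B_nonneg by (intro mult_right_mono) auto
    also have "\<dots> = B * (8 * ?s * (dual_const + ?Q)) / 4" by simp
    also have "\<dots> \<le> B * B / 4" using B1(3) B_nonneg by (intro divide_right_mono mult_left_mono) auto
    also have "\<dots> = (B / 2)\<^sup>2" by (simp add: power2_eq_square)
    finally have "norm (\<theta>s $ i - \<theta> (Suc n) $ i) \<le> B / 2"
      by (rule power2_le_imp_le) (use B_nonneg in simp)
    moreover have "norm (\<theta> (Suc n) $ i) \<le> norm (\<theta>s $ i) + norm (\<theta>s $ i - \<theta> (Suc n) $ i)"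
      by (metis norm_minus_commute norm_triangle_sub add.commute)
    ultimately show ?thesis using B1(2) saddle_norm_ge(1)[of i] Suc by simp
  qed
qed

end

section \<open>Convergence rates\<close>

context dpda_problem
begin

lemma convex_on_inner_g:
  assumes "\<theta>' \<in> dual_cone (J i) (K i)"
  shows "convex_on UNIV (\<lambda>y. \<theta>' \<bullet> g i y)"
proof (rule convex_onI)
  fix t :: real and y z :: "real ^ 'n"
  assume t: "0 < t" "t < 1"
  have "(1 - t) *\<^sub>R g i y + (1 - (1 - t)) *\<^sub>R g i z - g i ((1 - t) *\<^sub>R y + (1 - (1 - t)) *\<^sub>R z) \<in> K i"
    using g_convex[of i] t unfolding cone_convex_def by (metis atLeastAtMost_iff diff_ge_0_iff_ge less_imp_le diff_le_eq add_increasing2 order_refl)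
  then have "0 \<le> \<theta>' \<bullet> ((1 - t) *\<^sub>R g i y + t *\<^sub>R g i z - g i ((1 - t) *\<^sub>R y + t *\<^sub>R z))"
    using assms by (simp add: dual_cone_def)
  then show "\<theta>' \<bullet> g i ((1 - t) *\<^sub>R y + t *\<^sub>R z) \<le> (1 - t) * (\<theta>' \<bullet> g i y) + t * (\<theta>' \<bullet> g i z)"
    by (simp add: inner_diff_right inner_add_right)
qed simp

lemma edom_convex_combination:
  assumes "finite S" "sum a S = 1" "\<And>k. k \<in> S \<Longrightarrow> 0 \<le> a k"
    "\<And>k. k \<in> S \<Longrightarrow> z k $ i \<in> edom (\<rho> i)"
  shows "(\<Sum>k\<in>S. a k *\<^sub>R z k) $ i \<in> edom (\<rho> i)"
  unfolding sum_component vector_scaleR_component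
  by (rule convex_sum[OF assms(1) convex_edom[OF rho] assms(2,3,4)])

text \<open>Jensen's inequality node by node: for multipliers in the dual cones each summand is
  convex on its domain, and the pairing with \<open>\<nu>'\<close> is linear.\<close>

lemma lagrangian_gap_convex_combination:
  assumes S: "finite S" "sum a S = 1" "\<And>k. k \<in> S \<Longrightarrow> 0 \<le> a k"
    and z: "\<And>k i. k \<in> S \<Longrightarrow> z k $ i \<in> edom (\<rho> i)"
    and \<theta>': "\<And>i. \<theta>' $ i \<in> dual_cone (J i) (K i)"
  shows "lagrangian_gap \<theta>' \<nu>' (\<Sum>k\<in>S. a k *\<^sub>R z k) \<le> (\<Sum>k\<in>S. a k * lagrangian_gap \<theta>' \<nu>' (z k))"
proof -
  let ?h = "\<lambda>i y. real_of_ereal (\<rho> i y) + f i y + \<theta>' $ i \<bullet> g i y"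
  let ?c = "\<Sum>i\<in>UNIV. real_of_ereal (\<rho> i xs) + f i xs"
  have S0: "S \<noteq> {}" using S(2) by auto
  have cv: "convex_on (edom (\<rho> i)) (?h i)" for i
    by (intro convex_on_add convex_on_real_of_ereal rho)
      (use f_convex convex_on_inner_g[OF \<theta>'] convex_on_subset[OF _ subset_UNIV convex_edom[OF rho]] in blast)+
  have gap: "lagrangian_gap \<theta>' \<nu>' w = (\<Sum>i\<in>UNIV. ?h i (w $ i)) - ?c + \<nu>' \<bullet> w" for w
    by (simp add: lagrangian_gap_def sum.distrib)
  have "?h i ((\<Sum>k\<in>S. a k *\<^sub>R z k) $ i) \<le> (\<Sum>k\<in>S. a k * ?h i (z k $ i))" for i
    unfolding sum_component vector_scaleR_component
    by (rule convex_on_sum[OF S(1) S0 cv S(2,3) z])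
  then have "(\<Sum>i\<in>UNIV. ?h i ((\<Sum>k\<in>S. a k *\<^sub>R z k) $ i)) \<le> (\<Sum>i\<in>UNIV. \<Sum>k\<in>S. a k * ?h i (z k $ i))"
    by (rule sum_mono)
  also have "\<dots> = (\<Sum>k\<in>S. a k * (\<Sum>i\<in>UNIV. ?h i (z k $ i)))"
    unfolding sum_distrib_left by (rule sum.swap)
  finally have "lagrangian_gap \<theta>' \<nu>' (\<Sum>k\<in>S. a k *\<^sub>R z k)
      \<le> (\<Sum>k\<in>S. a k * (\<Sum>i\<in>UNIV. ?h i (z k $ i))) - sum a S * ?c + (\<Sum>k\<in>S. a k * (\<nu>' \<bullet> z k))"
    unfolding gap S(2) inner_sum_right inner_scaleR_right by simp
  also have "\<dots> = (\<Sum>k\<in>S. a k * lagrangian_gap \<theta>' \<nu>' (z k))"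
    unfolding gap sum_distrib_right by (simp only: distrib_left right_diff_distrib sum.distrib sum_subtractf)
  finally show ?thesis .
qed

text \<open>
  Testing the gap with multipliers aligned with the residuals, and of twice the size of the optimal
  ones, separates the infeasibility from the suboptimality.
\<close>

lemma gap_certificate:
  assumes z: "\<And>i. z $ i \<in> edom (\<rho> i)"
    and ub: "\<And>\<theta>' \<nu>'. (\<And>i. \<theta>' $ i \<in> dual_cone (J i) (K i)) \<Longrightarrow> (\<Sum>i\<in>UNIV. \<nu>' $ i) = 0 \<Longrightarrow>
       (\<And>i. norm (\<theta>' $ i) \<le> 2 * saddle_norm + 1) \<Longrightarrow> norm \<nu>' \<le> 2 * saddle_norm + 1 \<Longrightarrow>
       lagrangian_gap \<theta>' \<nu>' z \<le> a"
  shows "\<bar>(\<Sum>i\<in>UNIV. real_of_ereal (\<rho> i (z $ i)) + f i (z $ i)) - (\<Sum>i\<in>UNIV. real_of_ereal (\<rho> i xs) + f i xs)\<bar> \<le> a"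
    and "proj_dist consensus z + (\<Sum>i\<in>UNIV. norm (\<theta>s $ i) * proj_dist (uminus ` K i) (g i (z $ i))) \<le> a"
proof -
  define \<Phi> where "\<Phi> = (\<Sum>i\<in>UNIV. real_of_ereal (\<rho> i (z $ i)) + f i (z $ i)) - (\<Sum>i\<in>UNIV. real_of_ereal (\<rho> i xs) + f i xs)"
  define dg where "dg i = proj_dist (uminus ` K i) (g i (z $ i))" for i
  define \<pi> where "\<pi> i = g i (z $ i) - closest_point (uminus ` K i) (g i (z $ i))" for i
  define P where "P = closest_point consensus z"
  define dc where "dc = proj_dist consensus z"
  have n\<pi>: "norm (\<pi> i) = dg i" for i by (simp add: dg_def \<pi>_def proj_dist_def norm_minus_commute)
  have nP: "norm (z - P) = dc" by (simp add: dc_def P_def proj_dist_def norm_minus_commute)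
  have dg0: "0 \<le> dg i" for i using n\<pi>[of i, symmetric] by simp
  have dc0: "0 \<le> dc" using nP[symmetric] by simp
  obtain c where c: "\<And>i. P $ i = c" "(\<Sum>i\<in>UNIV. z $ i - c) = 0"
    using closest_point_consensus[of z] unfolding P_def by blast
  have P0: "v \<bullet> P = 0" if "(\<Sum>i\<in>UNIV. v $ i) = 0" for v
  proof -
    have "v \<bullet> P = (\<Sum>i\<in>UNIV. v $ i) \<bullet> c" by (simp add: inner_vec_def[of v] c inner_sum_left)
    then show ?thesis using that by simp
  qed
  have sumP: "(\<Sum>i\<in>UNIV. (z - P) $ i) = 0" using c by simp
  \<comment> \<open>Normalized residuals, scaled to twice the optimal multipliers. For consensus an
    extra 1 is added, which leaves \<open>dc\<close> itself in the final estimate even if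
    \<open>\<nu>s\<close> vanishes. Division by zero yields the zero multiplier, as wanted for a
    vanishing residual.\<close>
  define \<theta>' where "\<theta>' = (\<chi> i. (2 * norm (\<theta>s $ i) / dg i) *\<^sub>R \<pi> i)"
  define \<nu>' where "\<nu>' = ((2 * norm \<nu>s + 1) / dc) *\<^sub>R (z - P)"
  have saddle_norms: "norm (\<theta>s $ i) \<le> saddle_norm" "norm \<nu>s \<le> saddle_norm" for i
    unfolding saddle_norm_def using Finite_Cartesian_Product.norm_nth_le[of \<theta>s i] by (auto intro: add_increasing2)
  have "lagrangian_gap \<theta>' \<nu>' z \<le> a"
  proof (rule ub)
    show "\<theta>' $ i \<in> dual_cone (J i) (K i)" for i
      unfolding \<theta>'_def \<pi>_def vec_lambda_beta using dg0
      by (intro dual_cone_scaleR residual_in_dual_cone cones g_space) auto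
    show "(\<Sum>i\<in>UNIV. \<nu>' $ i) = 0"
      unfolding \<nu>'_def vector_scaleR_component scaleR_sum_right[symmetric] sumP by simp
    show "norm (\<theta>' $ i) \<le> 2 * saddle_norm + 1" for i
    proof -
      have "norm (\<theta>' $ i) \<le> 2 * norm (\<theta>s $ i)" by (cases "dg i = 0") (simp_all add: \<theta>'_def n\<pi> dg0)
      then show ?thesis using saddle_norms(1)[of i] by linarith
    qed
    have "norm \<nu>' \<le> 2 * norm \<nu>s + 1" by (cases "dc = 0") (simp_all add: \<nu>'_def nP dc0)
    then show "norm \<nu>' \<le> 2 * saddle_norm + 1" using saddle_norms(2) by linarith
  qed
  moreover have "\<theta>' $ i \<bullet> g i (z $ i) = 2 * (norm (\<theta>s $ i) * dg i)" for i
  proof -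
    have "\<pi> i \<bullet> g i (z $ i) = (dg i)\<^sup>2"
      unfolding \<pi>_def dg_def by (rule inner_residual[OF cones(2,3,1) g_space])
    then show ?thesis by (cases "dg i = 0") (simp_all add: \<theta>'_def power2_eq_square)
  qed
  moreover have "\<nu>' \<bullet> z = (2 * norm \<nu>s + 1) * dc"
  proof -
    have "(z - P) \<bullet> z = (z - P) \<bullet> (z - P)" using P0[OF sumP] by (simp add: inner_diff_right)
    also have "\<dots> = dc\<^sup>2" by (simp add: nP flip: power2_norm_eq_inner)
    finally show ?thesis by (cases "dc = 0") (simp_all add: \<nu>'_def power2_eq_square)
  qed
  ultimately have 1: "\<Phi> + 2 * (\<Sum>i\<in>UNIV. norm (\<theta>s $ i) * dg i) + (2 * (norm \<nu>s * dc) + dc) \<le> a"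
    unfolding lagrangian_gap_def \<Phi>_def sum_distrib_left by (simp add: distrib_right mult.assoc)
  have "(\<Sum>i\<in>UNIV. \<theta>s $ i \<bullet> g i (z $ i)) \<le> (\<Sum>i\<in>UNIV. norm (\<theta>s $ i) * dg i)"
    unfolding dg_def by (rule sum_mono) (rule inner_dual_cone_le[OF cones(2,3,1) g_space \<theta>s_dual])
  moreover have "\<nu>s \<bullet> z \<le> norm \<nu>s * dc"
  proof -
    have "\<nu>s \<bullet> z = \<nu>s \<bullet> (z - P)" using P0[OF \<nu>s_sum] by (simp add: inner_diff_right)
    then show ?thesis unfolding nP[symmetric] by (simp add: norm_cauchy_schwarz)
  qed
  \<comment> \<open>The saddle inequality contains each residual once, the tested gap twice. Their
    difference bounds the infeasibility by \<open>a\<close>, and then the saddle inequality bounds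
    \<open>\<Phi>\<close> from below by \<open>- a\<close>.\<close>
  ultimately have 2: "0 \<le> \<Phi> + (\<Sum>i\<in>UNIV. norm (\<theta>s $ i) * dg i) + norm \<nu>s * dc"
    using saddle[OF z] unfolding \<Phi>_def by linarith
  have 3: "0 \<le> (\<Sum>i\<in>UNIV. norm (\<theta>s $ i) * dg i)" "0 \<le> norm \<nu>s * dc"
    using dg0 dc0 by (auto intro: sum_nonneg)
  show "\<bar>(\<Sum>i\<in>UNIV. real_of_ereal (\<rho> i (z $ i)) + f i (z $ i)) - (\<Sum>i\<in>UNIV. real_of_ereal (\<rho> i xs) + f i xs)\<bar> \<le> a"
    unfolding \<Phi>_def[symmetric] using 1 2 3 dc0 by linarith
  show "proj_dist consensus z + (\<Sum>i\<in>UNIV. norm (\<theta>s $ i) * proj_dist (uminus ` K i) (g i (z $ i))) \<le> a"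
    unfolding dg_def[symmetric] dc_def[symmetric] using 1 2 3 by linarith
qed

lemma sep_objective_eq:
  assumes "\<And>i. z $ i \<in> edom (\<rho> i)"
  shows "sep_objective \<rho> f z = ereal (\<Sum>i\<in>UNIV. real_of_ereal (\<rho> i (z $ i)) + f i (z $ i))"
proof -
  have "phi \<rho> f i (z $ i) = ereal (real_of_ereal (\<rho> i (z $ i)) + f i (z $ i))" for i
    unfolding phi_def by (subst edom_eq_real[OF rho assms]) simp
  then show ?thesis by (simp add: sep_objective_def)
qed

end

section \<open>Rates along a run with controlled multipliers\<close>

context dpda_run
begin

context
  assumes l_\<theta>: "\<And>k i. l * norm (\<theta> k $ i) \<le> B * Lg\<^sub>m"
begin

text \<open>The ergodic average starts with \<open>x (Suc 0)\<close>, whose gap is outside the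
  telescoping sum; the first three summands bound it directly. The rest is the Lyapunov bound for
  the test multipliers of \<open>gap_certificate\<close>, of size at most
  \<open>2 * saddle_norm + 1\<close>.\<close>

definition rate_const :: real where
  "rate_const = \<bar>(\<Sum>i\<in>UNIV. real_of_ereal (\<rho> i (x (Suc 0) $ i)) + f i (x (Suc 0) $ i)) - (\<Sum>i\<in>UNIV. real_of_ereal (\<rho> i xs) + f i xs)\<bar>
     + real CARD('i) * ((2 * saddle_norm + 1) * Gm) + (2 * saddle_norm + 1) * (real CARD('i) * r)
     + (init_const (2 * saddle_norm + 1) + (1 / \<tau>t 0 + \<mu>) / 2 * (2 * (real CARD('i) * r))\<^sup>2
     + err_const (2 * saddle_norm + 1) * err_total)"

lemma weighted_gap_sum:
  assumes dual: "\<And>i. \<theta>' $ i \<in> dual_cone (J i) (K i)" "(\<Sum>i\<in>UNIV. \<nu>' $ i) = 0"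
    and M: "\<And>i. norm (\<theta>' $ i) \<le> 2 * saddle_norm + 1" "norm \<nu>' \<le> 2 * saddle_norm + 1"
  shows "(\<Sum>k<Suc n. \<gamma> k / \<gamma>0 * lagrangian_gap \<theta>' \<nu>' (x (Suc k))) \<le> rate_const"
proof -
  let ?M = "2 * saddle_norm + 1"
  have "(\<Sum>i\<in>UNIV. \<theta>' $ i \<bullet> g i (x (Suc 0) $ i)) \<le> (\<Sum>i\<in>(UNIV::'i set). ?M * Gm)"
  proof (rule sum_mono)
    fix i
    have "\<theta>' $ i \<bullet> g i (x (Suc 0) $ i) \<le> norm (\<theta>' $ i) * norm (g i (x (Suc 0) $ i))" by (rule norm_cauchy_schwarz)
    also have "\<dots> \<le> ?M * Gm" using saddle_norm_ge(3) by (intro mult_mono M g_le_Gm x_dom) auto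
    finally show "\<theta>' $ i \<bullet> g i (x (Suc 0) $ i) \<le> ?M * Gm" .
  qed
  moreover have "\<nu>' \<bullet> x (Suc 0) \<le> ?M * (real CARD('i) * r)"
    using norm_cauchy_schwarz[of \<nu>' "x (Suc 0)"] mult_mono[OF M(2) norm_x[of 0]] saddle_norm_ge(3) by force
  ultimately have g0: "lagrangian_gap \<theta>' \<nu>' (x (Suc 0)) \<le> \<bar>(\<Sum>i\<in>UNIV. real_of_ereal (\<rho> i (x (Suc 0) $ i)) + f i (x (Suc 0) $ i)) - (\<Sum>i\<in>UNIV. real_of_ereal (\<rho> i xs) + f i xs)\<bar>
     + real CARD('i) * (?M * Gm) + ?M * (real CARD('i) * r)"
    unfolding lagrangian_gap_def by simp
  have "\<gamma> 0 / \<gamma>0 = 1" using gamma0 by (simp add: init)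
  then have "(\<Sum>k<Suc n. \<gamma> k / \<gamma>0 * lagrangian_gap \<theta>' \<nu>' (x (Suc k)))
      = lagrangian_gap \<theta>' \<nu>' (x (Suc 0)) + (\<Sum>k<n. \<gamma> (Suc k) / \<gamma>0 * lagrangian_gap \<theta>' \<nu>' (x (Suc (Suc k))))"
    unfolding sum.lessThan_Suc_shift by simp
  then show ?thesis
    using g0 V_sum[OF l_\<theta> dual M, of n] V_nonneg[OF l_\<theta>, of \<theta>' \<nu>' n] unfolding rate_const_def by linarith
qed

lemma V_saddle_le_rate_const: "V \<theta>s \<nu>s (Suc n) \<le> rate_const"
proof -
  have M: "norm (\<theta>s $ i) \<le> 2 * saddle_norm + 1" "norm \<nu>s \<le> 2 * saddle_norm + 1" for i
    using saddle_norm_ge(1)[of i] saddle_norm_ge(2,3) by linarith+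
  have "0 \<le> (\<Sum>k<n. \<gamma> (Suc k) / \<gamma>0 * lagrangian_gap \<theta>s \<nu>s (x (Suc (Suc k))))"
    using \<gamma>_pos gamma0 gap_saddle_nonneg by (intro sum_nonneg mult_nonneg_nonneg) (auto simp: less_imp_le)
  moreover have "0 \<le> real CARD('i) * ((2 * saddle_norm + 1) * Gm)" "0 \<le> (2 * saddle_norm + 1) * (real CARD('i) * r)"
    using saddle_norm_ge(3) Gm_nonneg dom_radius_nonneg by simp_all
  ultimately show ?thesis
    using V_sum[OF l_\<theta> \<theta>s_dual \<nu>s_sum M, of n] unfolding rate_const_def by linarith
qed

lemma rate_const_nonneg: "0 \<le> rate_const"
  using V_saddle_le_rate_const[of 0] V_nonneg[OF l_\<theta>, of \<theta>s \<nu>s 0] by linarith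

lemma distance_rate:
  assumes "n \<ge> 1"
  shows "(norm (x n - X\<^sub>s))\<^sup>2 \<le> \<tau>t n / \<gamma> n * (4 * \<gamma>0) * rate_const"
proof -
  obtain m where n: "n = Suc m" using assms by (cases n) auto
  have "\<gamma> n / \<gamma>0 / \<tau>t n / 4 * (norm (x n - X\<^sub>s))\<^sup>2 \<le> rate_const"
    using V_lower[OF l_\<theta>, of m \<theta>s \<nu>s] dual_dist_nonneg[of \<theta>s \<nu>s n] V_saddle_le_rate_const[of m]
    unfolding n by linarith
  then show ?thesis using \<gamma>_pos[of n] \<tau>t_pos[of n] gamma0 by (simp add: field_simps)
qed

lemma weight_sum_pos: "n \<ge> 1 \<Longrightarrow> 0 < weight_sum \<gamma> n"
  unfolding weight_sum_eq using \<gamma>_pos by (intro sum_pos) (auto simp: lessThan_empty_iff)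

lemma ergodic_avg_eq: "ergodic_avg \<gamma> x n = (\<Sum>k<n. (\<gamma> k / \<gamma>0 / weight_sum \<gamma> n) *\<^sub>R x (Suc k))"
proof -
  have "(\<Sum>k=1..n. (\<gamma> (k - 1) / \<gamma> 0) *\<^sub>R x k) = (\<Sum>k<n. (\<gamma> k / \<gamma>0) *\<^sub>R x (Suc k))"
    by (rule sum.reindex_bij_witness[of _ Suc "\<lambda>k. k - 1"]) (auto simp: init)
  then show ?thesis
    unfolding ergodic_avg_def by (simp add: scaleR_sum_right divide_inverse mult_ac)
qed

text \<open>The bound on the weighted gaps has one constant for all test multipliers of the given
  size, so these may depend on the residuals of the average, as \<open>gap_certificate\<close>
  demands.\<close>

lemma ergodic_rate:
  assumes n: "n \<ge> 1"
  shows "max \<bar>sep_objective \<rho> f (ergodic_avg \<gamma> x n) - sep_objective \<rho> f X\<^sub>s\<bar>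
              (ereal (proj_dist consensus (ergodic_avg \<gamma> x n)
                 + (\<Sum>i\<in>UNIV. norm (\<theta>s $ i)
                     * proj_dist (uminus ` K i) (g i (ergodic_avg \<gamma> x n $ i)))))
            \<le> ereal (rate_const / weight_sum \<gamma> n)"
proof -
  let ?W = "weight_sum \<gamma> n" and ?z = "ergodic_avg \<gamma> x n"
  have W: "0 < ?W" by (rule weight_sum_pos[OF n])
  obtain m where m: "n = Suc m" using n by (cases n) auto
  have a: "(\<Sum>k<n. \<gamma> k / \<gamma>0 / ?W) = 1"
  proof -
    have "(\<Sum>k<n. \<gamma> k / \<gamma>0) = ?W" by (simp only: weight_sum_eq init)
    moreover have "?W / ?W = 1" using W by simp
    ultimately show ?thesis by (metis sum_divide_distrib)
  qed
  have a0: "0 \<le> \<gamma> k / \<gamma>0 / ?W" for k using \<gamma>_pos[of k] gamma0 W by simp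
  have z: "?z $ i \<in> edom (\<rho> i)" for i
    unfolding ergodic_avg_eq by (rule edom_convex_combination[OF _ a a0 x_dom]) simp
  have "lagrangian_gap \<theta>' \<nu>' ?z \<le> rate_const / ?W"
    if dual: "\<And>i. \<theta>' $ i \<in> dual_cone (J i) (K i)" "(\<Sum>i\<in>UNIV. \<nu>' $ i) = 0"
      and M: "\<And>i. norm (\<theta>' $ i) \<le> 2 * saddle_norm + 1" "norm \<nu>' \<le> 2 * saddle_norm + 1" for \<theta>' \<nu>'
  proof -
    have "lagrangian_gap \<theta>' \<nu>' ?z \<le> (\<Sum>k<n. \<gamma> k / \<gamma>0 / ?W * lagrangian_gap \<theta>' \<nu>' (x (Suc k)))"
      unfolding ergodic_avg_eq
      by (rule lagrangian_gap_convex_combination[OF _ a a0 x_dom dual(1)]) simp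
    also have "\<dots> = (\<Sum>k<n. \<gamma> k / \<gamma>0 * lagrangian_gap \<theta>' \<nu>' (x (Suc k))) / ?W"
      by (simp add: sum_divide_distrib)
    also have "\<dots> \<le> rate_const / ?W"
      using weighted_gap_sum[OF dual M, of m] W unfolding m by (intro divide_right_mono) auto
    finally show ?thesis .
  qed
  note cert = gap_certificate[OF z this]
  have ereal_max: "max \<bar>ereal v - ereal v'\<bar> (ereal w) \<le> ereal c" if "\<bar>v - v'\<bar> \<le> c" "w \<le> c" for v v' w c
    using that by simp
  show ?thesis
    unfolding sep_objective_eq[OF z] sep_objective_eq[of X\<^sub>s, unfolded X\<^sub>s_def vec_lambda_beta, OF xs_dom, folded X\<^sub>s_def]
    by (rule ereal_max[OF cert])
qed

lemma weight_rate_bigo: "(\<lambda>n. rate_const / weight_sum \<gamma> n) \<in> O(\<lambda>n. 1 / (real n)\<^sup>2)"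
proof -
  obtain b where b: "b > 0" "\<And>n. b * (real n)\<^sup>2 \<le> weight_sum \<gamma> n" using weight_sum_lower by blast
  show ?thesis
  proof (rule bigoI[of _ "rate_const / b"])
    show "\<forall>\<^sub>F n in sequentially. norm (rate_const / weight_sum \<gamma> n) \<le> rate_const / b * norm (1 / (real n)\<^sup>2)"
      using eventually_gt_at_top[of 0]
    proof eventually_elim
      case (elim n)
      have "0 < weight_sum \<gamma> n * (b * (real n)\<^sup>2)"
        using elim b(1) by (intro mult_pos_pos weight_sum_pos) auto
      then have "rate_const / weight_sum \<gamma> n \<le> rate_const / (b * (real n)\<^sup>2)"
        by (rule divide_left_mono[OF b(2) rate_const_nonneg])
      then show ?case using rate_const_nonneg weight_sum_pos[of n] elim by simp
    qed
  qed
qed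

lemma distance_rate_le:
  obtains c where "0 \<le> c" "\<And>n. n \<ge> 1 \<Longrightarrow> \<tau>t n / \<gamma> n * (4 * \<gamma>0) * rate_const \<le> c * (1 / (real n)\<^sup>2)"
proof -
  obtain b where b: "b > 0" "\<And>n. b * (real n)\<^sup>2 \<le> \<gamma> n / \<tau>t n" using ratio_lower by blast
  have "\<tau>t n / \<gamma> n * (4 * \<gamma>0) * rate_const \<le> (4 * \<gamma>0 * rate_const / b) * (1 / (real n)\<^sup>2)" if "n \<ge> 1" for n
  proof -
    have "0 < b * (real n)\<^sup>2" using b(1) that by simp
    then have "0 < \<gamma> n / \<tau>t n * (b * (real n)\<^sup>2)"
      by (rule mult_pos_pos[OF divide_pos_pos[OF \<gamma>_pos \<tau>t_pos]])
    then have "1 / (\<gamma> n / \<tau>t n) \<le> 1 / (b * (real n)\<^sup>2)"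
      by (rule divide_left_mono[OF b(2) zero_le_one])
    then have "\<tau>t n / \<gamma> n \<le> 1 / (b * (real n)\<^sup>2)" by simp
    then have "\<tau>t n / \<gamma> n * (4 * \<gamma>0 * rate_const) \<le> 1 / (b * (real n)\<^sup>2) * (4 * \<gamma>0 * rate_const)"
      using gamma0 rate_const_nonneg by (intro mult_right_mono) auto
    then show ?thesis by (simp add: mult_ac)
  qed
  then show ?thesis using that[of "4 * \<gamma>0 * rate_const / b"] b(1) gamma0 rate_const_nonneg by simp
qed

lemma distance_rate_bigo: "(\<lambda>n. \<tau>t n / \<gamma> n * (4 * \<gamma>0) * rate_const) \<in> O(\<lambda>n. 1 / (real n)\<^sup>2)"
proof -
  obtain c where c: "0 \<le> c" "\<And>n. n \<ge> 1 \<Longrightarrow> \<tau>t n / \<gamma> n * (4 * \<gamma>0) * rate_const \<le> c * (1 / (real n)\<^sup>2)"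
    using distance_rate_le by blast
  show ?thesis
  proof (rule bigoI[of _ c])
    show "\<forall>\<^sub>F n in sequentially. norm (\<tau>t n / \<gamma> n * (4 * \<gamma>0) * rate_const) \<le> c * norm (1 / (real n)\<^sup>2)"
      using eventually_ge_at_top[of 1]
    proof eventually_elim
      case (elim n)
      have "0 \<le> \<tau>t n / \<gamma> n * (4 * \<gamma>0) * rate_const"
        using \<gamma>_pos[of n] \<tau>t_pos[of n] gamma0 rate_const_nonneg by simp
      then show ?case using c(2)[OF elim] by simp
    qed
  qed
qed

lemma iterates_converge: "x \<longlonglongrightarrow> X\<^sub>s"
proof -
  obtain c where c: "0 \<le> c" "\<And>n. n \<ge> 1 \<Longrightarrow> \<tau>t n / \<gamma> n * (4 * \<gamma>0) * rate_const \<le> c * (1 / (real n)\<^sup>2)"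
    using distance_rate_le by blast
  have "(\<lambda>n. (norm (x n - X\<^sub>s))\<^sup>2) \<longlonglongrightarrow> 0"
  proof (rule tendsto_sandwich[OF _ _ tendsto_const])
    show "(\<lambda>n. c * (1 / (real n)\<^sup>2)) \<longlonglongrightarrow> 0"
      by (intro tendsto_mult_right_zero tendsto_divide_0[OF tendsto_const] filterlim_at_top_imp_at_infinity
          filterlim_pow_at_top filterlim_real_sequentially) simp
    show "\<forall>\<^sub>F n in sequentially. (norm (x n - X\<^sub>s))\<^sup>2 \<le> c * (1 / (real n)\<^sup>2)"
      using eventually_ge_at_top[of 1]
      by eventually_elim (use distance_rate c(2) order_trans in blast)
  qed simp
  from tendsto_real_sqrt[OF this] have "(\<lambda>n. norm (x n - X\<^sub>s)) \<longlonglongrightarrow> 0" by simp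
  then show ?thesis by (simp add: tendsto_norm_zero_iff LIM_zero_iff)
qed

text \<open>A constant is of the order of the partial sums because these are at least their first
  term, which is positive.\<close>

lemma rate_const_bigo: "(\<lambda>_. rate_const) \<in> O(\<lambda>n. \<Sum>k=1..n. \<beta> ^ q (k - 1) * real k ^ 4)"
proof (rule bigoI[of _ "rate_const / \<beta> ^ q 0"])
  show "\<forall>\<^sub>F n in sequentially. norm rate_const \<le> rate_const / \<beta> ^ q 0 * norm (\<Sum>k=1..n. \<beta> ^ q (k - 1) * real k ^ 4)"
    using eventually_ge_at_top[of 1]
  proof eventually_elim
    case (elim n)
    let ?S = "\<Sum>k=1..n. \<beta> ^ q (k - 1) * real k ^ 4"
    have "\<beta> ^ q (1 - 1) * real 1 ^ 4 \<le> ?S"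
      using elim averaging by (intro member_le_sum) auto
    then have S: "\<beta> ^ q 0 \<le> ?S" by simp
    have "rate_const = rate_const / \<beta> ^ q 0 * \<beta> ^ q 0" using averaging by simp
    also have "\<dots> \<le> rate_const / \<beta> ^ q 0 * norm ?S"
      using S rate_const_nonneg averaging by (intro mult_left_mono) auto
    finally show ?case using rate_const_nonneg by simp
  qed
qed

lemma parameter_bigo: "(\<lambda>n. max (weight_sum \<gamma> n) (\<gamma> n / \<tau>t n)) \<in> O(\<lambda>n. (real n)\<^sup>2)"
proof (rule landau_o.big_trans[OF _ sum_in_bigo(1)[OF weight_sum_bigo ratio_bigo]])
  show "(\<lambda>n. max (weight_sum \<gamma> n) (\<gamma> n / \<tau>t n)) \<in> O(\<lambda>n. weight_sum \<gamma> n + \<gamma> n / \<tau>t n)"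
  proof (rule bigoI[of _ 1])
    show "\<forall>\<^sub>F n in sequentially. norm (max (weight_sum \<gamma> n) (\<gamma> n / \<tau>t n)) \<le> 1 * norm (weight_sum \<gamma> n + \<gamma> n / \<tau>t n)"
      using eventually_ge_at_top[of 1]
    proof eventually_elim
      case (elim n)
      have "0 < weight_sum \<gamma> n" "0 < \<gamma> n / \<tau>t n"
        using weight_sum_pos[OF elim] \<gamma>_pos[of n] \<tau>t_pos[of n] by simp_all
      then show ?case unfolding real_norm_def max_def by auto
    qed
  qed
qed

end

end

text \<open>Stationarity supplies one subgradient per node, so the Lagrangian can be minimized in
  each block separately once \<open>\<nu>s\<close> compensates the differences between the nodes.
  The zero duality gap gives complementary slackness, which removes the constraint terms at
  \<open>xs\<close>.\<close>

lemma saddle_point_exists: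
  fixes \<rho> :: "'i::finite \<Rightarrow> real ^ 'n \<Rightarrow> ereal"
    and g :: "'i \<Rightarrow> real ^ 'n \<Rightarrow> real ^ 'm"
  assumes rho: "\<And>i. proper_closed_convex (\<rho> i)"
    and no_gap: "zero_duality_gap \<rho> f g J K"
    and sol: "primal_dual_solution \<rho> f g J K xs \<theta>s"
    and g_diff: "\<And>i x. g i differentiable (at x)"
    and g_convex: "\<And>i. cone_convex (K i) (g i)"
  shows "xs \<in> edom (\<rho> i)"
    and "g i xs \<in> uminus ` K i"
    and "\<theta>s $ i \<in> dual_cone (J i) (K i)"
    and "\<exists>\<nu>s. (\<Sum>i\<in>UNIV. \<nu>s $ i) = 0 \<and> (\<forall>z. (\<forall>i. z $ i \<in> edom (\<rho> i)) \<longrightarrow>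
       0 \<le> (\<Sum>i\<in>UNIV. real_of_ereal (\<rho> i (z $ i)) + f i (z $ i))
          - (\<Sum>i\<in>UNIV. real_of_ereal (\<rho> i xs) + f i xs)
          + (\<Sum>i\<in>UNIV. \<theta>s $ i \<bullet> g i (z $ i)) + \<nu>s \<bullet> z)"
proof -
  have feas: "xs \<in> feasible g K" and fin: "objective \<rho> f xs < \<infinity>"
    and opt: "\<And>y. y \<in> feasible g K \<Longrightarrow> objective \<rho> f xs \<le> objective \<rho> f y"
    and mult: "\<theta>s \<in> multipliers J K"
    and dopt: "\<And>t. t \<in> multipliers J K \<Longrightarrow> dual_function \<rho> f g t \<le> dual_function \<rho> f g \<theta>s"
    and stat: "stationary \<rho> f g xs \<theta>s"
    using sol by (auto simp: primal_dual_solution_def primal_solution_def dual_solution_def)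
  show "g i xs \<in> uminus ` K i" using feas by (simp add: feasible_def)
  show \<theta>s: "\<theta>s $ i \<in> dual_cone (J i) (K i)" for i using mult by (simp add: multipliers_def)
  show dom: "xs \<in> edom (\<rho> i)" for i
  proof (rule ccontr)
    assume "xs \<notin> edom (\<rho> i)"
    then have "phi \<rho> f i xs = \<infinity>" by (simp add: edom_def phi_def)
    then have "objective \<rho> f xs = \<infinity>" unfolding objective_def by (subst sum_Pinfty) auto
    with fin show False by simp
  qed
  define \<Phi> where "\<Phi> i y = real_of_ereal (\<rho> i y) + f i y" for i y
  have phi: "phi \<rho> f i y = ereal (\<Phi> i y)" if "y \<in> edom (\<rho> i)" for i y
    unfolding phi_def \<Phi>_def by (subst edom_eq_real[OF rho that]) simp
  have obj: "objective \<rho> f xs = ereal (\<Sum>i\<in>UNIV. \<Phi> i xs)"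
    by (simp add: objective_def phi[OF dom])
  have "(INF x\<in>feasible g K. objective \<rho> f x) = objective \<rho> f xs"
    by (intro antisym INF_lower feas INF_greatest opt)
  moreover have "(SUP t\<in>multipliers J K. dual_function \<rho> f g t) = dual_function \<rho> f g \<theta>s"
    by (intro antisym SUP_upper mult SUP_least dopt)
  moreover have "dual_function \<rho> f g \<theta>s \<le> objective \<rho> f xs + ereal (\<Sum>i\<in>UNIV. \<theta>s $ i \<bullet> g i xs)"
    unfolding dual_function_def by (rule INF_lower) simp
  ultimately have "objective \<rho> f xs \<le> objective \<rho> f xs + ereal (\<Sum>i\<in>UNIV. \<theta>s $ i \<bullet> g i xs)"
    using no_gap unfolding zero_duality_gap_def by metis
  then have slack: "0 \<le> (\<Sum>i\<in>UNIV. \<theta>s $ i \<bullet> g i xs)" unfolding obj by simp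
  obtain s where s: "\<And>i. s i \<in> subdifferential (phi \<rho> f i) xs"
    "(\<Sum>i\<in>UNIV. s i + transpose (jacobian (g i) (at xs)) *v (\<theta>s $ i)) = 0"
    using stat by (auto simp: stationary_def)
  \<comment> \<open>The negative of each node's own Lagrangian subgradient: it makes
    \<open>xs\<close> minimize every block, and stationarity says that the blocks sum to
    zero.\<close>
  define \<nu>s where "\<nu>s = (\<chi> i. - (s i + transpose (jacobian (g i) (at xs)) *v (\<theta>s $ i)))"
  have sum0: "(\<Sum>i\<in>UNIV. \<nu>s $ i) = 0" unfolding \<nu>s_def vec_lambda_beta sum_negf s(2) by simp
  have "0 \<le> (\<Sum>i\<in>UNIV. \<Phi> i (z $ i)) - (\<Sum>i\<in>UNIV. \<Phi> i xs) + (\<Sum>i\<in>UNIV. \<theta>s $ i \<bullet> g i (z $ i)) + \<nu>s \<bullet> z"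
    if z: "\<And>i. z $ i \<in> edom (\<rho> i)" for z
  proof -
    have "\<Phi> i xs + \<theta>s $ i \<bullet> g i xs + \<nu>s $ i \<bullet> xs \<le> \<Phi> i (z $ i) + \<theta>s $ i \<bullet> g i (z $ i) + \<nu>s $ i \<bullet> z $ i" for i
    proof -
      have "phi \<rho> f i xs + ereal (s i \<bullet> (z $ i - xs)) \<le> phi \<rho> f i (z $ i)"
        using s(1)[of i] by (simp add: subdifferential_def)
      then have "\<Phi> i xs + s i \<bullet> (z $ i - xs) \<le> \<Phi> i (z $ i)"
        by (simp add: phi dom z)
      moreover have "\<theta>s $ i \<bullet> g i xs + (transpose (jacobian (g i) (at xs)) *v (\<theta>s $ i)) \<bullet> (z $ i - xs) \<le> \<theta>s $ i \<bullet> g i (z $ i)"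
        by (rule inner_cone_convex_gradient[OF g_convex g_diff]) (use \<theta>s[of i] in \<open>auto simp: dual_cone_def\<close>)
      ultimately show ?thesis
        by (simp add: \<nu>s_def inner_diff_right inner_add_left inner_diff_left)
    qed
    then have "(\<Sum>i\<in>UNIV. \<Phi> i xs + \<theta>s $ i \<bullet> g i xs + \<nu>s $ i \<bullet> xs) \<le> (\<Sum>i\<in>UNIV. \<Phi> i (z $ i) + \<theta>s $ i \<bullet> g i (z $ i) + \<nu>s $ i \<bullet> z $ i)"
      by (rule sum_mono)
    moreover have "(\<Sum>i\<in>UNIV. \<nu>s $ i \<bullet> xs) = 0" unfolding inner_sum_left[symmetric] sum0 by simp
    ultimately show ?thesis using slack unfolding sum.distrib inner_vec_def[of \<nu>s] by linarith
  qed
  with sum0 show "\<exists>\<nu>s. (\<Sum>i\<in>UNIV. \<nu>s $ i) = 0 \<and> (\<forall>z. (\<forall>i. z $ i \<in> edom (\<rho> i)) \<longrightarrow>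
       0 \<le> (\<Sum>i\<in>UNIV. real_of_ereal (\<rho> i (z $ i)) + f i (z $ i))
          - (\<Sum>i\<in>UNIV. real_of_ereal (\<rho> i xs) + f i xs)
          + (\<Sum>i\<in>UNIV. \<theta>s $ i \<bullet> g i (z $ i)) + \<nu>s \<bullet> z)"
    unfolding \<Phi>_def by blast
qed

lemma jacobian_affine:
  fixes A :: "real ^ 'n ^ 'm"
  assumes "\<And>x. h x = A *v x + b"
  shows "jacobian h (at x) = A"
proof -
  have "((\<lambda>x. A *v x + b) has_derivative (\<lambda>v. A *v v)) (at x)"
    using has_derivative_add[OF bounded_linear_imp_has_derivative[OF matrix_vector_mul_bounded_linear[of A]] has_derivative_const[of b], of "at x"]
    by simp
  then have "(h has_derivative (\<lambda>v. A *v v)) (at x)" using assms by presburger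
  from frechet_derivative_at[OF this] show ?thesis
    by (metis jacobian_def matrix_of_matrix_vector_mul)
qed

theorem theorem3p1:
  fixes \<rho> :: "'i::finite \<Rightarrow> real ^ 'n \<Rightarrow> ereal"
    and f :: "'i \<Rightarrow> real ^ 'n \<Rightarrow> real"
    and g :: "'i \<Rightarrow> real ^ 'n \<Rightarrow> real ^ 'm"
    and J :: "'i \<Rightarrow> 'm set"
    and K :: "'i \<Rightarrow> (real ^ 'm) set"
    and Lf Lg Cg \<mu>s :: "'i \<Rightarrow> real"
    and \<mu>bar \<mu> \<delta> \<gamma>0 \<Gamma> \<beta> :: real
    and xs :: "real ^ 'n" and \<theta>s :: "real ^ 'm ^ 'i"
    and E :: "nat \<Rightarrow> ('i \<times> 'i) set"
    and q :: "nat \<Rightarrow> nat"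
    and R :: "nat \<Rightarrow> real ^ 'n ^ 'i \<Rightarrow> real ^ 'n ^ 'i"
    and x0 :: "real ^ 'n ^ 'i"
  assumes rho: "\<And>i. proper_closed_convex (\<rho> i)"
    and f_convex: "\<And>i. convex_on UNIV (f i)"
    and cones: "\<And>i. K i \<subseteq> coord_space (J i)" "\<And>i. closed (K i)" "\<And>i. convex_cone (K i)"
    and Lf_pos: "\<And>i. Lf i > 0"
    and f_smooth: "\<And>i. \<exists>U. open U \<and> edom (\<rho> i) \<subseteq> U \<and>
           (\<forall>x\<in>U. f i differentiable (at x)) \<and> (Lf i)-lipschitz_on U (gradient (f i))"
    and no_gap: "zero_duality_gap \<rho> f g J K"
    and sol: "primal_dual_solution \<rho> f g J K xs \<theta>s"
    and g_space: "\<And>i x. g i x \<in> coord_space (J i)"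
    and g_diff: "\<And>i x. g i differentiable (at x)"
    and g_convex: "\<And>i. cone_convex (K i) (g i)"
    and Lg_pos: "\<And>i. Lg i > 0"
    and g_lipschitz: "\<And>i x y. spectral_norm (jacobian (g i) (at x) - jacobian (g i) (at y))
           \<le> Lg i * norm (x - y)"
    and Cg_pos: "\<And>i. Cg i > 0"
    and g_bound: "\<And>i x. x \<in> edom (\<rho> i) \<Longrightarrow> spectral_norm (jacobian (g i) (at x)) \<le> Cg i"
    and fbar_strong: "\<mu>bar > 0" "strongly_convex \<mu>bar (\<lambda>x. \<Sum>i\<in>UNIV. f i x)"
    and f_strong: "\<And>i. \<mu>s i > 0" "\<And>i. strongly_convex (\<mu>s i) (f i)"
    and compact_dom: "\<And>i. compact (edom (phi \<rho> f i))"
    and R_local: "\<And>k. computable_in_rounds E (\<Sum>l<k. q l) (q k) (R k)"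
    and averaging: "\<Gamma> > 0" "0 < \<beta>" "\<beta> < 1"
      "\<And>k w. norm (R k w - closest_point consensus w) \<le> real CARD('i) * \<Gamma> * \<beta> ^ q k * norm w"
    and mu: "0 < \<mu>" "\<mu> \<le> Min (range \<mu>s)"
    and delta: "\<delta> > 0"
    and gamma0: "\<gamma>0 > 0"
    and q_summable: "summable (\<lambda>k. \<beta> ^ q k * real (Suc k) ^ 4)"
  shows "\<exists>Bbar. \<forall>B.
    (B > 0 \<and> B \<ge> Bbar) \<or> (B = 0 \<and> (\<forall>i. \<exists>A b. \<forall>x. g i x = A *v x + b)) \<longrightarrow>
    (\<forall>x \<theta> \<nu> p \<omega> \<gamma> \<tau> \<tau>t \<eta> \<kappa>.
      DPDA_TV \<rho> f g J K Lf Lg Cg R x0 0 \<gamma>0 \<mu> \<delta> B x \<theta> \<nu> p \<omega> \<gamma> \<tau> \<tau>t \<eta> \<kappa> \<longrightarrow>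
      x \<longlonglongrightarrow> (\<chi> i. xs) \<and>
      (\<exists>\<Lambda> :: nat \<Rightarrow> real.
        (\<forall>n. \<Lambda> n \<ge> 0) \<and>
        \<Lambda> \<in> O(\<lambda>n. \<Sum>k=1..n. \<beta> ^ q (k - 1) * real k ^ 4) \<and>
        bdd_above (range \<Lambda>) \<and>
        (\<forall>n\<ge>1.
          max \<bar>sep_objective \<rho> f (ergodic_avg \<gamma> x n) - sep_objective \<rho> f (\<chi> i. xs)\<bar>
              (ereal (proj_dist consensus (ergodic_avg \<gamma> x n)
                 + (\<Sum>i\<in>UNIV. norm (\<theta>s $ i)
                     * proj_dist (uminus ` K i) (g i (ergodic_avg \<gamma> x n $ i)))))
            \<le> ereal (\<Lambda> n / weight_sum \<gamma> n)) \<and>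
        (\<lambda>n. \<Lambda> n / weight_sum \<gamma> n) \<in> O(\<lambda>n. 1 / (real n)\<^sup>2) \<and>
        (\<forall>n\<ge>1. (norm (x n - (\<chi> i. xs)))\<^sup>2 \<le> \<tau>t n / \<gamma> n * (4 * \<gamma>0) * \<Lambda> n) \<and>
        (\<lambda>n. \<tau>t n / \<gamma> n * (4 * \<gamma>0) * \<Lambda> n) \<in> O(\<lambda>n. 1 / (real n)\<^sup>2)) \<and>
      (\<lambda>n. max (weight_sum \<gamma> n) (\<gamma> n / \<tau>t n)) \<in> O(\<lambda>n. (real n)\<^sup>2))"
proof -
  note saddle = saddle_point_exists[OF rho no_gap sol g_diff g_convex]
  obtain \<nu>s where \<nu>s: "(\<Sum>i\<in>UNIV. \<nu>s $ i) = 0"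
    "\<And>z. (\<And>i. z $ i \<in> edom (\<rho> i)) \<Longrightarrow>
       0 \<le> (\<Sum>i\<in>UNIV. real_of_ereal (\<rho> i (z $ i)) + f i (z $ i))
          - (\<Sum>i\<in>UNIV. real_of_ereal (\<rho> i xs) + f i xs)
          + (\<Sum>i\<in>UNIV. \<theta>s $ i \<bullet> g i (z $ i)) + \<nu>s \<bullet> z"
    using saddle(4) by auto
  have "bounded (g i ` edom (\<rho> i))" for i
  proof -
    have "continuous_on (edom (\<rho> i)) (g i)"
      using g_diff[of i] by (simp add: continuous_at_imp_continuous_on differentiable_imp_continuous_within)
    then show ?thesis
      using compact_dom[of i] unfolding edom_phi by (intro compact_imp_bounded compact_continuous_image)
  qed
  then have "bounded (\<Union>i. g i ` edom (\<rho> i))" by (simp add: bounded_UN)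
  then obtain Gm where Gm: "\<And>i z. z \<in> edom (\<rho> i) \<Longrightarrow> norm (g i z) \<le> Gm"
    unfolding bounded_iff by blast
  interpret problem: dpda_problem \<rho> f g J K Lf Lg Cg \<mu>s \<mu> \<delta> \<gamma>0 \<Gamma> \<beta> xs \<theta>s \<nu>s q R Gm
    by (unfold_locales; fact rho cones Lf_pos f_smooth g_space g_diff g_convex Lg_pos Cg_pos g_bound
        f_strong f_convex compact_dom averaging mu delta gamma0 q_summable saddle(1-3) \<nu>s Gm)
  show ?thesis
  proof (intro exI[of _ problem.B_bar] allI impI, goal_cases)
    case (1 B x \<theta> \<nu> p \<omega> \<gamma> \<tau> \<tau>t \<eta> \<kappa>)
    note B = 1(1) and run = 1(2)
    have B0: "0 \<le> B" using B by auto
    \<comment> \<open>Affine constraints have constant Jacobians and take \<open>l = 0\<close>, for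
      any admissible \<open>B\<close>. Otherwise \<open>B = 0\<close> is excluded, so
      \<open>B\<close> is above the threshold and the induction on the multipliers applies.\<close>
    obtain l where l: "0 \<le> l"
      "\<And>i x y. spectral_norm (jacobian (g i) (at x) - jacobian (g i) (at y)) \<le> l * norm (x - y)"
      "l = 0 \<or> (l \<le> Max (range Lg) \<and> problem.B_bar \<le> B)"
    proof (cases "\<forall>i. \<exists>A b. \<forall>x. g i x = A *v x + b")
      case True
      have "spectral_norm (jacobian (g i) (at x) - jacobian (g i) (at y)) \<le> 0 * norm (x - y)" for i x y
      proof -
        obtain A b where "\<And>x. g i x = A *v x + b" using True by blast
        from jacobian_affine[OF this] show ?thesis by (simp add: spectral_norm_def onorm_zero)
      qed
      then show ?thesis using that[of 0] by blast
    next
      case False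
      have "Lg i \<le> Max (range Lg)" for i by simp
      then have "spectral_norm (jacobian (g i) (at x) - jacobian (g i) (at y)) \<le> Max (range Lg) * norm (x - y)" for i x y
        using g_lipschitz[of i x y] mult_right_mono[of "Lg i" "Max (range Lg)" "norm (x - y)"] by fastforce
      moreover have "0 \<le> Max (range Lg)"
        using Lg_pos[of undefined] \<open>\<And>i. Lg i \<le> Max (range Lg)\<close>[of undefined] by linarith
      ultimately show ?thesis using that[of "Max (range Lg)"] B False by blast
    qed
    interpret dpda_run \<rho> f g J K Lf Lg Cg \<mu>s \<mu> \<delta> \<gamma>0 \<Gamma> \<beta> xs \<theta>s \<nu>s q R Gm x0 B l x \<theta> \<nu> p \<omega> \<gamma> \<tau> \<tau>t \<eta> \<kappa>
      by (unfold_locales; fact B0 run l(1,2))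
    have l\<theta>: "l * norm (\<theta> k $ i) \<le> B * Max (range Lg)" for k i
      using l(3)
    proof
      assume "l = 0"
      then show ?thesis using B0 Lg\<^sub>m(2) by simp
    next
      assume *: "l \<le> Max (range Lg) \<and> problem.B_bar \<le> B"
      then have "l * norm (\<theta> k $ i) \<le> Max (range Lg) * B"
        using \<theta>_bounded[of k i] Lg\<^sub>m(2) by (intro mult_mono) auto
      then show ?thesis by (simp add: mult.commute)
    qed
    have bdd: "bdd_above (range (\<lambda>_::nat. rate_const))" by simp
    note rates = iterates_converge[OF l\<theta>] rate_const_nonneg[OF l\<theta>] rate_const_bigo[OF l\<theta>] bdd
      ergodic_rate[OF l\<theta>] weight_rate_bigo[OF l\<theta>] distance_rate[OF l\<theta>] distance_rate_bigo[OF l\<theta>]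
      parameter_bigo[OF l\<theta>]
    show ?case
      by (intro conjI exI[of _ "\<lambda>_. rate_const"] allI impI; fact rates[unfolded problem.X\<^sub>s_def])
  qed
qed

end
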